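(* Let $\alpha_1\ge4$ be the constant of the Kulikov–Dam Larsen theorem (recalled in the context). Then the following are equivalent. (i) There exist constants $\alpha\ge4$, $\delta_0\in(0,\tfrac12)$, $\kappa>0$, $C<\infty$, $c_0<\infty$ such that $D(\delta,c)\ge\kappa L\ln\bigl(\frac{\alpha c}{L}\bigr)-C$ for every $c\ge c_0$ and every $\delta$ with $\alpha^{-c}<\delta\le\delta_0$. (ii) There exist $\kappa_T>0$, $L_T<\infty$, $c_T<\infty$ such that for all $c\ge c_T$ and all $u\in[L_T,\alpha_1\ln c]$, $$\ln\det\bigl(I+(e^u-1)S_c\bigr)\ge u\,c+\kappa_T\,u^2\ln c.$$
   Context: For $c>0$, $S_c$ is the positive trace-class integral operator on $L^2(0,c)$ with kernel $\frac{\sin(\pi(x-y))}{\pi(x-y)}$ (equal to $1$ for $x=y$); its eigenvalues are simple, $1>\lambda_0(c)>\lambda_1(c)>\cdots>0$; $\det$ is the Fredholm determinant. For $0<\delta<\tfrac12$, $L=\ln\frac1\delta$, $\Lambda^+_\delta(c)=\#\{n:\tfrac12<\lambda_n(c)\le1-\delta\}$ and $D(\delta,c)=\Lambda^-_\delta(c)=\#\{n:\delta<\lambda_n(c)\le\tfrac12\}$. $\ln$ is the natural logarithm. Kulikov–Dam Larsen theorem (known result, dimension one; may be used): there exists a constant $\alpha_1\ge4$ such that, for every $c\ge2$, with $L=\ln\frac1\varepsilon$ and $R=\ln\frac{\alpha_1c}{L}$, and with absolute implied constants: (a) uniformly for $\alpha_1^{-c}<\varepsilon<\tfrac12$, $\Lambda^\pm_\varepsilon(c)\lesssim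 LR$; (b) if moreover $\varepsilon<c^{-\alpha_1}$, then also $\Lambda^\pm_\varepsilon(c)\gtrsim LR$; (c) if $\varepsilon\le\alpha_1^{-c}$ there are no eigenvalues above $1-\varepsilon$ and $\Lambda^-_\varepsilon(c)\asymp L/\ln(L/c)$. (Open/closed endpoint conventions may change the counts by at most $2$.) Such an $\alpha_1$ is fixed. *)

theory Defs
  imports "HOL-Analysis.Analysis" "Jordan_Normal_Form.Determinant"
begin

text \<open>Everything below is meant for \<open>c > 0\<close>. Elements of \<open>L\<^sup>2(0,c)\<close> are represented by
  square-integrable functions, with equality almost everywhere written out where it matters.\<close>

definition interval_measure :: "real \<Rightarrow> real measure" where
  "interval_measure c = restrict_space lborel {0<..<c}"

definition square_integrable :: "real \<Rightarrow> (real \<Rightarrow> complex) \<Rightarrow> bool" where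
  "square_integrable c f \<longleftrightarrow>
     f \<in> borel_measurable (interval_measure c) \<and>
     integrable (interval_measure c) (\<lambda>x. (cmod (f x))\<^sup>2)"

definition sinc_kernel :: "real \<Rightarrow> real \<Rightarrow> real" where
  "sinc_kernel x y = (if x = y then 1 else sin (pi * (x - y)) / (pi * (x - y)))"

definition sinc_op :: "real \<Rightarrow> (real \<Rightarrow> complex) \<Rightarrow> real \<Rightarrow> complex" where
  "sinc_op c f x = (LINT y|interval_measure c. complex_of_real (sinc_kernel x y) * f y)"

definition in_eigenspace :: "real \<Rightarrow> real \<Rightarrow> (real \<Rightarrow> complex) \<Rightarrow> bool" where
  "in_eigenspace c \<mu> f \<longleftrightarrow>
     square_integrable c f \<and>
     (AE x in interval_measure c. sinc_op c f x = complex_of_real \<mu> * f x)"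

text \<open>The \<open>\<mu>\<close>-eigenspace, as a subspace of \<open>L\<^sup>2(0,c)\<close>, has a basis of \<open>d\<close> elements
  (\<open>d = 0\<close> means that \<open>\<mu>\<close> is not an eigenvalue).\<close>

definition eigenspace_dim :: "real \<Rightarrow> real \<Rightarrow> nat \<Rightarrow> bool" where
  "eigenspace_dim c \<mu> d \<longleftrightarrow>
     (\<exists>\<phi> :: nat \<Rightarrow> real \<Rightarrow> complex.
        (\<forall>i<d. in_eigenspace c \<mu> (\<phi> i)) \<and>
        (\<forall>a :: nat \<Rightarrow> complex.
           (AE x in interval_measure c. (\<Sum>i<d. a i * \<phi> i x) = 0) \<longrightarrow> (\<forall>i<d. a i = 0)) \<and>
        (\<forall>f. in_eigenspace c \<mu> f \<longrightarrow>
           (\<exists>a :: nat \<Rightarrow> complex.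
              AE x in interval_measure c. f x = (\<Sum>i<d. a i * \<phi> i x))))"

text \<open>The eigenvalues are listed in decreasing order and repeated according to multiplicity.
  As they are in fact simple, this is the strictly decreasing list of the positive eigenvalues;
  the definition does not rely on simplicity. Finiteness is stated because \<open>card\<close> of an
  infinite set is 0.\<close>

definition eigenvalue_list :: "real \<Rightarrow> (nat \<Rightarrow> real) \<Rightarrow> bool" where
  "eigenvalue_list c l \<longleftrightarrow>
     decseq l \<and> (\<forall>n. 0 < l n) \<and>
     (\<forall>\<mu>>0. finite {n. l n = \<mu>} \<and> eigenspace_dim c \<mu> (card {n. l n = \<mu>}))"

text \<open>For \<open>c > 0\<close> there is exactly one such sequence, so the choice operator chooses nothing.\<close>

definition eigval :: "real \<Rightarrow> nat \<Rightarrow> real" where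
  "eigval c = (SOME l. eigenvalue_list c l)"

definition Lambda_plus :: "real \<Rightarrow> real \<Rightarrow> nat" where
  "Lambda_plus \<delta> c = card {n. 1/2 < eigval c n \<and> eigval c n \<le> 1 - \<delta>}"

definition Lambda_minus :: "real \<Rightarrow> real \<Rightarrow> nat" where
  "Lambda_minus \<delta> c = card {n. \<delta> < eigval c n \<and> eigval c n \<le> 1/2}"

text \<open>Fredholm's series for \<open>det (I + z T)\<close>, where \<open>T\<close> is the integral operator on
  \<open>L\<^sup>2(0,c)\<close> with kernel \<open>K\<close>:
  the sum over \<open>n\<close> of \<open>z\<^sup>n / n!\<close> times the integral over \<open>(0,c)\<^sup>n\<close> of the determinant of
  the matrix with entries \<open>K(x\<^sub>i, x\<^sub>j)\<close>.\<close>

definition fredholm_det :: "real \<Rightarrow> (real \<Rightarrow> real \<Rightarrow> real) \<Rightarrow> real \<Rightarrow> real" where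
  "fredholm_det c K z =
     (\<Sum>n. z ^ n / fact n *
        (LINT x|Pi\<^sub>M {..<n} (\<lambda>_. interval_measure c).
           Determinant.det (Matrix.mat n n (\<lambda>(i, j). K (x i) (x j)))))"

text \<open>The conclusion of the Kulikov--Dam Larsen theorem in dimension one, as a property of the
  constant \<open>\<alpha>\<close>. The implied constants \<open>A\<close>, \<open>a\<close> do not depend on \<open>c\<close> and \<open>\<epsilon>\<close>.\<close>

definition KDL_constant :: "real \<Rightarrow> bool" where
  "KDL_constant \<alpha> \<longleftrightarrow>
     \<alpha> \<ge> 4 \<and>
     (\<exists>A>0. \<forall>c\<ge>2. \<forall>\<epsilon>. \<alpha> powr (- c) < \<epsilon> \<and> \<epsilon> < 1/2 \<longrightarrow>
        real (Lambda_plus \<epsilon> c) \<le> A * (ln (1/\<epsilon>) * ln (\<alpha> * c / ln (1/\<epsilon>))) \<and>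
        real (Lambda_minus \<epsilon> c) \<le> A * (ln (1/\<epsilon>) * ln (\<alpha> * c / ln (1/\<epsilon>)))) \<and>
     (\<exists>a>0. \<forall>c\<ge>2. \<forall>\<epsilon>. \<alpha> powr (- c) < \<epsilon> \<and> \<epsilon> < 1/2 \<and> \<epsilon> < c powr (- \<alpha>) \<longrightarrow>
        a * (ln (1/\<epsilon>) * ln (\<alpha> * c / ln (1/\<epsilon>))) \<le> real (Lambda_plus \<epsilon> c) \<and>
        a * (ln (1/\<epsilon>) * ln (\<alpha> * c / ln (1/\<epsilon>))) \<le> real (Lambda_minus \<epsilon> c)) \<and>
     (\<exists>a>0. \<exists>A>0. \<forall>c\<ge>2. \<forall>\<epsilon>. 0 < \<epsilon> \<and> \<epsilon> \<le> \<alpha> powr (- c) \<longrightarrow>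
        (\<forall>n. eigval c n \<le> 1 - \<epsilon>) \<and>
        a * (ln (1/\<epsilon>) / ln (ln (1/\<epsilon>) / c)) \<le> real (Lambda_minus \<epsilon> c) \<and>
        real (Lambda_minus \<epsilon> c) \<le> A * (ln (1/\<epsilon>) / ln (ln (1/\<epsilon>) / c)))"

end

theory Submission
  imports Defs "HOL-Complex_Analysis.Great_Picard"
begin

text \<open>By Mercer's theorem and a finite-rank approximation, the Fredholm determinant is the product of
  the factors \<open>1 + (exp u - 1) * \<lambda>\<close> over the eigenvalues \<open>\<lambda>\<close>, and the eigenvalues sum to \<open>c\<close>.
  Hence \<open>ln det - u * c\<close> is the sum of \<open>g \<lambda> = ln (1 + (exp u - 1) * \<lambda>) - u * \<lambda>\<close>, which is
  nonnegative. As \<open>g \<lambda>\<close> is of order \<open>u\<close> for \<open>\<lambda>\<close> between a power of \<open>exp (- u)\<close> and \<open>1/2\<close>, lower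
  bounds for the counting function give lower bounds for the sum. Conversely \<open>g \<lambda> \<le> u * (1 - \<lambda>)\<close>, so
  by the upper bounds of Kulikov and Dam Larsen the eigenvalues above \<open>1/2\<close> contribute only
  \<open>O(u ln c)\<close>, and those below \<open>exp (- 2 * u)\<close> only \<open>O(ln c)\<close>. This gives the lower bound for \<open>D\<close> as
  long as \<open>\<delta> \<ge> exp (- 2 * \<alpha>\<^sub>1 * ln c)\<close>; for smaller \<open>\<delta>\<close> it is part of the Kulikov--Dam Larsen
  theorem.\<close>

section \<open>Spectral expansion of positive kernels\<close>

text \<open>\<open>eigval\<close> is a choice from lists described only through eigenspaces in
  complex L2, while the determinant is a series of multiple integrals; only a full spectral theorem
  connects the two. It is proved for real continuous functions, where Arzela-Ascoli supplies the
  compactness; complex functions enter only when the resulting list is identified with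
  \<open>eigval\<close>. Strict positivity of the sinc form makes that list infinite. The counting
  bound and the determinant bound are matched at thresholds exp (- u / 4) and exp (- 2 * u). Such
  factors in the exponent are harmless, since they change ln (1 / \<delta>) only by a constant
  factor. The error O(u ln c) has one power of u less than u^2 ln c, so a large lower limit for u
  absorbs it. The restriction u \<le> \<open>\<alpha>\<^sub>1 * ln c\<close> acts twice: it keeps u
  below sqrt c, so that the logarithm in the counting bound is comparable to ln c, and it lets
  \<delta> = exp (- 2 * u) go down to the power - 2 * \<open>\<alpha>\<^sub>1\<close> of c, past the
  power - \<open>\<alpha>\<^sub>1\<close> where the known lower bound takes over.\<close>

definition ip :: "real \<Rightarrow> (real \<Rightarrow> real) \<Rightarrow> (real \<Rightarrow> real) \<Rightarrow> real" where
  "ip c f g = integral {0..c} (\<lambda>x. f x * g x)"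

definition kop :: "real \<Rightarrow> (real \<Rightarrow> real \<Rightarrow> real) \<Rightarrow> (real \<Rightarrow> real) \<Rightarrow> real \<Rightarrow> real" where
  "kop c K f x = integral {0..c} (\<lambda>y. K x y * f y)"

text \<open>Positivity is required of the quadratic form of \<open>K\<close> on sums of a continuous function and
  a point mass, because this form is inherited by the deflated kernels and gives bounds at points.\<close>

definition psd_kernel :: "real \<Rightarrow> (real \<Rightarrow> real \<Rightarrow> real) \<Rightarrow> bool" where
  "psd_kernel c K \<longleftrightarrow>
     continuous_on ({0..c} \<times> {0..c}) (\<lambda>(x, y). K x y) \<and>
     (\<forall>x\<in>{0..c}. \<forall>y\<in>{0..c}. K x y = K y x) \<and>
     (\<forall>x\<in>{0..c}. \<forall>a f. continuous_on {0..c} f \<longrightarrow>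
        0 \<le> a\<^sup>2 * K x x + 2 * a * kop c K f x + ip c (kop c K f) f)"

text \<open>Abstract Cauchy-Schwarz: applied to the form of a kernel on a point mass plus a
  function, it yields \<open>kop_point_bound\<close>. For \<open>A = 0\<close> the polynomial is
  affine, and an affine function bounded below is constant.\<close>

lemma quadratic_nonneg_discriminant:
  fixes A B C :: real
  assumes "\<And>t. 0 \<le> t\<^sup>2 * A + 2 * t * B + C"
  shows "B\<^sup>2 \<le> A * C"
proof (cases "A = 0")
  case True
  have "B = 0"
  proof (rule ccontr)
    assume "B \<noteq> 0"
    \<comment> \<open>At this t the polynomial takes the value -1.\<close>
    then have "2 * (- (C + 1) / (2 * B)) * B = - (C + 1)" by simp
    then show False using assms[of "- (C + 1) / (2 * B)"] True by simp
  qed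
  then show ?thesis using True by simp
next
  case False
  have "0 \<le> A"
  proof (rule ccontr)
    assume "\<not> 0 \<le> A"
    \<comment> \<open>For negative \<open>A\<close> the quadratic is negative far out;
      \<open>s\<close> is so large that its leading term outweighs the linear and the constant
      one.\<close>
    define s where "s = (2 * \<bar>B\<bar> + \<bar>C\<bar> + 1) / - A + 1"
    have s: "s \<ge> 1" using \<open>\<not> 0 \<le> A\<close> by (simp add: s_def divide_nonneg_neg)
    have "s * - A \<ge> 2 * \<bar>B\<bar> + \<bar>C\<bar> + 1"
      using \<open>\<not> 0 \<le> A\<close> by (simp add: s_def field_simps)
    then have "s * (s * - A) \<ge> s * (2 * \<bar>B\<bar> + \<bar>C\<bar> + 1)" using s by (intro mult_left_mono) auto
    moreover have "s * (\<bar>C\<bar> + 1) \<ge> 1 * (\<bar>C\<bar> + 1)" using s by (intro mult_right_mono) auto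
    moreover have "s * \<bar>B\<bar> \<ge> s * B" using s by (intro mult_left_mono) auto
    ultimately show False using assms[of s] by (simp add: algebra_simps power2_eq_square)
  qed
  then have "0 < A" using False by simp
  have e: "(- B / A)\<^sup>2 * A + 2 * (- B / A) * B + C = C - B\<^sup>2 / A"
    using \<open>0 < A\<close> by (simp add: power2_eq_square field_simps)
  have "B\<^sup>2 / A \<le> C" using assms[of "- B / A"] unfolding e by simp
  then show ?thesis using \<open>0 < A\<close> by (simp add: field_simps)
qed

section \<open>The real inner product on continuous functions\<close>

lemma ip_commute: "ip c f g = ip c g f"
  by (simp add: ip_def mult.commute)

lemma ip_cong:
  assumes "\<And>x. x \<in> {0..c} \<Longrightarrow> f x = f' x" "\<And>x. x \<in> {0..c} \<Longrightarrow> g x = g' x"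
  shows "ip c f g = ip c f' g'"
  unfolding ip_def by (rule integral_cong) (simp add: assms)

lemma ip_add_scale:
  assumes "continuous_on {0..c} f" "continuous_on {0..c} g" "continuous_on {0..c} h"
  shows "ip c (\<lambda>x. f x + a * g x) h = ip c f h + a * ip c g h"
proof -
  have "ip c (\<lambda>x. f x + a * g x) h = integral {0..c} (\<lambda>x. f x * h x + a * (g x * h x))"
    by (simp add: ip_def algebra_simps)
  also have "\<dots> = integral {0..c} (\<lambda>x. f x * h x) + integral {0..c} (\<lambda>x. a * (g x * h x))"
    by (intro integral_add integrable_continuous_interval continuous_intros assms)
  finally show ?thesis by (simp add: ip_def)
qed

lemma ip_add_scale_right:
  assumes "continuous_on {0..c} f" "continuous_on {0..c} g" "continuous_on {0..c} h"
  shows "ip c h (\<lambda>x. f x + a * g x) = ip c h f + a * ip c h g"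
  using ip_add_scale[OF assms] by (simp add: ip_commute)

lemma ip_scale: "ip c (\<lambda>x. a * f x) g = a * ip c f g"
  by (simp add: ip_def mult.assoc)

lemma ip_scale_right: "ip c g (\<lambda>x. a * f x) = a * ip c g f"
  by (simp add: ip_def algebra_simps)

lemma ip_sum:
  assumes "finite J" "\<And>j. j \<in> J \<Longrightarrow> continuous_on {0..c} (g j)" "continuous_on {0..c} h"
  shows "ip c (\<lambda>x. \<Sum>j\<in>J. a j * g j x) h = (\<Sum>j\<in>J. a j * ip c (g j) h)"
  using assms(1,2)
proof (induction J rule: finite_induct)
  case (insert i J)
  have c: "continuous_on {0..c} (\<lambda>x. \<Sum>j\<in>J. a j * g j x)"
    by (intro continuous_intros) (use insert in auto)
  have "ip c (\<lambda>x. \<Sum>j\<in>insert i J. a j * g j x) h = ip c (\<lambda>x. (\<Sum>j\<in>J. a j * g j x) + a i * g i x) h"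
    using insert by (intro ip_cong) (auto simp: add.commute)
  also have "\<dots> = ip c (\<lambda>x. (\<Sum>j\<in>J. a j * g j x)) h + a i * ip c (g i) h"
    by (rule ip_add_scale[OF c]) (use insert assms in auto)
  finally show ?case using insert by (simp add: add.commute)
qed (simp add: ip_def)

lemma ip_self_nonneg: "0 \<le> ip c f f"
  unfolding ip_def
  \<comment> \<open>A square that is not integrable has \<open>integral\<close> 0 by convention, so
    both cases give a nonnegative value.\<close>
  by (cases "(\<lambda>x. f x * f x) integrable_on {0..c}")
     (auto intro: integral_nonneg simp: not_integrable_integral)

lemma ip_self_eq_0:
  assumes "0 < c" "continuous_on {0..c} f" "ip c f f = 0" "x \<in> {0..c}"
  shows "f x = 0"
proof -
  have "continuous_on {0..c} (\<lambda>x. f x * f x)" by (intro continuous_intros assms)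
  from integral_eq_0_iff[OF this assms(1)] assms(3,4) show ?thesis by (auto simp: ip_def)
qed

lemma ip_uniform_limit:
  assumes "uniform_limit {0..c} f g sequentially" "\<And>n. continuous_on {0..c} (f n)"
    and "uniform_limit {0..c} f' g' sequentially" "\<And>n. continuous_on {0..c} (f' n)"
  shows "(\<lambda>n. ip c (f n) (f' n)) \<longlonglongrightarrow> ip c g g'"
proof -
  have cg: "continuous_on {0..c} g"
    by (rule uniform_limit_theorem[OF _ assms(1)]) (use assms in auto)
  have cg': "continuous_on {0..c} g'"
    by (rule uniform_limit_theorem[OF _ assms(3)]) (use assms in auto)
  have "uniform_limit {0..c} (\<lambda>n x. f n x * f' n x) (\<lambda>x. g x * g' x) sequentially"
    by (rule uniform_lim_mult[OF assms(1,3)])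
       (use cg cg' in \<open>auto intro!: compact_imp_bounded compact_continuous_image\<close>)
  then obtain I J where *: "\<And>n. ((\<lambda>x. f n x * f' n x) has_integral I n) {0..c}"
    "((\<lambda>x. g x * g' x) has_integral J) {0..c}" "(I \<longlongrightarrow> J) sequentially"
    by (rule uniform_limit_integral) (auto intro!: continuous_intros assms)
  have "I = (\<lambda>n. ip c (f n) (f' n))"
    by (rule ext) (use *(1) in \<open>simp add: ip_def integral_unique[THEN sym]\<close>)
  moreover have "J = ip c g g'" using *(2) by (simp add: ip_def integral_unique)
  ultimately show ?thesis using *(3) by simp
qed

section \<open>A positive kernel, its top eigenpair and its deflation\<close>

locale interval_kernel =
  fixes c :: real and K :: "real \<Rightarrow> real \<Rightarrow> real"
  assumes c_pos: "0 < c" and psd: "psd_kernel c K"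
begin

lemma K_cont: "continuous_on ({0..c} \<times> {0..c}) (\<lambda>(x, y). K x y)"
  and K_sym: "x \<in> {0..c} \<Longrightarrow> y \<in> {0..c} \<Longrightarrow> K x y = K y x"
  and K_psd: "x \<in> {0..c} \<Longrightarrow> continuous_on {0..c} f \<Longrightarrow>
      0 \<le> a\<^sup>2 * K x x + 2 * a * kop c K f x + ip c (kop c K f) f"
  using psd by (auto simp: psd_kernel_def)

lemma K_cont_compose:
  "continuous_on S f \<Longrightarrow> continuous_on S g \<Longrightarrow> f ` S \<subseteq> {0..c} \<Longrightarrow> g ` S \<subseteq> {0..c} \<Longrightarrow>
   continuous_on S (\<lambda>z. K (f z) (g z))"
  using continuous_on_compose2[OF K_cont, of S "\<lambda>z. (f z, g z)"]
  by (auto intro!: continuous_intros simp: image_subset_iff)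

lemma K_row_cont: "x \<in> {0..c} \<Longrightarrow> continuous_on {0..c} (\<lambda>y. K x y)"
  by (rule K_cont_compose) (auto intro!: continuous_intros)

lemma kop_row: "kop c K f x = ip c (K x) f"
  by (simp add: kop_def ip_def)

lemma kop_add_scale:
  assumes "x \<in> {0..c}" "continuous_on {0..c} f" "continuous_on {0..c} g"
  shows "kop c K (\<lambda>x. f x + a * g x) x = kop c K f x + a * kop c K g x"
  unfolding kop_row by (rule ip_add_scale_right[OF assms(2,3) K_row_cont[OF assms(1)]])

lemma kop_scale: "kop c K (\<lambda>x. a * f x) x = a * kop c K f x"
  unfolding kop_row by (rule ip_scale_right)

lemma kop_cont:
  assumes "continuous_on {0..c} f"
  shows "continuous_on {0..c} (kop c K f)"
proof -
  have "continuous_on ({0..c} \<times> cbox 0 c) (\<lambda>(x, y). K x y * f y)"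
    using K_cont by (auto intro!: continuous_intros continuous_on_compose2[OF assms] simp: split_beta)
  from integral_continuous_on_param[OF this] show ?thesis
    by (simp add: kop_def[abs_def])
qed

lemma kop_sym:
  assumes f: "continuous_on {0..c} f" and g: "continuous_on {0..c} g"
  shows "ip c (kop c K f) g = ip c f (kop c K g)"
proof -
  have "continuous_on (cbox (0, 0) (c, c)) (\<lambda>(x, y). g x * (K x y * f y))"
    using K_cont by (auto intro!: continuous_intros continuous_on_compose2[OF f] continuous_on_compose2[OF g]
      simp: split_beta cbox_Pair_eq)
  from integral_swap_continuous[OF this]
  have "integral {0..c} (\<lambda>x. integral {0..c} (\<lambda>y. g x * (K x y * f y))) =
        integral {0..c} (\<lambda>y. integral {0..c} (\<lambda>x. g x * (K x y * f y)))" by simp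
  moreover have "ip c (kop c K f) g = integral {0..c} (\<lambda>x. integral {0..c} (\<lambda>y. g x * (K x y * f y)))"
    by (simp add: ip_def kop_def mult.commute)
  moreover have "ip c f (kop c K g) = integral {0..c} (\<lambda>y. integral {0..c} (\<lambda>x. g x * (K x y * f y)))"
    unfolding ip_def kop_def
  proof (rule integral_cong)
    fix y assume y: "y \<in> {0..c}"
    have "integral {0..c} (\<lambda>x. K y x * g x) = integral {0..c} (\<lambda>x. g x * K x y)"
      by (rule integral_cong) (simp add: K_sym[OF y] mult.commute)
    moreover have "integral {0..c} (\<lambda>x. g x * (K x y * f y)) = integral {0..c} (\<lambda>x. f y * (g x * K x y))"
      by (simp add: algebra_simps)
    ultimately show "f y * integral {0..c} (\<lambda>x. K y x * g x) = integral {0..c} (\<lambda>x. g x * (K x y * f y))"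
      by simp
  qed
  ultimately show ?thesis by simp
qed

lemma form_nonneg: "continuous_on {0..c} f \<Longrightarrow> 0 \<le> ip c (kop c K f) f"
  using K_psd[of 0 f 0] c_pos by simp

lemma diag_nonneg: "x \<in> {0..c} \<Longrightarrow> 0 \<le> K x x"
  using K_psd[of x "\<lambda>_. 0" 1] c_pos by (simp add: kop_def ip_def)

text \<open>Cauchy-Schwarz for the form of \<open>K\<close> between a point mass at x and f. It
  turns smallness of the quadratic form into smallness at every point.\<close>

lemma kop_point_bound:
  assumes "x \<in> {0..c}" "continuous_on {0..c} f"
  shows "(kop c K f x)\<^sup>2 \<le> K x x * ip c (kop c K f) f"
  by (rule quadratic_nonneg_discriminant) (use K_psd[OF assms] in \<open>auto simp: algebra_simps\<close>)

lemma form_add_scale: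
  assumes f: "continuous_on {0..c} f" and g: "continuous_on {0..c} g"
  shows "ip c (kop c K (\<lambda>x. f x + a * g x)) (\<lambda>x. f x + a * g x) =
    ip c (kop c K f) f + 2 * a * ip c (kop c K f) g + a\<^sup>2 * ip c (kop c K g) g"
proof -
  note cf = kop_cont[OF f] and cg = kop_cont[OF g]
  have "ip c (kop c K (\<lambda>x. f x + a * g x)) (\<lambda>x. f x + a * g x) =
    ip c (\<lambda>x. kop c K f x + a * kop c K g x) (\<lambda>x. f x + a * g x)"
    by (intro ip_cong kop_add_scale f g) auto
  also have "\<dots> = ip c (kop c K f) (\<lambda>x. f x + a * g x) + a * ip c (kop c K g) (\<lambda>x. f x + a * g x)"
    by (intro ip_add_scale cf cg continuous_intros f g)
  also have "\<dots> = ip c (kop c K f) f + 2 * a * ip c (kop c K f) g + a\<^sup>2 * ip c (kop c K g) g"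
    using kop_sym[OF g f] by (simp add: ip_add_scale_right f g cf cg ip_commute algebra_simps power2_eq_square)
  finally show ?thesis .
qed

lemma K_bounded:
  obtains B where "0 < B" "\<And>x y. x \<in> {0..c} \<Longrightarrow> y \<in> {0..c} \<Longrightarrow> \<bar>K x y\<bar> \<le> B"
proof -
  have "compact ((\<lambda>(x, y). K x y) ` ({0..c} \<times> {0..c}))"
    by (intro compact_continuous_image K_cont compact_Times) auto
  from compact_imp_bounded[OF this] show thesis
    unfolding bounded_pos by (auto intro!: that)
qed

text \<open>The pointwise inequality between the absolute value of f and (1 + f^2) / 2 replaces
  Cauchy-Schwarz for integrals; integrated over an interval of length c, for normalized f, it gives
  the factor (c + 1) / 2.\<close>

lemma ip_unit_bound:
  assumes "continuous_on {0..c} f" "ip c f f = 1"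
    and "continuous_on {0..c} k" "\<And>y. y \<in> {0..c} \<Longrightarrow> \<bar>k y\<bar> \<le> B"
  shows "\<bar>ip c k f\<bar> \<le> B * ((c + 1) / 2)"
proof -
  have "norm (integral {0..c} (\<lambda>y. k y * f y)) \<le> integral {0..c} (\<lambda>y. (B / 2) * (1 + f y * f y))"
  proof (rule Henstock_Kurzweil_Integration.integral_norm_bound_integral)
    show "(\<lambda>y. k y * f y) integrable_on {0..c}" "(\<lambda>y. (B / 2) * (1 + f y * f y)) integrable_on {0..c}"
      by (intro integrable_continuous_interval continuous_intros assms)+
    fix y assume y: "y \<in> {0..c}"
    have "0 \<le> (\<bar>f y\<bar> - 1)\<^sup>2" by simp
    then have "\<bar>f y\<bar> \<le> (1 + f y * f y) / 2" by (simp add: power2_eq_square algebra_simps)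
    then have "\<bar>k y\<bar> * \<bar>f y\<bar> \<le> B * ((1 + f y * f y) / 2)"
      using assms(4)[OF y] by (intro mult_mono) auto
    then show "norm (k y * f y) \<le> (B / 2) * (1 + f y * f y)"
      by (simp add: abs_mult)
  qed
  also have "integral {0..c} (\<lambda>y. (B / 2) * (1 + f y * f y)) =
      (B / 2) * (integral {0..c} (\<lambda>y. 1) + integral {0..c} (\<lambda>y. f y * f y))"
    by (subst integral_mult_right, subst Henstock_Kurzweil_Integration.integral_add)
      (auto intro!: integrable_continuous_interval continuous_intros assms)
  finally show ?thesis using assms(2) c_pos by (simp add: ip_def)
qed

text \<open>The last clause makes \<mu> the maximum of the Rayleigh quotient, not just some
  eigenvalue. Maximality gives the decreasing order of the eigenvalues and bounds the forms of the
  remainder kernels.\<close>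

definition top_eigenpair :: "real \<Rightarrow> (real \<Rightarrow> real) \<Rightarrow> bool" where
  "top_eigenpair \<mu> \<phi> \<longleftrightarrow> 0 < \<mu> \<and> continuous_on {0..c} \<phi> \<and> ip c \<phi> \<phi> = 1 \<and>
     (\<forall>x\<in>{0..c}. kop c K \<phi> x = \<mu> * \<phi> x) \<and>
     (\<forall>f. continuous_on {0..c} f \<longrightarrow> ip c (kop c K f) f \<le> \<mu> * ip c f f)"

text \<open>A maximizing sequence need not converge, but its image under the operator has a uniformly
  convergent subsequence, whose limit is an eigenfunction.\<close>

lemma top_eigenpair_exists:
  assumes f0: "continuous_on {0..c} f\<^sub>0" "0 < ip c (kop c K f\<^sub>0) f\<^sub>0"
  shows "\<exists>\<mu> \<phi>. top_eigenpair \<mu> \<phi>"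
proof -
  obtain B where B: "0 < B" "\<And>x y. x \<in> {0..c} \<Longrightarrow> y \<in> {0..c} \<Longrightarrow> \<bar>K x y\<bar> \<le> B"
    using K_bounded by blast
  define q where "q f = ip c (kop c K f) f" for f
  define B1 where "B1 = B * ((c + 1) / 2)"
  define S where "S = {q f |f. continuous_on {0..c} f \<and> ip c f f = 1}"
  define \<mu> where "\<mu> = Sup S"
  have Tbd: "\<bar>kop c K f x\<bar> \<le> B1" if "continuous_on {0..c} f" "ip c f f = 1" "x \<in> {0..c}" for f x
    unfolding kop_row B1_def by (rule ip_unit_bound) (use that B K_row_cont in auto)
  have qbd: "q f \<le> B1 * ((c + 1) / 2)" if "continuous_on {0..c} f" "ip c f f = 1" for f
    using ip_unit_bound[OF that kop_cont[OF that(1)] Tbd[OF that]] by (simp add: q_def)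
  have bdd: "bdd_above S" unfolding S_def bdd_above_def using qbd by blast
  have q_scale: "q (\<lambda>x. a * f x) = a\<^sup>2 * q f" for a f
    by (simp add: q_def kop_scale[abs_def] ip_scale ip_scale_right power2_eq_square)
  have normalize: "continuous_on {0..c} (\<lambda>x. (1 / sqrt (ip c f f)) * f x)"
      "ip c (\<lambda>x. (1 / sqrt (ip c f f)) * f x) (\<lambda>x. (1 / sqrt (ip c f f)) * f x) = 1"
      "q (\<lambda>x. (1 / sqrt (ip c f f)) * f x) = q f / ip c f f"
    if "continuous_on {0..c} f" "ip c f f \<noteq> 0" for f
  proof -
    have "0 < ip c f f" using that(2) ip_self_nonneg[of c f] by linarith
    then show "ip c (\<lambda>x. (1 / sqrt (ip c f f)) * f x) (\<lambda>x. (1 / sqrt (ip c f f)) * f x) = 1"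
      "q (\<lambda>x. (1 / sqrt (ip c f f)) * f x) = q f / ip c f f"
      unfolding q_scale ip_scale ip_scale_right by (simp_all add: power_divide)
  qed (intro continuous_intros that)
  have q0: "q f = 0" if "continuous_on {0..c} f" "ip c f f = 0" for f
  proof -
    have "q f = ip c (kop c K f) (\<lambda>_. 0)"
      unfolding q_def by (rule ip_cong) (use ip_self_eq_0[OF c_pos that] in auto)
    then show ?thesis by (simp add: ip_def)
  qed
  have q_le: "q f \<le> \<mu> * ip c f f" if "continuous_on {0..c} f" for f
  proof (cases "ip c f f = 0")
    case False
    have "q f / ip c f f \<in> S" unfolding S_def using normalize[OF that False] by force
    then have "q f / ip c f f \<le> \<mu>" unfolding \<mu>_def using bdd by (rule cSup_upper)
    then show ?thesis using False ip_self_nonneg[of c f] by (simp add: field_simps)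
  qed (simp add: q0[OF that])
  have ip0: "ip c f\<^sub>0 f\<^sub>0 \<noteq> 0" using f0 q0 q_def by fastforce
  then have ne: "S \<noteq> {}" unfolding S_def using normalize[OF f0(1)] by blast
  have \<mu>: "0 < \<mu>"
    using q_le[OF f0(1)] f0(2) mult_nonpos_nonneg[OF _ ip_self_nonneg[of c f\<^sub>0], of \<mu>]
    unfolding q_def by linarith
  have "\<exists>f. continuous_on {0..c} f \<and> ip c f f = 1 \<and> \<mu> - 1 / real (Suc n) < q f" for n
  proof -
    have "\<mu> - 1 / real (Suc n) < Sup S" unfolding \<mu>_def by simp
    from less_cSupE[OF this ne] show ?thesis unfolding S_def by blast
  qed
  then obtain F where F: "\<And>n. continuous_on {0..c} (F n)" "\<And>n. ip c (F n) (F n) = 1"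
    "\<And>n. \<mu> - 1 / real (Suc n) < q (F n)" by metis
  define G where "G n = kop c K (F n)" for n
  \<comment> \<open>The defect of \<open>F n\<close> as an eigenfunction; its norm is controlled by
    how far \<open>q (F n)\<close> falls short of the supremum.\<close>
  define H where "H n x = G n x + (- \<mu>) * F n x" for n x
  have Gc: "continuous_on {0..c} (G n)" for n unfolding G_def by (rule kop_cont[OF F(1)])
  have Hc: "continuous_on {0..c} (H n)" for n unfolding H_def[abs_def] by (intro continuous_intros Gc F)
  have HH: "ip c (H n) (H n) = ip c (G n) (G n) - 2 * \<mu> * q (F n) + \<mu>\<^sup>2" for n
  proof -
    have "ip c (H n) (H n) = ip c (G n) (H n) + (- \<mu>) * ip c (F n) (H n)"
      unfolding H_def[abs_def] by (intro ip_add_scale Gc F continuous_intros)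
    also have "ip c (G n) (H n) = ip c (G n) (G n) + (- \<mu>) * ip c (G n) (F n)"
      unfolding H_def[abs_def] by (intro ip_add_scale_right Gc F continuous_intros)
    also have "ip c (F n) (H n) = ip c (F n) (G n) + (- \<mu>) * ip c (F n) (F n)"
      unfolding H_def[abs_def] by (intro ip_add_scale_right Gc F continuous_intros)
    finally show ?thesis
      by (simp add: F(2) q_def G_def ip_commute[of c "F n"] power2_eq_square algebra_simps)
  qed
  \<comment> \<open>The form is nonnegative at F n - G n / \<mu>, and at \<open>G n\<close> it is at
    most \<mu> times the squared norm; together these bound the norm of the image in place of an
    operator norm.\<close>
  have GG: "ip c (G n) (G n) \<le> \<mu> * q (F n)" for n
  proof -
    have "0 \<le> q (\<lambda>x. F n x + (- 1 / \<mu>) * G n x)"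
      unfolding q_def by (intro form_nonneg continuous_intros F Gc)
    also have "\<dots> = q (F n) + 2 * (- 1 / \<mu>) * ip c (G n) (G n) + (- 1 / \<mu>)\<^sup>2 * q (G n)"
      unfolding q_def form_add_scale[OF F(1) Gc] by (simp add: G_def)
    also have "\<dots> \<le> q (F n) + 2 * (- 1 / \<mu>) * ip c (G n) (G n) + (- 1 / \<mu>)\<^sup>2 * (\<mu> * ip c (G n) (G n))"
      by (intro add_left_mono mult_left_mono q_le Gc) simp
    also have "\<dots> = q (F n) - ip c (G n) (G n) / \<mu>"
      using \<mu> by (simp add: power2_eq_square field_simps)
    finally show ?thesis using \<mu> by (simp add: field_simps)
  qed
  have HH_le: "ip c (H n) (H n) \<le> \<mu> * (1 / real (Suc n))" for n
  proof -
    have "ip c (H n) (H n) \<le> \<mu> * (\<mu> - q (F n))"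
      using HH[of n] GG[of n] by (simp add: power2_eq_square algebra_simps)
    also have "\<dots> \<le> \<mu> * (1 / real (Suc n))" using F(3)[of n] \<mu> by (intro mult_left_mono) auto
    finally show ?thesis .
  qed
  have inv0: "(\<lambda>n. a * (1 / real (Suc n))) \<longlonglongrightarrow> 0" for a :: real
    using tendsto_mult_right_zero[OF LIMSEQ_Suc[OF lim_1_over_n], of a] by simp
  have HH0: "(\<lambda>n. ip c (H n) (H n)) \<longlonglongrightarrow> 0"
    by (rule tendsto_sandwich[OF _ _ tendsto_const inv0[of \<mu>]])
       (intro always_eventually allI ip_self_nonneg HH_le)+
  have q_lim: "(\<lambda>n. q (F n)) \<longlonglongrightarrow> \<mu>"
  proof (rule tendsto_sandwich[OF _ _ _ tendsto_const])
    show "(\<lambda>n. \<mu> - 1 * (1 / real (Suc n))) \<longlonglongrightarrow> \<mu>"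
      using tendsto_diff[OF tendsto_const inv0[of 1], of \<mu>] by simp
    show "\<forall>\<^sub>F n in sequentially. \<mu> - 1 * (1 / real (Suc n)) \<le> q (F n)"
      using F(3) by (auto intro!: always_eventually less_imp_le)
    show "\<forall>\<^sub>F n in sequentially. q (F n) \<le> \<mu>" using q_le[OF F(1)] F(2) by simp
  qed
  have TH0: "(\<lambda>n. kop c K (H n) x) \<longlonglongrightarrow> 0" if x: "x \<in> {0..c}" for x
  proof -
    have "(kop c K (H n) x)\<^sup>2 \<le> (K x x * \<mu>) * ip c (H n) (H n)" for n
      using kop_point_bound[OF x Hc[of n]] mult_left_mono[OF q_le[OF Hc[of n]] diag_nonneg[OF x]]
      by (simp add: q_def mult.assoc)
    then have "(\<lambda>n. (kop c K (H n) x)\<^sup>2) \<longlonglongrightarrow> 0"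
      by (intro tendsto_sandwich[OF _ _ tendsto_const tendsto_mult_right_zero[OF HH0]])
         (auto intro!: always_eventually)
    from tendsto_real_sqrt[OF this] show ?thesis by (simp add: tendsto_rabs_zero_iff)
  qed
  \<comment> \<open>Uniform continuity of the kernel makes the images of normalized functions
    equicontinuous; the tolerance e / (c + 1) leaves e / 2 after
    \<open>ip_unit_bound\<close>.\<close>
  have equi: "\<exists>d>0. \<forall>n y. y \<in> {0..c} \<and> norm (x - y) < d \<longrightarrow> norm (G n x - G n y) < e"
    if x: "x \<in> {0..c}" and e: "0 < e" for x e :: real
  proof -
    have "uniformly_continuous_on ({0..c} \<times> {0..c}) (\<lambda>(x, y). K x y)"
      by (intro compact_uniformly_continuous K_cont compact_Times) auto
    moreover have e': "0 < e / (c + 1)" using e c_pos by simp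
    ultimately obtain d where d: "0 < d"
      "\<And>p p'. p \<in> {0..c} \<times> {0..c} \<Longrightarrow> p' \<in> {0..c} \<times> {0..c} \<Longrightarrow> dist p' p < d \<Longrightarrow>
        dist (case p' of (x, y) \<Rightarrow> K x y) (case p of (x, y) \<Rightarrow> K x y) < e / (c + 1)"
      unfolding uniformly_continuous_on_def by metis
    have "norm (G n x - G n y) < e" if y: "y \<in> {0..c}" "norm (x - y) < d" for n y
    proof -
      have k: "\<bar>K x z + (- 1) * K y z\<bar> \<le> e / (c + 1)" if z: "z \<in> {0..c}" for z
        using d(2)[of "(y, z)" "(x, z)"] x y z by (simp add: dist_Pair_Pair dist_real_def)
      have "G n x - G n y = ip c (\<lambda>z. K x z + (- 1) * K y z) (F n)"
        unfolding G_def kop_row by (subst ip_add_scale) (use x y K_row_cont F in auto)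
      moreover have "\<bar>ip c (\<lambda>z. K x z + (- 1) * K y z) (F n)\<bar> \<le> e / (c + 1) * ((c + 1) / 2)"
        by (rule ip_unit_bound[OF F(1,2) _ k]) (auto intro!: continuous_intros K_row_cont x y)
      moreover have "e / (c + 1) * ((c + 1) / 2) < e" using e c_pos by simp
      ultimately show ?thesis by simp
    qed
    then show ?thesis using d(1) by blast
  qed
  obtain g r where g: "continuous_on {0..c} g" "strict_mono (r :: nat \<Rightarrow> nat)"
    and lim: "\<And>e. 0 < e \<Longrightarrow> \<exists>N. \<forall>n x. N \<le> n \<and> x \<in> {0..c} \<longrightarrow> norm (G (r n) x - g x) < e"
    by (rule Arzela_Ascoli[of "{0..c}" G B1, OF _ _ equi]) (use Tbd F in \<open>auto simp: G_def\<close>)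
  have ul: "uniform_limit {0..c} (\<lambda>n. G (r n)) g sequentially"
    unfolding uniform_limit_sequentially_iff dist_norm using lim by blast
  \<comment> \<open>Applying the operator to \<open>G n\<close> = \<open>H n\<close> + \<mu> *
    \<open>F n\<close> gives a relation between images only, plus a vanishing term. It passes to the
    limit although \<open>F n\<close> need not converge.\<close>
  have eig: "kop c K g x = \<mu> * g x" if x: "x \<in> {0..c}" for x
  proof (rule LIMSEQ_unique)
    show "(\<lambda>n. kop c K (G (r n)) x) \<longlonglongrightarrow> kop c K g x"
      unfolding kop_row by (rule ip_uniform_limit[OF uniform_limit_const K_row_cont[OF x] ul Gc])
    have "kop c K (G n) x = kop c K (H n) x + \<mu> * G n x" for n
      unfolding H_def[abs_def] kop_add_scale[OF x Gc F(1)] by (simp add: G_def)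
    moreover have "(\<lambda>n. kop c K (H (r n)) x + \<mu> * G (r n) x) \<longlonglongrightarrow> 0 + \<mu> * g x"
      by (intro tendsto_intros tendsto_uniform_limitI[OF ul x]
          LIMSEQ_subseq_LIMSEQ[OF TH0[OF x] g(2), unfolded comp_def])
    ultimately show "(\<lambda>n. kop c K (G (r n)) x) \<longlonglongrightarrow> \<mu> * g x" by simp
  qed
  \<comment> \<open>The limit could a priori be 0; its norm turns out to be \<mu>, so 1 / \<mu>
    normalizes it.\<close>
  have gg: "ip c g g = \<mu>\<^sup>2"
  proof (rule LIMSEQ_unique)
    show "(\<lambda>n. ip c (G (r n)) (G (r n))) \<longlonglongrightarrow> ip c g g"
      by (rule ip_uniform_limit[OF ul Gc ul Gc])
    have "(\<lambda>n. ip c (H n) (H n) + 2 * \<mu> * q (F n) - \<mu>\<^sup>2) \<longlonglongrightarrow> 0 + 2 * \<mu> * \<mu> - \<mu>\<^sup>2"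
      by (intro tendsto_intros HH0 q_lim)
    then have "(\<lambda>n. ip c (G n) (G n)) \<longlonglongrightarrow> \<mu>\<^sup>2"
      by (simp add: HH power2_eq_square)
    from LIMSEQ_subseq_LIMSEQ[OF this g(2)]
    show "(\<lambda>n. ip c (G (r n)) (G (r n))) \<longlonglongrightarrow> \<mu>\<^sup>2" by (simp add: comp_def)
  qed
  have "top_eigenpair \<mu> (\<lambda>x. (1 / \<mu>) * g x)"
    unfolding top_eigenpair_def
  proof (intro conjI ballI allI impI)
    show "ip c (\<lambda>x. 1 / \<mu> * g x) (\<lambda>x. 1 / \<mu> * g x) = 1"
      unfolding ip_scale ip_scale_right gg using \<mu> by (simp add: power2_eq_square)
    show "continuous_on {0..c} (\<lambda>x. 1 / \<mu> * g x)" by (intro continuous_intros g)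
    show "kop c K (\<lambda>x. 1 / \<mu> * g x) x = \<mu> * (1 / \<mu> * g x)" if "x \<in> {0..c}" for x
      unfolding kop_scale eig[OF that] by simp
    show "ip c (kop c K f) f \<le> \<mu> * ip c f f" if "continuous_on {0..c} f" for f
      using q_le[OF that] by (simp add: q_def)
  qed (rule \<mu>)
  then show ?thesis by blast
qed

text \<open>By the eigenvalue equation and the normalization of \<phi>, the deflated form on a point
  mass plus f is the form of \<open>K\<close> on the same object with its \<phi>-component removed.
  This is why positivity is inherited.\<close>

lemma
  assumes \<phi>: "top_eigenpair \<mu> \<phi>"
  shows kop_deflate: "\<And>f x. continuous_on {0..c} f \<Longrightarrow> x \<in> {0..c} \<Longrightarrow>
      kop c (\<lambda>x y. K x y - \<mu> * \<phi> x * \<phi> y) f x = kop c K f x - \<mu> * \<phi> x * ip c \<phi> f"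
    and psd_deflate: "psd_kernel c (\<lambda>x y. K x y - \<mu> * \<phi> x * \<phi> y)"
proof -
  have \<phi>c: "continuous_on {0..c} \<phi>" and \<phi>1: "ip c \<phi> \<phi> = 1"
    and eig: "\<And>x. x \<in> {0..c} \<Longrightarrow> kop c K \<phi> x = \<mu> * \<phi> x"
    using \<phi> by (auto simp: top_eigenpair_def)
  show kd: "kop c (\<lambda>x y. K x y - \<mu> * \<phi> x * \<phi> y) f x = kop c K f x - \<mu> * \<phi> x * ip c \<phi> f"
    if f: "continuous_on {0..c} f" and x: "x \<in> {0..c}" for f x
    using ip_add_scale[OF K_row_cont[OF x] \<phi>c f, of "- (\<mu> * \<phi> x)"]
    by (simp add: kop_def ip_def)
  show "psd_kernel c (\<lambda>x y. K x y - \<mu> * \<phi> x * \<phi> y)"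
    unfolding psd_kernel_def
  proof (intro conjI ballI allI impI)
    show "continuous_on ({0..c} \<times> {0..c}) (\<lambda>(x, y). K x y - \<mu> * \<phi> x * \<phi> y)"
      using K_cont by (auto simp: split_beta intro!: continuous_intros continuous_on_compose2[OF \<phi>c])
  next
    fix x y assume "x \<in> {0..c}" "y \<in> {0..c}"
    then show "K x y - \<mu> * \<phi> x * \<phi> y = K y x - \<mu> * \<phi> y * \<phi> x" by (simp add: K_sym)
  next
    fix x a and f :: "real \<Rightarrow> real"
    assume x: "x \<in> {0..c}" and f: "continuous_on {0..c} f"
    let ?K' = "\<lambda>x y. K x y - \<mu> * \<phi> x * \<phi> y"
    \<comment> \<open>The \<phi>-coefficient of the point mass plus f; subtracting s * \<phi> from f
      lowers the form by \<mu> * s^2.\<close>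
    define s where "s = a * \<phi> x + ip c \<phi> f"
    have *: "2 * a * (s * (\<mu> * \<phi> x)) + 2 * s * \<mu> * ip c \<phi> f = 2 * (s\<^sup>2 * \<mu>)"
      unfolding s_def by (simp add: power2_eq_square algebra_simps)
    have "kop c K (\<lambda>y. f y + (- s) * \<phi> y) x = kop c K f x - s * (\<mu> * \<phi> x)"
      using kop_add_scale[OF x f \<phi>c, of "- s"] eig[OF x] by simp
    moreover have "ip c (kop c K (\<lambda>y. f y + (- s) * \<phi> y)) (\<lambda>y. f y + (- s) * \<phi> y) =
        ip c (kop c K f) f - 2 * s * \<mu> * ip c \<phi> f + s\<^sup>2 * \<mu>"
    proof -
      have "ip c (kop c K \<phi>) g = \<mu> * ip c \<phi> g" for g
        using ip_cong[of c "kop c K \<phi>" "\<lambda>x. \<mu> * \<phi> x" g g] eig by (simp add: ip_scale)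
      then show ?thesis
        using form_add_scale[OF f \<phi>c, of "- s"] kop_sym[OF f \<phi>c] \<phi>1
        by (simp add: ip_commute[of c f])
    qed
    moreover have "0 \<le> a\<^sup>2 * K x x + 2 * a * kop c K (\<lambda>y. f y + (- s) * \<phi> y) x +
        ip c (kop c K (\<lambda>y. f y + (- s) * \<phi> y)) (\<lambda>y. f y + (- s) * \<phi> y)"
      by (intro K_psd x continuous_intros f \<phi>c)
    ultimately have "0 \<le> a\<^sup>2 * K x x + 2 * a * kop c K f x + ip c (kop c K f) f - \<mu> * s\<^sup>2"
      using * by (simp add: right_diff_distrib mult.commute[of \<mu>])
    moreover have "ip c (kop c ?K' f) f = ip c (kop c K f) f - \<mu> * (ip c \<phi> f)\<^sup>2"
    proof -
      have "ip c (kop c ?K' f) f = ip c (\<lambda>x. kop c K f x + (- \<mu> * ip c \<phi> f) * \<phi> x) f"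
        by (rule ip_cong) (auto simp: kd[OF f])
      then show ?thesis
        using ip_add_scale[OF kop_cont[OF f] \<phi>c f, of "- \<mu> * ip c \<phi> f"]
        by (simp add: power2_eq_square)
    qed
    ultimately show "0 \<le> a\<^sup>2 * ?K' x x + 2 * a * kop c ?K' f x + ip c (kop c ?K' f) f"
      unfolding kd[OF f x] s_def by (simp add: power2_eq_square algebra_simps)
  qed
qed

end

text \<open>A polynomial with n + 1 coefficients can meet n linear conditions without vanishing.
  Under strict positivity this shows that the remainder after n eigenpairs has a nonzero form, so
  that the splitting never stops.\<close>

lemma orthogonal_continuous_exists:
  fixes n :: nat
  assumes c: "0 < c" and \<psi>: "\<And>j. j < n \<Longrightarrow> continuous_on {0..c} (\<psi> j)"
  shows "\<exists>f. continuous_on {0..c} f \<and> (\<exists>x\<in>{0..c}. f x \<noteq> 0) \<and> (\<forall>j<n. ip c (\<psi> j) f = 0)"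
proof -
  define A where "A = Matrix.mat (Suc n) (Suc n)
    (\<lambda>(j, i). if j < n then ip c (\<psi> j) (\<lambda>x. x ^ i) else 0)"
  have A: "A \<in> carrier_mat (Suc n) (Suc n)" by (simp add: A_def)
  \<comment> \<open>The last row of \<open>A\<close> is zero padding that makes the system square,
    so every Leibniz product contains a zero.\<close>
  have "A $$ (n, p n) = 0" if "p permutes {0..<Suc n}" for p
    using permutes_in_image[OF that, of n] by (simp add: A_def)
  then have "(\<Prod>i = 0..<Suc n. A $$ (i, p i)) = 0" if "p permutes {0..<Suc n}" for p
    using that by simp
  then have "Determinant.det A = 0"
    unfolding det_def'[OF A] by (intro sum.neutral) auto
  then obtain v where v: "v \<in> carrier_vec (Suc n)" "v \<noteq> 0\<^sub>v (Suc n)" "A *\<^sub>v v = 0\<^sub>v (Suc n)"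
    using det_0_iff_vec_prod_zero_field[OF A] by blast
  define f where "f x = (\<Sum>i<Suc n. vec_index v i * x ^ i)" for x :: real
  have fc: "continuous_on {0..c} f" unfolding f_def by (intro continuous_intros)
  have "ip c (\<psi> j) f = 0" if j: "j < n" for j
  proof -
    have "ip c (\<psi> j) f = (\<Sum>i<Suc n. vec_index v i * ip c (\<lambda>x. x ^ i) (\<psi> j))"
      unfolding f_def ip_commute[of c "\<psi> j"] using \<psi>[OF j]
      by (intro ip_sum) (auto intro!: continuous_intros)
    also have "\<dots> = vec_index (A *\<^sub>v v) j"
      using j v(1) by (simp add: A_def scalar_prod_def ip_commute[of c "\<psi> j"] mult.commute atLeast0LessThan)
    finally show ?thesis using j v(3) by simp
  qed
  moreover have "\<exists>x\<in>{0..c}. f x \<noteq> 0"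
  proof (rule ccontr)
    assume "\<not> (\<exists>x\<in>{0..c}. f x \<noteq> 0)"
    then have "{0..c} \<subseteq> {x. (\<Sum>i\<le>n. vec_index v i * x ^ i) = 0}"
      by (auto simp: f_def lessThan_Suc_atMost)
    moreover have "infinite {0..c}" using c by (simp add: infinite_Icc)
    ultimately have "\<forall>i\<le>n. vec_index v i = 0"
      using polyfun_finite_roots[of "\<lambda>i. vec_index v i" n] finite_subset by blast
    then have "v = 0\<^sub>v (Suc n)" using v(1) by (intro eq_vecI) auto
    with v(2) show False by blast
  qed
  ultimately show ?thesis using fc by blast
qed

text \<open>Only pointwise convergence is recorded; the uniform bound that limits under integrals
  require is recovered from the diagonal in \<open>trunc_abs_le_1\<close>.\<close>

definition spectral_expansion ::
    "real \<Rightarrow> (real \<Rightarrow> real \<Rightarrow> real) \<Rightarrow> (nat \<Rightarrow> real) \<Rightarrow> (nat \<Rightarrow> real \<Rightarrow> real) \<Rightarrow> bool" where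
  "spectral_expansion c K \<mu> \<phi> \<longleftrightarrow>
     decseq \<mu> \<and> (\<forall>n. 0 < \<mu> n) \<and> (\<forall>n. continuous_on {0..c} (\<phi> n)) \<and>
     (\<forall>i j. ip c (\<phi> i) (\<phi> j) = (if i = j then 1 else 0)) \<and>
     (\<forall>x\<in>{0..c}. \<forall>y\<in>{0..c}. (\<lambda>n. \<mu> n * \<phi> n x * \<phi> n y) sums K x y)"

context interval_kernel
begin

text \<open>The eigenpairs are split off one by one. The remainder kernels tend to 0 pointwise because,
  by positivity, the square of \<open>T\<^sub>n f (x)\<close> is at most \<open>K x x * \<mu> n * ip c f f\<close>, where \<open>f\<close> can be taken
  to be the limit of the rows of the remainders.\<close>

theorem spectral_expansion_exists:
  assumes strict: "\<And>f x. continuous_on {0..c} f \<Longrightarrow> x \<in> {0..c} \<Longrightarrow> f x \<noteq> 0 \<Longrightarrow> 0 < ip c (kop c K f) f"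
  shows "\<exists>\<mu> \<phi>. spectral_expansion c K \<mu> \<phi>"
proof -
  \<comment> \<open>The choice is total, so the recursion can be set up before it is known that each
    remainder has a top eigenpair; \<open>step\<close> and \<open>inv\<close> establish this
    afterwards.\<close>
  define nxt where "nxt K' = (SOME p. interval_kernel.top_eigenpair c K' (fst p) (snd p))" for K'
  define KK where
    "KK = rec_nat K (\<lambda>_ K' (x::real) (y::real). K' x y - fst (nxt K') * snd (nxt K') x * snd (nxt K') y)"
  define \<mu> where "\<mu> n = fst (nxt (KK n))" for n
  define \<phi> where "\<phi> n = snd (nxt (KK n))" for n
  have KK_0: "KK 0 = K" by (simp add: KK_def)
  have KK_Suc: "KK (Suc n) = (\<lambda>x y. KK n x y - \<mu> n * \<phi> n x * \<phi> n y)" for n :: nat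
    by (simp add: KK_def \<mu>_def \<phi>_def)
  \<comment> \<open>On functions orthogonal to the earlier eigenfunctions the remainder acts as
    \<open>K\<close>, so strict positivity of \<open>K\<close> provides a function with positive
    form. The hypotheses are the invariant \<open>inv\<close>, proved next by induction.\<close>
  have step: "interval_kernel.top_eigenpair c (KK n) (\<mu> n) (\<phi> n)"
    if s: "psd_kernel c (KK n)" "\<And>j. j < n \<Longrightarrow> continuous_on {0..c} (\<phi> j)"
      "\<And>f x. continuous_on {0..c} f \<Longrightarrow> (\<And>j. j < n \<Longrightarrow> ip c (\<phi> j) f = 0) \<Longrightarrow> x \<in> {0..c} \<Longrightarrow>
        kop c (KK n) f x = kop c K f x" for n
  proof -
    interpret n: interval_kernel c "KK n" using c_pos s(1) by unfold_locales
    obtain f where f: "continuous_on {0..c} f" "\<exists>x\<in>{0..c}. f x \<noteq> 0" "\<forall>j<n. ip c (\<phi> j) f = 0"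
      using orthogonal_continuous_exists[of c n \<phi>, OF c_pos s(2)] by blast
    have "ip c (kop c (KK n) f) f = ip c (kop c K f) f"
      by (rule ip_cong) (use s(3) f in auto)
    then have "0 < ip c (kop c (KK n) f) f" using strict f by auto
    then obtain m p where "n.top_eigenpair m p" using n.top_eigenpair_exists[OF f(1)] by blast
    then have "n.top_eigenpair (fst (m, p)) (snd (m, p))" by simp
    then show ?thesis unfolding \<mu>_def \<phi>_def nxt_def by (rule someI)
  qed
  have inv: "psd_kernel c (KK n) \<and> (\<forall>j<n. continuous_on {0..c} (\<phi> j)) \<and>
      (\<forall>f x. continuous_on {0..c} f \<longrightarrow> (\<forall>j<n. ip c (\<phi> j) f = 0) \<longrightarrow> x \<in> {0..c} \<longrightarrow>
        kop c (KK n) f x = kop c K f x)" for n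
  proof (induction n)
    case 0
    show ?case using psd by (simp add: KK_0)
  next
    case (Suc n)
    then interpret n: interval_kernel c "KK n" using c_pos by unfold_locales auto
    have t: "n.top_eigenpair (\<mu> n) (\<phi> n)" using step Suc by blast
    show ?case using Suc n.psd_deflate[OF t] n.kop_deflate[OF t] t
      by (auto simp: KK_Suc less_Suc_eq n.top_eigenpair_def)
  qed
  have psdn: "interval_kernel c (KK n)" for n using c_pos inv[of n] by unfold_locales auto
  have top: "interval_kernel.top_eigenpair c (KK n) (\<mu> n) (\<phi> n)" for n using step inv by blast
  have \<mu>_pos: "0 < \<mu> n" and \<phi>c: "continuous_on {0..c} (\<phi> n)" and \<phi>1: "ip c (\<phi> n) (\<phi> n) = 1"
    and eig: "\<And>x. x \<in> {0..c} \<Longrightarrow> kop c (KK n) (\<phi> n) x = \<mu> n * \<phi> n x"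
    and max: "\<And>f. continuous_on {0..c} f \<Longrightarrow> ip c (kop c (KK n) f) f \<le> \<mu> n * ip c f f" for n
    using top[of n] unfolding interval_kernel.top_eigenpair_def[OF psdn] by auto
  have \<mu>_nonneg: "0 \<le> \<mu> n" for n using \<mu>_pos[of n] by simp
  have kop_Suc: "kop c (KK (Suc n)) f x = kop c (KK n) f x - \<mu> n * \<phi> n x * ip c (\<phi> n) f"
    if "continuous_on {0..c} f" "x \<in> {0..c}" for n f x
    using interval_kernel.kop_deflate[OF psdn top that] by (simp add: KK_Suc)
  \<comment> \<open>Each remainder annihilates the eigenfunctions already removed. By symmetry of
    the operator, a new eigenfunction with nonzero eigenvalue is then orthogonal to them.\<close>
  have kill: "j < n \<Longrightarrow> x \<in> {0..c} \<Longrightarrow> kop c (KK n) (\<phi> j) x = 0"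
    and orth: "j < n \<Longrightarrow> ip c (\<phi> n) (\<phi> j) = 0" for n j x
  proof -
    have "(\<forall>j<n. \<forall>x\<in>{0..c}. kop c (KK n) (\<phi> j) x = 0) \<and> (\<forall>j<n. ip c (\<phi> n) (\<phi> j) = 0)" for n
    proof (induction n)
      case (Suc n)
      have k: "kop c (KK (Suc n)) (\<phi> j) x = 0" if "j < Suc n" "x \<in> {0..c}" for j x
        using that Suc eig[of x n] by (auto simp: kop_Suc[OF \<phi>c] \<phi>1 less_Suc_eq)
      have "ip c (\<phi> (Suc n)) (\<phi> j) = 0" if j: "j < Suc n" for j
      proof -
        have "\<mu> (Suc n) * ip c (\<phi> (Suc n)) (\<phi> j) = ip c (kop c (KK (Suc n)) (\<phi> (Suc n))) (\<phi> j)"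
          unfolding ip_scale[symmetric] by (rule ip_cong) (auto simp: eig)
        also have "\<dots> = ip c (\<phi> (Suc n)) (kop c (KK (Suc n)) (\<phi> j))"
          by (rule interval_kernel.kop_sym[OF psdn \<phi>c \<phi>c])
        also have "\<dots> = ip c (\<phi> (Suc n)) (\<lambda>_. 0)" by (rule ip_cong) (auto simp: k j)
        finally show ?thesis using \<mu>_pos[of "Suc n"] by (simp add: ip_def)
      qed
      with k show ?case by blast
    qed simp
    then show "j < n \<Longrightarrow> x \<in> {0..c} \<Longrightarrow> kop c (KK n) (\<phi> j) x = 0" "j < n \<Longrightarrow> ip c (\<phi> n) (\<phi> j) = 0"
      by blast+
  qed
  have orthonormal: "ip c (\<phi> i) (\<phi> j) = (if i = j then 1 else 0)" for i j
    using orth[of i j] orth[of j i] \<phi>1[of i] by (auto simp: ip_commute not_less_iff_gr_or_eq)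
      (metis ip_commute linorder_neqE_nat)
  \<comment> \<open>Being orthogonal to \<phi> n, the next eigenfunction has form value \<mu> (Suc
    n) already for the n-th remainder, where \<mu> n is the maximum.\<close>
  have dec: "\<mu> (Suc n) \<le> \<mu> n" for n
  proof -
    have "\<mu> (Suc n) = ip c (\<lambda>x. \<mu> (Suc n) * \<phi> (Suc n) x) (\<phi> (Suc n))"
      unfolding ip_scale using \<phi>1 by simp
    also have "\<dots> = ip c (kop c (KK n) (\<phi> (Suc n))) (\<phi> (Suc n))"
      by (rule ip_cong) (auto simp: eig[symmetric] kop_Suc[OF \<phi>c] orthonormal)
    also have "\<dots> \<le> \<mu> n" using max[OF \<phi>c[of "Suc n"], of n] \<phi>1 by simp
    finally show ?thesis .
  qed
  have KK_sum: "KK n x y = K x y - (\<Sum>j<n. \<mu> j * \<phi> j x * \<phi> j y)" for n x y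
    by (induction n) (simp_all add: KK_0 KK_Suc)
  \<comment> \<open>Bessel's inequality on the diagonal, because the remainder has a nonnegative
    diagonal. Integrated over x, it bounds the sum of the eigenvalues.\<close>
  have diag: "(\<Sum>j<n. \<mu> j * (\<phi> j x)\<^sup>2) \<le> K x x" if "x \<in> {0..c}" for n x
    using interval_kernel.diag_nonneg[OF psdn that, of n]
    by (simp add: KK_sum power2_eq_square mult.assoc)
  have diag_summable: "summable (\<lambda>j. \<mu> j * (\<phi> j x)\<^sup>2)" if "x \<in> {0..c}" for x
    using diag[OF that] by (intro summableI_nonneg_bounded[where x = "K x x"] mult_nonneg_nonneg \<mu>_nonneg) auto
  have "summable \<mu>"
  proof (rule summableI_nonneg_bounded)
    show "0 \<le> \<mu> n" for n by (rule \<mu>_nonneg)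
    fix n
    have "(\<Sum>j<n. \<mu> j) = (\<Sum>j<n. \<mu> j * ip c (\<phi> j) (\<phi> j))" by (simp add: \<phi>1)
    also have "\<dots> = integral {0..c} (\<lambda>x. \<Sum>j<n. \<mu> j * (\<phi> j x * \<phi> j x))"
      unfolding ip_def
      by (subst integral_sum) (auto intro!: integrable_continuous_interval continuous_intros \<phi>c)
    also have "\<dots> \<le> integral {0..c} (\<lambda>x. K x x)"
      using diag by (intro integral_le integrable_continuous_interval continuous_intros \<phi>c K_cont_compose)
        (auto simp: power2_eq_square)
    finally show "(\<Sum>j<n. \<mu> j) \<le> integral {0..c} (\<lambda>x. K x x)" .
  qed
  then have \<mu>0: "\<mu> \<longlonglongrightarrow> 0" by (rule summable_LIMSEQ_zero)
  obtain B where B: "0 < B" "\<And>x y. x \<in> {0..c} \<Longrightarrow> y \<in> {0..c} \<Longrightarrow> \<bar>K x y\<bar> \<le> B"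
    using K_bounded by blast
  have mercer: "(\<lambda>n. \<mu> n * \<phi> n x * \<phi> n y) sums K x y" if x: "x \<in> {0..c}" and y: "y \<in> {0..c}" for x y
  proof -
    define t where "t n = (\<Sum>j<n. \<mu> j * (\<phi> j x)\<^sup>2)" for n
    \<comment> \<open>Cauchy-Schwarz on a block of the series: the factor in x becomes small and the
      factor in z stays below \<open>B\<close>. So for fixed x the rows converge uniformly in z, and
      their limit is continuous without Dini's theorem.\<close>
    have tail: "(KK n x z - KK m x z)\<^sup>2 \<le> (t n - t m) * B" if "m < n" "z \<in> {0..c}" for m n z
    proof -
      have split: "(\<Sum>j<n. g j) - (\<Sum>j<m. g j) = (\<Sum>j\<in>{m..<n}. g j)" for g :: "nat \<Rightarrow> real"
        using \<open>m < n\<close> by (simp add: sum_diff_nat_ivl[of 0 m n g, symmetric] atLeast0LessThan)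
      have "KK n x z - KK m x z = - (\<Sum>j\<in>{m..<n}. (sqrt (\<mu> j) * \<phi> j x) * (sqrt (\<mu> j) * \<phi> j z))"
        using split[of "\<lambda>j. \<mu> j * \<phi> j x * \<phi> j z"] \<mu>_pos
        by (simp add: KK_sum mult.assoc mult.left_commute[of "\<phi> _ x"] less_imp_le)
          (simp add: mult.assoc[symmetric] less_imp_le)
      then have "(KK n x z - KK m x z)\<^sup>2 = (\<Sum>j\<in>{m..<n}. (sqrt (\<mu> j) * \<phi> j x) * (sqrt (\<mu> j) * \<phi> j z))\<^sup>2"
        by simp
      also have "\<dots> \<le> (\<Sum>j\<in>{m..<n}. (sqrt (\<mu> j) * \<phi> j x)\<^sup>2) * (\<Sum>j\<in>{m..<n}. (sqrt (\<mu> j) * \<phi> j z)\<^sup>2)"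
        by (rule Cauchy_Schwarz_ineq_sum)
      also have "(\<Sum>j\<in>{m..<n}. (sqrt (\<mu> j) * \<phi> j x)\<^sup>2) = t n - t m"
        unfolding t_def split using \<mu>_pos by (simp add: power_mult_distrib less_imp_le)
      also have "(\<Sum>j\<in>{m..<n}. (sqrt (\<mu> j) * \<phi> j z)\<^sup>2) \<le> B"
      proof -
        have "(\<Sum>j\<in>{m..<n}. (sqrt (\<mu> j) * \<phi> j z)\<^sup>2) = (\<Sum>j\<in>{m..<n}. \<mu> j * (\<phi> j z)\<^sup>2)"
          using \<mu>_pos by (simp add: power_mult_distrib less_imp_le)
        also have "\<dots> \<le> (\<Sum>j<n. \<mu> j * (\<phi> j z)\<^sup>2)"
          by (intro sum_mono2 mult_nonneg_nonneg \<mu>_nonneg) auto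
        also have "\<dots> \<le> B" using diag[OF that(2), of n] B(2)[OF that(2,2)] by linarith
        finally show ?thesis .
      qed
      finally show ?thesis
        using split[of "\<lambda>j. \<mu> j * (\<phi> j x)\<^sup>2"] \<mu>_pos
        by (simp add: t_def mult_left_mono sum_nonneg less_imp_le)
    qed
    have "Cauchy t"
      using diag_summable[OF x] unfolding t_def summable_iff_convergent by (rule convergent_Cauchy)
    have "uniformly_Cauchy_on {0..c} (\<lambda>n. KK n x)"
    proof (rule uniformly_Cauchy_onI')
      fix e :: real assume e: "0 < e"
      then have "0 < e\<^sup>2 / B" using B by simp
      then obtain M where M: "\<And>m n. M \<le> m \<Longrightarrow> M \<le> n \<Longrightarrow> dist (t m) (t n) < e\<^sup>2 / B"
        using metric_CauchyD[OF \<open>Cauchy t\<close>] by metis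
      have "dist (KK m x z) (KK n x z) < e" if "z \<in> {0..c}" "M \<le> m" "m < n" for z m n
      proof -
        have "(t n - t m) * B < e\<^sup>2 / B * B"
          using M[of m n] that B by (intro mult_strict_right_mono) (auto simp: dist_real_def)
        then have "(KK n x z - KK m x z)\<^sup>2 < e\<^sup>2"
          using tail[OF that(3,1)] B by simp
        then have "\<bar>KK n x z - KK m x z\<bar> < e"
          using e power2_less_imp_less[of "\<bar>KK n x z - KK m x z\<bar>" e] by simp
        then show ?thesis by (simp add: dist_real_def abs_minus_commute)
      qed
      then show "\<exists>M. \<forall>x'\<in>{0..c}. \<forall>m\<ge>M. \<forall>n>m. dist (KK m x x') (KK n x x') < e" by blast
    qed
    then obtain r where r: "uniform_limit {0..c} (\<lambda>n. KK n x) r sequentially"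
      using Cauchy_uniformly_convergent uniformly_convergent_on_def by blast
    have KKc: "continuous_on {0..c} (KK n x)" for n by (rule interval_kernel.K_row_cont[OF psdn x])
    have rc: "continuous_on {0..c} r"
      by (rule uniform_limit_theorem[OF _ r]) (use KKc in auto)
    \<comment> \<open>The value at x is the inner product of the n-th row with r, and these rows
      tend to r itself. The pointwise bound below forces the same limit to be 0.\<close>
    have "(\<lambda>n. kop c (KK n) r x) \<longlonglongrightarrow> ip c r r"
      unfolding interval_kernel.kop_row[OF psdn]
      by (rule ip_uniform_limit[OF r KKc uniform_limit_const rc])
    then have "(\<lambda>n. (kop c (KK n) r x)\<^sup>2) \<longlonglongrightarrow> (ip c r r)\<^sup>2" by (intro tendsto_intros)
    moreover have "(\<lambda>n. (kop c (KK n) r x)\<^sup>2) \<longlonglongrightarrow> 0"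
    proof (rule tendsto_sandwich[OF _ _ tendsto_const])
      show "(\<lambda>n. K x x * (\<mu> n * ip c r r)) \<longlonglongrightarrow> 0"
        using tendsto_mult_right_zero[OF tendsto_mult_left_zero[OF \<mu>0]] by blast
      have "(kop c (KK n) r x)\<^sup>2 \<le> K x x * (\<mu> n * ip c r r)" for n
      proof -
        have "(kop c (KK n) r x)\<^sup>2 \<le> KK n x x * ip c (kop c (KK n) r) r"
          by (rule interval_kernel.kop_point_bound[OF psdn x rc])
        also have "\<dots> \<le> K x x * (\<mu> n * ip c r r)"
        proof (rule mult_mono)
          have "0 \<le> (\<Sum>j<n. \<mu> j * (\<phi> j x)\<^sup>2)"
            by (intro sum_nonneg mult_nonneg_nonneg \<mu>_nonneg) simp
          then show "KK n x x \<le> K x x" by (simp add: KK_sum mult.assoc power2_eq_square)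
        qed (use max[OF rc] diag_nonneg[OF x] interval_kernel.form_nonneg[OF psdn rc] in auto)
        finally show ?thesis .
      qed
      then show "\<forall>\<^sub>F n in sequentially. (kop c (KK n) r x)\<^sup>2 \<le> K x x * (\<mu> n * ip c r r)" by simp
    qed simp
    ultimately have "(ip c r r)\<^sup>2 = 0" by (rule LIMSEQ_unique)
    then have "r y = 0" using ip_self_eq_0[OF c_pos rc _ y] by simp
    then have "(\<lambda>n. KK n x y) \<longlonglongrightarrow> 0" using tendsto_uniform_limitI[OF r y] by simp
    from tendsto_diff[OF tendsto_const this, of "K x y"] show ?thesis
      unfolding sums_def by (simp add: KK_sum)
  qed
  show ?thesis
    unfolding spectral_expansion_def
    using dec \<mu>_pos \<phi>c orthonormal mercer by (intro exI[of _ \<mu>] exI[of _ \<phi>]) (auto intro: decseq_SucI)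
qed

end

section \<open>The sinc kernel\<close>

text \<open>The Fourier transform of the indicator of a frequency band, written in real form and
  folded to {0..pi}. At each frequency the variables x and y separate symmetrically, which is the
  source of positivity.\<close>

lemma sinc_kernel_integral:
  "sinc_kernel x y = integral {0..pi} (\<lambda>s. cos (s * x) * cos (s * y) + sin (s * x) * sin (s * y)) / pi"
proof -
  have "integral {0..pi} (\<lambda>s. cos (s * (x - y))) = pi * sinc_kernel x y"
  proof (cases "x = y")
    case False
    have "((\<lambda>s. cos (s * (x - y))) has_integral
        (sin (pi * (x - y)) / (x - y) - sin (0 * (x - y)) / (x - y))) {0..pi}"
      using False
      by (intro fundamental_theorem_of_calculus)
         (auto intro!: derivative_eq_intros simp: has_real_derivative_iff_has_vector_derivative[symmetric])
    then show ?thesis using False by (simp add: integral_unique sinc_kernel_def)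
  qed (simp add: sinc_kernel_def)
  moreover have "cos (s * (x - y)) = cos (s * x) * cos (s * y) + sin (s * x) * sin (s * y)" for s
    by (simp add: right_diff_distrib cos_diff)
  ultimately show ?thesis by simp
qed

lemma sinc_kernel_sym: "sinc_kernel x y = sinc_kernel y x"
  by (simp add: sinc_kernel_integral mult.commute)

text \<open>The removable singularity on the diagonal is absent from the integral representation, so
  continuity of a parameter integral suffices.\<close>

lemma continuous_on_sinc_kernel: "continuous_on S (\<lambda>(x, y). sinc_kernel x y)"
proof -
  have "continuous_on (S \<times> cbox 0 pi)
      (\<lambda>(p, s). cos (s * fst p) * cos (s * snd p) + sin (s * fst p) * sin (s * snd p))"
    by (auto simp: split_beta intro!: continuous_intros)
  from integral_continuous_on_param[OF this] show ?thesis
    by (simp add: sinc_kernel_integral split_beta continuous_on_divide)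
qed

lemma integral_swap_continuous_Icc:
  fixes g :: "real \<Rightarrow> real \<Rightarrow> real"
  assumes "continuous_on ({a..b} \<times> {c..d}) (\<lambda>(x, y). g x y)"
  shows "integral {a..b} (\<lambda>x. integral {c..d} (g x)) = integral {c..d} (\<lambda>y. integral {a..b} (\<lambda>x. g x y))"
  using integral_swap_continuous[of a c b d g] assms by (simp add: cbox_Pair_eq)

section \<open>Cosine and sine transforms, and strict positivity of the sinc form\<close>

context
  fixes c :: real and f :: "real \<Rightarrow> real"
  assumes f: "continuous_on {0..c} f"
begin

abbreviation (input) cosine_transform :: "real \<Rightarrow> real" where
  "cosine_transform s \<equiv> ip c (\<lambda>y. cos (s * y)) f"

abbreviation (input) sine_transform :: "real \<Rightarrow> real" where
  "sine_transform s \<equiv> ip c (\<lambda>y. sin (s * y)) f"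

lemma continuous_on_transforms:
  "continuous_on S cosine_transform" "continuous_on S sine_transform"
proof -
  have "continuous_on (S \<times> cbox 0 c) (\<lambda>(s, y). cos (s * y) * f y)"
    "continuous_on (S \<times> cbox 0 c) (\<lambda>(s, y). sin (s * y) * f y)"
    by (auto simp: split_beta intro!: continuous_intros continuous_on_compose2[OF f])
  from this[THEN integral_continuous_on_param]
  show "continuous_on S cosine_transform" "continuous_on S sine_transform"
    by (simp_all add: ip_def)
qed

lemma sinc_kop:
  "kop c sinc_kernel f x =
     integral {0..pi} (\<lambda>s. cos (s * x) * cosine_transform s + sin (s * x) * sine_transform s) / pi"
proof -
  have "sinc_kernel x y * f y = integral {0..pi}
      (\<lambda>s. (cos (s * x) * cos (s * y) + sin (s * x) * sin (s * y)) * f y) / pi" for y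
    unfolding sinc_kernel_integral Henstock_Kurzweil_Integration.integral_mult_left by simp
  then have "pi * kop c sinc_kernel f x = integral {0..c} (\<lambda>y. integral {0..pi}
      (\<lambda>s. (cos (s * x) * cos (s * y) + sin (s * x) * sin (s * y)) * f y))"
    by (simp add: kop_def)
  also have "\<dots> = integral {0..pi} (\<lambda>s. integral {0..c}
      (\<lambda>y. (cos (s * x) * cos (s * y) + sin (s * x) * sin (s * y)) * f y))"
    by (rule integral_swap_continuous_Icc)
       (auto simp: split_beta intro!: continuous_intros continuous_on_compose2[OF f])
  also have "\<dots> = integral {0..pi} (\<lambda>s. cos (s * x) * cosine_transform s + sin (s * x) * sine_transform s)"
  proof (rule integral_cong)
    fix s
    have "integral {0..c} (\<lambda>y. cos (s * x) * (cos (s * y) * f y) + sin (s * x) * (sin (s * y) * f y)) =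
      integral {0..c} (\<lambda>y. cos (s * x) * (cos (s * y) * f y)) +
      integral {0..c} (\<lambda>y. sin (s * x) * (sin (s * y) * f y))"
      by (intro Henstock_Kurzweil_Integration.integral_add integrable_continuous_interval continuous_intros f)
    then show "integral {0..c} (\<lambda>y. (cos (s * x) * cos (s * y) + sin (s * x) * sin (s * y)) * f y) =
      cos (s * x) * cosine_transform s + sin (s * x) * sine_transform s"
      by (simp add: ip_def distrib_right mult.assoc)
  qed
  finally show ?thesis by (simp add: field_simps)
qed

text \<open>Interchanging the integrals separates the two variables and leaves the energy of f in
  the band.\<close>

lemma sinc_form:
  "ip c (kop c sinc_kernel f) f =
     integral {0..pi} (\<lambda>s. (cosine_transform s)\<^sup>2 + (sine_transform s)\<^sup>2) / pi"
proof -
  let ?C = "cosine_transform" and ?S = "sine_transform"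
  have "kop c sinc_kernel f x * f x = integral {0..pi}
      (\<lambda>s. (cos (s * x) * ?C s + sin (s * x) * ?S s) * f x) / pi" for x
    unfolding sinc_kop Henstock_Kurzweil_Integration.integral_mult_left by simp
  then have "pi * ip c (kop c sinc_kernel f) f = integral {0..c} (\<lambda>x. integral {0..pi}
      (\<lambda>s. (cos (s * x) * ?C s + sin (s * x) * ?S s) * f x))"
    by (simp add: ip_def[of c "kop c sinc_kernel f"])
  also have "\<dots> = integral {0..pi} (\<lambda>s. integral {0..c}
      (\<lambda>x. (cos (s * x) * ?C s + sin (s * x) * ?S s) * f x))"
    by (rule integral_swap_continuous_Icc)
       (auto simp: split_beta intro!: continuous_intros continuous_on_compose2[OF f]
          continuous_on_compose2[OF continuous_on_transforms(1)[of UNIV]]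
          continuous_on_compose2[OF continuous_on_transforms(2)[of UNIV]])
  also have "\<dots> = integral {0..pi} (\<lambda>s. (?C s)\<^sup>2 + (?S s)\<^sup>2)"
  proof (rule integral_cong)
    fix s
    have "integral {0..c} (\<lambda>x. ?C s * (cos (s * x) * f x) + ?S s * (sin (s * x) * f x)) =
      integral {0..c} (\<lambda>x. ?C s * (cos (s * x) * f x)) + integral {0..c} (\<lambda>x. ?S s * (sin (s * x) * f x))"
      by (intro Henstock_Kurzweil_Integration.integral_add integrable_continuous_interval continuous_intros f)
    also have "\<dots> = (?C s)\<^sup>2 + (?S s)\<^sup>2" by (simp add: ip_def power2_eq_square)
    finally show "integral {0..c} (\<lambda>x. (cos (s * x) * ?C s + sin (s * x) * ?S s) * f x) = (?C s)\<^sup>2 + (?S s)\<^sup>2"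
      by (simp add: algebra_simps)
  qed
  finally show ?thesis by (simp add: field_simps)
qed

text \<open>A point mass a at x has the transforms a * cos (s * x) and a * sin (s * x). Adding them
  to those of f gives a sum of squares, hence the positivity that \<open>psd_kernel\<close>
  demands.\<close>

lemma sinc_form_point:
  "a\<^sup>2 * sinc_kernel x x + 2 * a * kop c sinc_kernel f x + ip c (kop c sinc_kernel f) f =
     integral {0..pi} (\<lambda>s. (a * cos (s * x) + cosine_transform s)\<^sup>2 + (a * sin (s * x) + sine_transform s)\<^sup>2) / pi"
proof -
  let ?C = "cosine_transform" and ?S = "sine_transform"
  note c = continuous_on_transforms[of "{0..pi}"]
  have square: "(a * u + C)\<^sup>2 + (a * v + S)\<^sup>2 =
      a\<^sup>2 * (u * u + v * v) + (2 * a * (u * C + v * S) + (C\<^sup>2 + S\<^sup>2))" for u v C S :: real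
    by (simp add: power2_eq_square algebra_simps)
  have "integral {0..pi} (\<lambda>s. (a * cos (s * x) + ?C s)\<^sup>2 + (a * sin (s * x) + ?S s)\<^sup>2) =
    integral {0..pi} (\<lambda>s. a\<^sup>2 * (cos (s * x) * cos (s * x) + sin (s * x) * sin (s * x)) +
      (2 * a * (cos (s * x) * ?C s + sin (s * x) * ?S s) + ((?C s)\<^sup>2 + (?S s)\<^sup>2)))"
    unfolding square ..
  also have "\<dots> = a\<^sup>2 * integral {0..pi} (\<lambda>s. cos (s * x) * cos (s * x) + sin (s * x) * sin (s * x)) +
      (2 * a * integral {0..pi} (\<lambda>s. cos (s * x) * ?C s + sin (s * x) * ?S s) +
       integral {0..pi} (\<lambda>s. (?C s)\<^sup>2 + (?S s)\<^sup>2))"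
    by (subst Henstock_Kurzweil_Integration.integral_add,
        (intro integrable_continuous_interval continuous_intros c)+,
        subst Henstock_Kurzweil_Integration.integral_add,
        (intro integrable_continuous_interval continuous_intros c)+,
        simp only: Henstock_Kurzweil_Integration.integral_mult_right)
  finally show ?thesis
    unfolding sinc_kop sinc_form sinc_kernel_integral[of x x] by (simp add: field_simps)
qed

text \<open>The transform of \<open>f\<close> is a power series whose coefficients are the moments of \<open>f\<close>.\<close>

lemma moments_eq_0:
  fixes F :: "real \<Rightarrow> real" and a :: "nat \<Rightarrow> real"
  assumes abs: "\<And>x::real. summable (\<lambda>n. norm (a n *\<^sub>R x ^ n))" and F: "\<And>x. (\<lambda>n. a n *\<^sub>R x ^ n) sums F x"
    and zero: "\<And>s. s \<in> {0..pi} \<Longrightarrow> ip c (\<lambda>y. F (s * y)) f = 0" and c: "0 < c"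
  shows "a n * ip c (\<lambda>y. y ^ n) f = 0"
proof -
  have ps: "(\<lambda>n. (a n * ip c (\<lambda>y. y ^ n) f) * s ^ n) sums ip c (\<lambda>y. F (s * y)) f" for s
  proof -
    have "uniform_limit {0..c} (\<lambda>n y. \<Sum>i<n. a i *\<^sub>R (s * y) ^ i) (\<lambda>y. \<Sum>i. a i *\<^sub>R (s * y) ^ i) sequentially"
    proof (rule Weierstrass_m_test)
      show "summable (\<lambda>n. norm (a n *\<^sub>R (\<bar>s\<bar> * c) ^ n))" by (rule abs)
      fix n y assume "y \<in> {0..c}"
      then have "\<bar>s * y\<bar> ^ n \<le> (\<bar>s\<bar> * c) ^ n"
        by (intro power_mono) (auto simp: abs_mult intro!: mult_left_mono)
      then show "norm (a n *\<^sub>R (s * y) ^ n) \<le> norm (a n *\<^sub>R (\<bar>s\<bar> * c) ^ n)"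
        using c by (simp add: abs_mult power_abs mult_left_mono)
    qed
    then have "uniform_limit {0..c} (\<lambda>n y. \<Sum>i<n. a i *\<^sub>R (s * y) ^ i) (\<lambda>y. F (s * y)) sequentially"
      using F by (simp add: sums_iff)
    then have "(\<lambda>n. ip c (\<lambda>y. \<Sum>i<n. a i *\<^sub>R (s * y) ^ i) f) \<longlonglongrightarrow> ip c (\<lambda>y. F (s * y)) f"
      by (rule ip_uniform_limit[OF _ _ uniform_limit_const f]) (intro continuous_intros)
    moreover have "ip c (\<lambda>y. \<Sum>i<n. a i *\<^sub>R (s * y) ^ i) f = (\<Sum>i<n. (a i * ip c (\<lambda>y. y ^ i) f) * s ^ i)" for n
    proof -
      have "ip c (\<lambda>y. \<Sum>i<n. a i *\<^sub>R (s * y) ^ i) f = ip c (\<lambda>y. \<Sum>i<n. (a i * s ^ i) * y ^ i) f"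
        by (simp add: power_mult_distrib mult.assoc)
      also have "\<dots> = (\<Sum>i<n. (a i * s ^ i) * ip c (\<lambda>y. y ^ i) f)"
        by (rule ip_sum) (auto intro!: continuous_intros f)
      finally show ?thesis by (simp add: mult_ac)
    qed
    ultimately show ?thesis by (simp add: sums_def)
  qed
  show ?thesis
  \<comment> \<open>The constant coefficient is the value at s = 0. Any other nonzero coefficient
    would make 0 an isolated zero of the power series, whereas the function vanishes on all of
    {0..pi}.\<close>
  proof (cases "n = 0")
    case True
    show ?thesis using sums_unique2[OF ps[of 0] powser_sums_zero] zero[of 0] True by simp
  next
    case False
    show ?thesis
    proof (rule ccontr)
      assume "a n * ip c (\<lambda>y. y ^ n) f \<noteq> 0"
      then obtain r where r: "0 < r" "\<And>z. z \<in> cball 0 r - {0} \<Longrightarrow> ip c (\<lambda>y. F (z * y)) f \<noteq> 0"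
        using powser_0_nonzero[of 1 0 "\<lambda>n. a n * ip c (\<lambda>y. y ^ n) f" "\<lambda>s. ip c (\<lambda>y. F (s * y)) f" n]
          ps zero[of 0] False by auto
      have "ip c (\<lambda>y. F (min r pi * y)) f \<noteq> 0" by (rule r(2)) (use r(1) pi_gt_zero in \<open>auto simp: min_def\<close>)
      with zero[of "min r pi"] r(1) show False by simp
    qed
  qed
qed

text \<open>If the form vanished, both transforms would vanish on the band, hence all moments of f
  would be 0. Then f would be orthogonal to every polynomial and, by density, to itself.\<close>

lemma sinc_form_pos:
  assumes c: "0 < c" and x: "x \<in> {0..c}" and nz: "f x \<noteq> 0"
  shows "0 < ip c (kop c sinc_kernel f) f"
proof (rule ccontr)
  let ?C = "cosine_transform" and ?S = "sine_transform"
  assume "\<not> ?thesis"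
  moreover have int_nonneg: "0 \<le> integral {0..pi} (\<lambda>s. (?C s)\<^sup>2 + (?S s)\<^sup>2)"
    by (intro integral_nonneg integrable_continuous_interval continuous_intros continuous_on_transforms) auto
  ultimately have "integral {0..pi} (\<lambda>s. (?C s)\<^sup>2 + (?S s)\<^sup>2) = 0"
    unfolding sinc_form using pi_gt_zero by (simp add: zero_less_divide_iff not_less order_antisym)
  then have z: "\<And>s. s \<in> {0..pi} \<Longrightarrow> (?C s)\<^sup>2 + (?S s)\<^sup>2 = 0"
    by (subst (asm) integral_eq_0_iff) (auto intro!: continuous_intros continuous_on_transforms)
  have C0: "?C s = 0" and S0: "?S s = 0" if "s \<in> {0..pi}" for s
    using z[OF that] by (simp_all add: sum_power2_eq_zero_iff)
  have mom: "ip c (\<lambda>y. y ^ n) f = 0" for n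
  \<comment> \<open>The cosine series has nonzero coefficients exactly at even indices and the sine
    series at odd ones, so the two transforms together reach every moment.\<close>
  proof (cases "even n")
    case True
    then have "cos_coeff n \<noteq> 0" by (auto simp: cos_coeff_def)
    then show ?thesis
      using moments_eq_0[OF summable_norm_cos cos_converges C0 c, of n] by simp
  next
    case False
    then have "sin_coeff n \<noteq> 0" by (auto simp: sin_coeff_def)
    then show ?thesis
      using moments_eq_0[OF summable_norm_sin sin_converges S0 c, of n] by simp
  qed
  obtain g where g: "uniform_limit {0..c} g f sequentially" "\<And>n. polynomial_function (g n)"
    using Stone_Weierstrass_uniform_limit[of "{0..c}" f] f by auto
  have "ip c (g n) f = 0" for n
  proof -
    obtain a m where gn: "g n = (\<lambda>x. \<Sum>i\<le>m. a i * x ^ i)"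
      using g(2)[of n] unfolding real_polynomial_function_eq[symmetric] real_polynomial_function_iff_sum by blast
    have "ip c (g n) f = (\<Sum>i\<le>m. a i * ip c (\<lambda>x. x ^ i) f)"
      unfolding gn by (rule ip_sum) (auto intro!: continuous_intros f)
    then show ?thesis by (simp add: mom)
  qed
  moreover have "(\<lambda>n. ip c (g n) f) \<longlonglongrightarrow> ip c f f"
    by (rule ip_uniform_limit[OF g(1) _ uniform_limit_const f]) (use g(2) continuous_on_polymonial_function in blast)
  ultimately have "ip c f f = 0" by (simp add: LIMSEQ_const_iff)
  with ip_self_eq_0[OF c f] x nz show False by blast
qed

end

lemma psd_sinc_kernel: "psd_kernel c sinc_kernel"
  unfolding psd_kernel_def
proof (intro conjI ballI allI impI continuous_on_sinc_kernel)
  fix x a f assume f: "continuous_on {0..c} (f :: real \<Rightarrow> real)"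
  have "0 \<le> integral {0..pi} (\<lambda>s. (a * cos (s * x) + ip c (\<lambda>y. cos (s * y)) f)\<^sup>2 +
      (a * sin (s * x) + ip c (\<lambda>y. sin (s * y)) f)\<^sup>2)"
    by (intro integral_nonneg integrable_continuous_interval continuous_intros continuous_on_transforms f) auto
  then show "0 \<le> a\<^sup>2 * sinc_kernel x x + 2 * a * kop c sinc_kernel f x + ip c (kop c sinc_kernel f) f"
    unfolding sinc_form_point[OF f] by simp
qed (rule sinc_kernel_sym)

theorem sinc_spectral_expansion:
  assumes "0 < c"
  shows "\<exists>\<mu> \<phi>. spectral_expansion c sinc_kernel \<mu> \<phi>"
proof -
  interpret interval_kernel c sinc_kernel
    using assms psd_sinc_kernel by unfold_locales
  show ?thesis by (rule spectral_expansion_exists) (rule sinc_form_pos[OF _ assms])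
qed

section \<open>The eigenvalue list\<close>

lemma space_interval_measure: "space (interval_measure c) = {0<..<c}"
  by (simp add: interval_measure_def space_restrict_space)

lemma finite_measure_interval_measure: "finite_measure (interval_measure c)"
  unfolding interval_measure_def
  by (rule finite_measureI)
     (use emeasure_bounded_finite[OF bounded_box, of 0 c] in
       \<open>simp add: space_restrict_space emeasure_restrict_space less_top[symmetric]\<close>)

lemma borel_measurable_interval_measure:
  fixes f :: "real \<Rightarrow> 'a::topological_space"
  assumes "continuous_on {0..c} f"
  shows "f \<in> borel_measurable (interval_measure c)"
proof -
  have "continuous_on {0<..<c} f" by (rule continuous_on_subset[OF assms]) auto
  then have "f \<in> borel_measurable (restrict_space borel {0<..<c})"
    by (rule borel_measurable_continuous_on_restrict)
  moreover have "sets (restrict_space borel {0<..<c}) = sets (interval_measure c)"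
    unfolding interval_measure_def by (intro sets_restrict_space_cong) simp
  ultimately show ?thesis using measurable_cong_sets by blast
qed

lemma bounded_continuous_on_Icc:
  fixes f :: "real \<Rightarrow> 'a::real_normed_vector"
  assumes "continuous_on {0..c} f"
  obtains B where "0 < B" "\<And>x. x \<in> {0..c} \<Longrightarrow> norm (f x) \<le> B"
proof -
  have "bounded (f ` {0..c})"
    by (intro compact_imp_bounded compact_continuous_image assms) auto
  then show thesis using that unfolding bounded_pos by blast
qed

lemma integrable_interval_measure_mult:
  fixes f :: "real \<Rightarrow> 'a::{real_normed_algebra, banach, second_countable_topology}"
  assumes g: "continuous_on {0..c} g" and f: "integrable (interval_measure c) f"
  shows "integrable (interval_measure c) (\<lambda>x. g x * f x)"
proof -
  obtain B where B: "0 < B" "\<And>x. x \<in> {0..c} \<Longrightarrow> norm (g x) \<le> B"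
    using bounded_continuous_on_Icc[OF g] by blast
  show ?thesis
  proof (rule Bochner_Integration.integrable_bound)
    show "integrable (interval_measure c) (\<lambda>x. B * norm (f x))" using f by simp
    show "(\<lambda>x. g x * f x) \<in> borel_measurable (interval_measure c)"
      using borel_measurable_interval_measure[OF g] f by measurable
    show "AE x in interval_measure c. norm (g x * f x) \<le> norm (B * norm (f x))"
    proof (rule AE_I2)
      fix x assume "x \<in> space (interval_measure c)"
      then have "norm (g x) * norm (f x) \<le> B * norm (f x)"
        using B(2)[of x] by (intro mult_right_mono) (auto simp: space_interval_measure)
      then show "norm (g x * f x) \<le> norm (B * norm (f x))"
        using B(1) norm_mult_ineq[of "g x" "f x"] by simp
    qed
  qed
qed

lemma integrable_interval_measure:
  fixes f :: "real \<Rightarrow> 'a::{real_normed_algebra_1, banach, second_countable_topology}"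
  assumes "continuous_on {0..c} f"
  shows "integrable (interval_measure c) f"
proof -
  interpret finite_measure "interval_measure c" by (rule finite_measure_interval_measure)
  show ?thesis using integrable_interval_measure_mult[OF assms integrable_const[of 1]] by simp
qed

lemma integral_interval_measure:
  fixes f :: "real \<Rightarrow> real"
  assumes f: "continuous_on {0..c} f"
  shows "(LINT x|interval_measure c. f x) = integral {0..c} f"
proof -
  have *: "(LINT x|interval_measure c. f x) = set_lebesgue_integral lborel {0<..<c} f"
    unfolding interval_measure_def set_lebesgue_integral_def by (rule integral_restrict_space) simp
  have "set_integrable lborel {0<..<c} f"
    using integrable_interval_measure[OF f]
    by (simp add: interval_measure_def set_integrable_def integrable_restrict_space)
  with * show ?thesis
    by (simp add: set_borel_integral_eq_integral integral_open_interval_real)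
qed

lemma square_integrable_imp_integrable:
  assumes "square_integrable c f"
  shows "integrable (interval_measure c) f"
proof -
  interpret finite_measure "interval_measure c" by (rule finite_measure_interval_measure)
  show ?thesis
  proof (rule Bochner_Integration.integrable_bound)
    show "integrable (interval_measure c) (\<lambda>x. 1 + (cmod (f x))\<^sup>2)"
      using assms by (simp add: square_integrable_def)
    show "f \<in> borel_measurable (interval_measure c)"
      using assms by (simp add: square_integrable_def)
    have "t \<le> 1 + t\<^sup>2" for t :: real
      using zero_le_power2[of "t - 1/2"] by (simp add: power2_eq_square algebra_simps)
    then show "AE x in interval_measure c. norm (f x) \<le> norm (1 + (cmod (f x))\<^sup>2)"
      by (simp add: abs_of_nonneg)
  qed
qed

text \<open>The matrices expressing two bases in each other are mutually inverse, so their products in the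
  two orders have the same trace, which is \<open>d\<close> and \<open>m\<close>, respectively.\<close>

lemma eigenspace_dim_unique:
  assumes "eigenspace_dim c \<nu> d" "eigenspace_dim c \<nu> m"
  shows "d = m"
proof -
  let ?M = "interval_measure c"
  obtain \<phi> :: "nat \<Rightarrow> real \<Rightarrow> complex" where \<phi>: "\<And>i. i < d \<Longrightarrow> in_eigenspace c \<nu> (\<phi> i)"
    "\<And>a i. AE x in ?M. (\<Sum>i<d. a i * \<phi> i x) = 0 \<Longrightarrow> i < d \<Longrightarrow> a i = 0"
    "\<And>f. in_eigenspace c \<nu> f \<Longrightarrow> \<exists>a :: nat \<Rightarrow> complex. AE x in ?M. f x = (\<Sum>i<d. a i * \<phi> i x)"
    using assms(1) unfolding eigenspace_dim_def by blast
  obtain \<psi> :: "nat \<Rightarrow> real \<Rightarrow> complex" where \<psi>: "\<And>i. i < m \<Longrightarrow> in_eigenspace c \<nu> (\<psi> i)"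
    "\<And>a i. AE x in ?M. (\<Sum>i<m. a i * \<psi> i x) = 0 \<Longrightarrow> i < m \<Longrightarrow> a i = 0"
    "\<And>f. in_eigenspace c \<nu> f \<Longrightarrow> \<exists>a :: nat \<Rightarrow> complex. AE x in ?M. f x = (\<Sum>i<m. a i * \<psi> i x)"
    using assms(2) unfolding eigenspace_dim_def by blast
  have "\<forall>i\<in>{..<d}. \<exists>a. AE x in ?M. \<phi> i x = (\<Sum>k<m. a k * \<psi> k x)"
    using \<psi>(3)[OF \<phi>(1)] by blast
  from bchoice[OF this]
  obtain A where A: "\<And>i. i < d \<Longrightarrow> AE x in ?M. \<phi> i x = (\<Sum>k<m. A i k * \<psi> k x)" by blast
  have "\<forall>k\<in>{..<m}. \<exists>b. AE x in ?M. \<psi> k x = (\<Sum>i<d. b i * \<phi> i x)"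
    using \<phi>(3)[OF \<psi>(1)] by blast
  from bchoice[OF this]
  obtain B where B: "\<And>k. k < m \<Longrightarrow> AE x in ?M. \<psi> k x = (\<Sum>i<d. B k i * \<phi> i x)" by blast
  have inverse: "(\<Sum>k<n. A i k * B k i) = 1"
    if i: "i < e" and A: "\<And>i. i < e \<Longrightarrow> AE x in ?M. \<phi> i x = (\<Sum>k<n. A i k * \<psi> k x)"
      and B: "\<And>k. k < n \<Longrightarrow> AE x in ?M. \<psi> k x = (\<Sum>i<e. B k i * \<phi> i x)"
      and indep: "\<And>a i. AE x in ?M. (\<Sum>i<e. a i * \<phi> i x) = 0 \<Longrightarrow> i < e \<Longrightarrow> a i = 0"
    for A B :: "nat \<Rightarrow> nat \<Rightarrow> complex" and \<phi> \<psi> :: "nat \<Rightarrow> real \<Rightarrow> complex" and e n i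
  proof -
    have "AE x in ?M. \<forall>k\<in>{..<n}. \<psi> k x = (\<Sum>j<e. B k j * \<phi> j x)"
      using B by (intro AE_finite_allI) auto
    with A[OF i] have "AE x in ?M. (\<Sum>j<e. ((\<Sum>k<n. A i k * B k j) - (if j = i then 1 else 0)) * \<phi> j x) = 0"
    proof eventually_elim
      case (elim x)
      have "\<phi> i x = (\<Sum>k<n. A i k * (\<Sum>j<e. B k j * \<phi> j x))" using elim by simp
      also have "\<dots> = (\<Sum>k<n. \<Sum>j<e. A i k * B k j * \<phi> j x)" by (simp add: sum_distrib_left mult.assoc)
      also have "\<dots> = (\<Sum>j<e. \<Sum>k<n. A i k * B k j * \<phi> j x)" by (rule sum.swap)
      finally have "(\<Sum>j<e. (\<Sum>k<n. A i k * B k j) * \<phi> j x) = \<phi> i x" by (simp add: sum_distrib_right)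
      moreover have "(\<Sum>j<e. (if j = i then 1 else 0) * \<phi> j x) = \<phi> i x"
        using i by (simp add: if_distrib[of "\<lambda>t. t * _"] sum.delta cong: if_cong)
      ultimately show ?case by (simp add: left_diff_distrib sum_subtractf)
    qed
    from indep[OF this i] show ?thesis by simp
  qed
  have "(\<Sum>k<m. A i k * B k i) = 1" if "i < d" for i
    by (rule inverse[where e = d and \<phi> = \<phi> and \<psi> = \<psi>, OF that]) (fact A B \<phi>(2))+
  then have d: "(\<Sum>i<d. \<Sum>k<m. A i k * B k i) = of_nat d" by simp
  have "(\<Sum>i<d. B k i * A i k) = 1" if "k < m" for k
    by (rule inverse[where e = m and \<phi> = \<psi> and \<psi> = \<phi>, OF that]) (fact A B \<psi>(2))+
  then have "(\<Sum>k<m. \<Sum>i<d. B k i * A i k) = of_nat m" by simp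
  moreover note d
  moreover have "(\<Sum>i<d. \<Sum>k<m. A i k * B k i) = (\<Sum>k<m. \<Sum>i<d. B k i * A i k)"
    by (subst sum.swap) (simp add: mult.commute)
  ultimately have "(of_nat d :: complex) = of_nat m" by simp
  then show ?thesis by simp
qed

text \<open>An initial segment is determined by its size, so decreasing lists can be compared by
  counting their members above each threshold.\<close>

lemma decseq_superlevel:
  fixes l :: "nat \<Rightarrow> real"
  assumes "decseq l" "finite {k. t \<le> l k}"
  shows "{k. t \<le> l k} = {..<card {k. t \<le> l k}}"
proof -
  have "\<exists>k. \<not> t \<le> l k"
  proof (rule ccontr)
    assume "\<not> ?thesis"
    then have "{k. t \<le> l k} = UNIV" by blast
    then show False using assms(2) by simp
  qed
  define N where "N = (LEAST k. \<not> t \<le> l k)"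
  have N: "\<not> t \<le> l N" unfolding N_def using \<open>\<exists>k. \<not> t \<le> l k\<close> by (rule LeastI_ex)
  have "{k. t \<le> l k} = {..<N}"
  proof safe
    fix k assume "t \<le> l k"
    then show "k < N" using N decseqD[OF assms(1), of N k] by (cases "k < N") auto
  next
    fix k assume "k < N"
    then show "t \<le> l k" unfolding N_def using not_less_Least by blast
  qed
  then show ?thesis by simp
qed

text \<open>\<open>eigenvalue_list\<close> by itself does not say that the values tend to 0. As
  \<open>l'\<close> does, only finitely many of its values lie above t. Each value of
  \<open>l\<close> has a nonzero eigenspace and so occurs in \<open>l'\<close>, and both
  multiplicities equal the dimension; thus the counts above t agree.\<close>

lemma eigenvalue_list_unique:
  assumes l: "eigenvalue_list c l" and l': "eigenvalue_list c l'" and "l' \<longlonglongrightarrow> 0"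
  shows "l = l'"
proof -
  have fin: "finite {k. l k = t}" "finite {k. l' k = t}" if "0 < t" for t
    using l l' that by (simp_all add: eigenvalue_list_def)
  have same: "card {k. l k = t} = card {k. l' k = t}" if "0 < t" for t
    by (rule eigenspace_dim_unique[of c t]) (use l l' that in \<open>simp_all add: eigenvalue_list_def\<close>)
  have sup: "{k. t \<le> l k} = {k. t \<le> l' k}" if t: "0 < t" for t
  proof -
    have fl': "finite {k. t \<le> l' k}"
    proof -
      have "\<forall>\<^sub>F k in sequentially. l' k < t" using \<open>l' \<longlonglongrightarrow> 0\<close> t by (rule order_tendstoD)
      then obtain N where "\<And>k. k \<ge> N \<Longrightarrow> l' k < t" unfolding eventually_sequentially by blast
      then have "{k. t \<le> l' k} \<subseteq> {..<N}" by (force simp: not_le[symmetric])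
      then show ?thesis by (rule finite_subset) simp
    qed
    define W where "W = l' ` {k. t \<le> l' k}"
    have fW: "finite W" unfolding W_def using fl' by (rule finite_imageI)
    have W: "w \<in> W \<Longrightarrow> t \<le> w" for w by (auto simp: W_def)
    have e': "{k. t \<le> l' k} = (\<Union>w\<in>W. {k. l' k = w})" by (auto simp: W_def)
    have "l k \<in> W" if k: "t \<le> l k" for k
    proof -
      have lk: "0 < l k" using t k by simp
      have "card {n. l n = l k} \<noteq> 0" using fin(1)[OF lk] by auto
      then have "{n. l' n = l k} \<noteq> {}" unfolding same[OF lk] by force
      then obtain n where n: "l' n = l k" by blast
      have "l' n \<in> W" unfolding W_def using n k by (intro imageI) simp
      then show ?thesis by (simp add: n)
    qed
    then have e: "{k. t \<le> l k} = (\<Union>w\<in>W. {k. l k = w})" using W by auto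
    have pos: "w \<in> W \<Longrightarrow> 0 < w" for w using W[of w] t by simp
    have "card {k. t \<le> l k} = (\<Sum>w\<in>W. card {k. l k = w})"
      unfolding e by (rule card_UN_disjoint) (use fW fin pos in auto)
    also have "\<dots> = (\<Sum>w\<in>W. card {k. l' k = w})" using same pos by simp
    also have "\<dots> = card {k. t \<le> l' k}"
      unfolding e' by (rule card_UN_disjoint[symmetric]) (use fW fin pos in auto)
    finally have "card {k. t \<le> l k} = card {k. t \<le> l' k}" .
    moreover have "finite {k. t \<le> l k}" unfolding e using fW fin pos by blast
    ultimately show ?thesis
      using decseq_superlevel[of l t] decseq_superlevel[of l' t] l l' fl'
      by (simp add: eigenvalue_list_def)
  qed
  show ?thesis
  proof
    fix k
    have "0 < l k" "0 < l' k" using l l' by (auto simp: eigenvalue_list_def)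
    then show "l k = l' k" using sup[of "l k"] sup[of "l' k"] by (intro order_antisym) auto
  qed
qed

section \<open>Eigenspaces of the complex operator, read off from Mercer's expansion\<close>

locale sinc_spectrum =
  fixes c :: real and \<mu> :: "nat \<Rightarrow> real" and \<phi> :: "nat \<Rightarrow> real \<Rightarrow> real"
  assumes c_pos: "0 < c" and expansion: "spectral_expansion c sinc_kernel \<mu> \<phi>"
begin

abbreviation M where "M \<equiv> interval_measure c"

lemma \<mu>_decseq: "decseq \<mu>" and \<mu>_pos: "0 < \<mu> n" and \<phi>_cont: "continuous_on {0..c} (\<phi> n)"
  and \<phi>_orthonormal: "ip c (\<phi> i) (\<phi> j) = (if i = j then 1 else 0)"
  and mercer: "x \<in> {0..c} \<Longrightarrow> y \<in> {0..c} \<Longrightarrow> (\<lambda>n. \<mu> n * \<phi> n x * \<phi> n y) sums sinc_kernel x y"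
  using expansion by (auto simp: spectral_expansion_def)

lemma \<phi>_orthonormal_LINT: "(LINT x|M. \<phi> i x * \<phi> j x) = (if i = j then 1 else 0)"
  using \<phi>_orthonormal[of i j] unfolding ip_def
  by (subst integral_interval_measure) (auto intro!: continuous_intros \<phi>_cont)

definition trunc :: "nat \<Rightarrow> real \<Rightarrow> real \<Rightarrow> real" where
  "trunc n x y = (\<Sum>j<n. \<mu> j * \<phi> j x * \<phi> j y)"

lemma trunc_tendsto: "x \<in> {0..c} \<Longrightarrow> y \<in> {0..c} \<Longrightarrow> (\<lambda>n. trunc n x y) \<longlonglongrightarrow> sinc_kernel x y"
  using mercer by (simp add: trunc_def sums_def)

lemma trunc_row_cont: "continuous_on {0..c} (trunc n x)"
  unfolding trunc_def by (intro continuous_intros \<phi>_cont)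

lemma trunc_diag: "x \<in> {0..c} \<Longrightarrow> 0 \<le> trunc n x x \<and> trunc n x x \<le> 1"
proof
  assume x: "x \<in> {0..c}"
  have nn: "0 \<le> \<mu> j * \<phi> j x * \<phi> j x" for j
    using \<mu>_pos[of j] by (simp add: mult.assoc)
  then show "0 \<le> trunc n x x" unfolding trunc_def by (intro sum_nonneg) auto
  have "trunc n x x \<le> suminf (\<lambda>j. \<mu> j * \<phi> j x * \<phi> j x)"
    unfolding trunc_def using mercer[OF x x] nn by (intro sum_le_suminf) (auto simp: sums_iff)
  then show "trunc n x x \<le> 1" using mercer[OF x x] by (simp add: sums_iff sinc_kernel_def)
qed

text \<open>Cauchy-Schwarz reduces this to the diagonal, where the partial sums increase to
  \<open>sinc_kernel x x\<close>, which is 1. Being independent of n, the bound drives the dominated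
  convergence arguments below.\<close>

lemma trunc_abs_le_1:
  assumes x: "x \<in> {0..c}" and y: "y \<in> {0..c}"
  shows "\<bar>trunc n x y\<bar> \<le> 1"
proof -
  have s: "sqrt (\<mu> j) * \<phi> j x * (sqrt (\<mu> j) * \<phi> j y) = \<mu> j * \<phi> j x * \<phi> j y" for j x y
  proof -
    have "sqrt (\<mu> j) * \<phi> j x * (sqrt (\<mu> j) * \<phi> j y) = (sqrt (\<mu> j) * sqrt (\<mu> j)) * \<phi> j x * \<phi> j y"
      by (simp only: mult_ac)
    then show ?thesis using \<mu>_pos[of j] by simp
  qed
  have "(trunc n x y)\<^sup>2 \<le> trunc n x x * trunc n y y"
    using Cauchy_Schwarz_ineq_sum[of "\<lambda>j. sqrt (\<mu> j) * \<phi> j x" "\<lambda>j. sqrt (\<mu> j) * \<phi> j y" "{..<n}"]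
    by (simp only: trunc_def s power2_eq_square)
  also have "\<dots> \<le> 1 * 1" using trunc_diag[OF x] trunc_diag[OF y] by (intro mult_mono) auto
  finally show ?thesis by (simp add: abs_square_le_1)
qed

text \<open>Mercer's expansion is integrated along the diagonal: each normalized eigenfunction
  contributes its eigenvalue, and the kernel is 1 there.\<close>

lemma trace: "\<mu> sums c"
proof -
  interpret finite_measure M by (rule finite_measure_interval_measure)
  have "(\<lambda>n. LINT x|M. trunc n x x) \<longlonglongrightarrow> (LINT x|M. sinc_kernel x x)"
  proof (rule integral_dominated_convergence[where w = "\<lambda>_. 1"])
    show "(\<lambda>x. trunc n x x) \<in> borel_measurable M" for n
      unfolding trunc_def by (intro borel_measurable_interval_measure continuous_intros \<phi>_cont)
    show "AE x in M. (\<lambda>n. trunc n x x) \<longlonglongrightarrow> sinc_kernel x x"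
      by (rule AE_I2) (auto simp: space_interval_measure intro: trunc_tendsto)
    show "AE x in M. norm (trunc n x x) \<le> 1" for n
      by (rule AE_I2) (auto simp: space_interval_measure intro!: trunc_abs_le_1)
  qed (auto simp: sinc_kernel_def)
  moreover have "(LINT x|M. trunc n x x) = (\<Sum>j<n. \<mu> j)" for n
  proof -
    have "(LINT x|M. trunc n x x) = (\<Sum>j<n. (LINT x|M. \<mu> j * (\<phi> j x * \<phi> j x)))"
      unfolding trunc_def mult.assoc
      by (rule Bochner_Integration.integral_sum)
         (intro integrable_interval_measure continuous_intros \<phi>_cont)
    then show ?thesis by (simp add: \<phi>_orthonormal_LINT)
  qed
  moreover have "(LINT x|M. sinc_kernel x x) = c"
    using c_pos by (subst integral_interval_measure) (simp_all add: sinc_kernel_def)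
  ultimately show ?thesis by (simp add: sums_def)
qed

lemma \<mu>_tendsto_0: "\<mu> \<longlonglongrightarrow> 0"
  using trace by (intro summable_LIMSEQ_zero) (rule sums_summable)

text \<open>A Fourier coefficient; there is no conjugation because the eigenfunctions are
  real.\<close>

definition coef :: "(real \<Rightarrow> complex) \<Rightarrow> nat \<Rightarrow> complex" where
  "coef f j = (LINT x|M. complex_of_real (\<phi> j x) * f x)"

lemma \<phi>_mult_integrable: "integrable M f \<Longrightarrow> integrable M (\<lambda>x. complex_of_real (\<phi> j x) * f x)"
  by (rule integrable_interval_measure_mult) (intro continuous_intros \<phi>_cont)

lemma trunc_op:
  assumes f: "integrable M f"
  shows "(LINT y|M. complex_of_real (trunc n x y) * f y) = (\<Sum>j<n. complex_of_real (\<mu> j * \<phi> j x) * coef f j)"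
proof -
  have "(LINT y|M. complex_of_real (trunc n x y) * f y) =
      (LINT y|M. (\<Sum>j<n. complex_of_real (\<mu> j * \<phi> j x) * (complex_of_real (\<phi> j y) * f y)))"
    by (simp add: trunc_def sum_distrib_right mult.assoc)
  also have "\<dots> = (\<Sum>j<n. (LINT y|M. complex_of_real (\<mu> j * \<phi> j x) * (complex_of_real (\<phi> j y) * f y)))"
    by (rule Bochner_Integration.integral_sum) (intro integrable_mult_right \<phi>_mult_integrable f)
  finally show ?thesis by (simp add: coef_def)
qed

lemma sinc_op_sums:
  assumes f: "integrable M f" and x: "x \<in> {0..c}"
  shows "(\<lambda>j. complex_of_real (\<mu> j * \<phi> j x) * coef f j) sums sinc_op c f x"
proof -
  have [measurable]: "f \<in> borel_measurable M" using f by simp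
  have [measurable]: "trunc n x \<in> borel_measurable M" "sinc_kernel x \<in> borel_measurable M" for n
    using interval_kernel.K_row_cont[OF interval_kernel.intro[OF c_pos psd_sinc_kernel] x]
    by (auto intro!: borel_measurable_interval_measure trunc_row_cont)
  have "(\<lambda>n. LINT y|M. complex_of_real (trunc n x y) * f y) \<longlonglongrightarrow>
      (LINT y|M. complex_of_real (sinc_kernel x y) * f y)"
  proof (rule integral_dominated_convergence[where w = "\<lambda>y. cmod (f y)"])
    show "AE y in M. (\<lambda>n. complex_of_real (trunc n x y) * f y) \<longlonglongrightarrow> complex_of_real (sinc_kernel x y) * f y"
      by (rule AE_I2) (use x in \<open>auto simp: space_interval_measure intro!: tendsto_intros trunc_tendsto\<close>)
    show "AE y in M. norm (complex_of_real (trunc n x y) * f y) \<le> cmod (f y)" for n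
      by (rule AE_I2)
         (use x in \<open>auto simp: space_interval_measure norm_mult intro!: mult_left_le_one_le trunc_abs_le_1\<close>)
  qed (use f in auto)
  then show ?thesis by (simp add: sums_def trunc_op[OF f] sinc_op_def)
qed

lemma coef_\<phi>: "coef (\<lambda>x. complex_of_real (\<phi> i x)) j = (if i = j then 1 else 0)"
proof -
  have "coef (\<lambda>x. complex_of_real (\<phi> i x)) j = complex_of_real (LINT x|M. \<phi> j x * \<phi> i x)"
    unfolding coef_def by (simp flip: of_real_mult)
  then show ?thesis by (simp add: \<phi>_orthonormal_LINT)
qed

lemma coef_sum:
  assumes "finite J" "\<And>i. i \<in> J \<Longrightarrow> integrable M (f i)"
  shows "coef (\<lambda>x. \<Sum>i\<in>J. a i * f i x) j = (\<Sum>i\<in>J. a i * coef (f i) j)"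
proof -
  have "coef (\<lambda>x. \<Sum>i\<in>J. a i * f i x) j = (LINT x|M. (\<Sum>i\<in>J. a i * (complex_of_real (\<phi> j x) * f i x)))"
    by (simp add: coef_def sum_distrib_left algebra_simps)
  also have "\<dots> = (\<Sum>i\<in>J. (LINT x|M. a i * (complex_of_real (\<phi> j x) * f i x)))"
    by (rule Bochner_Integration.integral_sum) (intro integrable_mult_right \<phi>_mult_integrable assms(2))
  finally show ?thesis by (simp add: coef_def)
qed

lemma \<phi>_integrable: "integrable M (\<lambda>x. complex_of_real (\<phi> j x))"
  by (intro integrable_interval_measure continuous_intros \<phi>_cont)

lemma \<phi>_in_eigenspace: "in_eigenspace c (\<mu> j) (\<lambda>x. complex_of_real (\<phi> j x))"
  unfolding in_eigenspace_def square_integrable_def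
proof (intro conjI AE_I2)
  show "(\<lambda>x. complex_of_real (\<phi> j x)) \<in> borel_measurable M" using \<phi>_integrable by auto
  have "integrable M (\<lambda>x. \<phi> j x * \<phi> j x)"
    by (intro integrable_interval_measure continuous_intros \<phi>_cont)
  then show "integrable M (\<lambda>x. (cmod (complex_of_real (\<phi> j x)))\<^sup>2)"
    by (simp add: power2_eq_square)
  fix x assume "x \<in> space M"
  then have x: "x \<in> {0..c}" by (simp add: space_interval_measure)
  have "(\<lambda>i. complex_of_real (\<mu> i * \<phi> i x) * coef (\<lambda>x. complex_of_real (\<phi> j x)) i) sums
      (complex_of_real (\<mu> j * \<phi> j x))"
    using sums_single[of j "\<lambda>i. complex_of_real (\<mu> i * \<phi> i x)"]
    by (simp add: coef_\<phi> if_distrib eq_commute cong: if_cong)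
  from sums_unique2[OF sinc_op_sums[OF \<phi>_integrable x] this]
  show "sinc_op c (\<lambda>x. complex_of_real (\<phi> j x)) x = complex_of_real (\<mu> j) * complex_of_real (\<phi> j x)"
    by simp
qed

text \<open>The pointwise expansion of the image is integrated term by term against \<phi> i.
  Domination holds because every partial sum is the image of f under a truncated kernel, hence
  bounded by the integral of \<open>cmod (f y)\<close>.\<close>

lemma coef_sinc_op:
  assumes f: "integrable M f"
  shows "coef (sinc_op c f) i = complex_of_real (\<mu> i) * coef f i"
proof -
  define S where "S n x = (\<Sum>j<n. complex_of_real (\<mu> j * \<phi> j x) * coef f j)" for n x
  define B where "B = (LINT y|M. cmod (f y))"
  interpret finite_measure M by (rule finite_measure_interval_measure)
  have Sc: "continuous_on {0..c} (S n)" for n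
    unfolding S_def[abs_def] by (intro continuous_intros \<phi>_cont)
  have [measurable]: "S n \<in> borel_measurable M" "(\<lambda>x. complex_of_real (\<phi> i x)) \<in> borel_measurable M" for n
    using borel_measurable_interval_measure[OF Sc] \<phi>_integrable by auto
  have lim: "(\<lambda>n. S n x) \<longlonglongrightarrow> sinc_op c f x" if "x \<in> {0..c}" for x
    using sinc_op_sums[OF f that] by (simp add: sums_def S_def)
  have [measurable]: "sinc_op c f \<in> borel_measurable M"
    by (rule borel_measurable_LIMSEQ_metric[of S]) (auto simp: space_interval_measure intro!: lim)
  have bound: "cmod (S n x) \<le> B" if x: "x \<in> {0..c}" for n x
  proof -
    have "S n x = (LINT y|M. complex_of_real (trunc n x y) * f y)" by (simp add: S_def trunc_op[OF f])
    also have "cmod \<dots> \<le> (LINT y|M. cmod (f y))"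
    proof (rule Bochner_Integration.integral_norm_bound_integral)
      show "integrable M (\<lambda>y. complex_of_real (trunc n x y) * f y)"
        by (intro integrable_interval_measure_mult continuous_intros trunc_row_cont f)
      show "norm (complex_of_real (trunc n x y) * f y) \<le> cmod (f y)" if "y \<in> space M" for y
        using that x by (auto simp: space_interval_measure norm_mult intro!: mult_left_le_one_le trunc_abs_le_1)
    qed (use f in auto)
    finally show ?thesis by (simp add: B_def)
  qed
  have "(\<lambda>n. LINT x|M. complex_of_real (\<phi> i x) * S n x) \<longlonglongrightarrow> (LINT x|M. complex_of_real (\<phi> i x) * sinc_op c f x)"
  proof (rule integral_dominated_convergence[where w = "\<lambda>x. cmod (complex_of_real (\<phi> i x)) * B"])
    show "integrable M (\<lambda>x. cmod (complex_of_real (\<phi> i x)) * B)"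
      using \<phi>_integrable by (intro integrable_mult_left integrable_norm)
    show "AE x in M. (\<lambda>n. complex_of_real (\<phi> i x) * S n x) \<longlonglongrightarrow> complex_of_real (\<phi> i x) * sinc_op c f x"
      by (rule AE_I2) (auto simp: space_interval_measure intro!: tendsto_intros lim)
    show "AE x in M. norm (complex_of_real (\<phi> i x) * S n x) \<le> cmod (complex_of_real (\<phi> i x)) * B" for n
      by (rule AE_I2) (auto simp: space_interval_measure norm_mult intro!: mult_left_mono bound)
  qed auto
  then have "(\<lambda>n. coef (S n) i) \<longlonglongrightarrow> coef (sinc_op c f) i" by (simp add: coef_def)
  moreover have "coef (S n) i = (if i < n then complex_of_real (\<mu> i) * coef f i else 0)" for n
  proof -
    have "coef (S n) i = coef (\<lambda>x. \<Sum>j<n. (complex_of_real (\<mu> j) * coef f j) * complex_of_real (\<phi> j x)) i"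
      by (simp add: S_def[abs_def] mult_ac)
    also have "\<dots> = (\<Sum>j<n. (complex_of_real (\<mu> j) * coef f j) * (if j = i then 1 else 0))"
      by (subst coef_sum) (auto intro: \<phi>_integrable simp: coef_\<phi>)
    also have "\<dots> = (\<Sum>j<n. if j = i then complex_of_real (\<mu> j) * coef f j else 0)"
      by (intro sum.cong) auto
    finally show ?thesis by (simp add: sum.delta)
  qed
  moreover have "(\<lambda>n. if i < n then complex_of_real (\<mu> i) * coef f i else 0) \<longlonglongrightarrow> complex_of_real (\<mu> i) * coef f i"
    by (rule tendsto_eventually) (use eventually_gt_at_top[of i] in eventually_elim, simp)
  ultimately show ?thesis using LIMSEQ_unique by simp
qed

lemma coef_cong_AE:
  assumes "integrable M f" "integrable M g" "AE x in M. f x = g x"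
  shows "coef f j = coef g j"
  unfolding coef_def
  by (rule integral_cong_AE) (use assms \<phi>_mult_integrable in auto)

lemma finite_level: "0 < t \<Longrightarrow> finite {n. \<mu> n = t}"
proof -
  assume "0 < t"
  then have "\<forall>\<^sub>F k in sequentially. \<mu> k < t" using \<mu>_tendsto_0 by (intro order_tendstoD)
  then obtain N where "\<And>k. k \<ge> N \<Longrightarrow> \<mu> k < t" unfolding eventually_sequentially by blast
  then have "{n. \<mu> n = t} \<subseteq> {..<N}" by (force simp: not_le[symmetric])
  then show ?thesis by (rule finite_subset) simp
qed

text \<open>Coefficients at other levels vanish, so the expansion of the image of f is a finite sum.
  Dividing by the nonzero t recovers f from its image, and completeness of the eigenfunctions in L2
  is bypassed.\<close>

lemma eigenspace_span:
  assumes f: "in_eigenspace c t f" and t: "0 < t"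
  shows "AE x in M. f x = (\<Sum>j | \<mu> j = t. coef f j * complex_of_real (\<phi> j x))"
proof -
  have fi: "integrable M f" and eig: "AE x in M. sinc_op c f x = complex_of_real t * f x"
    using f square_integrable_imp_integrable by (auto simp: in_eigenspace_def)
  have zero: "coef f j = 0" if "\<mu> j \<noteq> t" for j
  proof -
    have "coef (\<lambda>x. complex_of_real t * f x) j = complex_of_real t * coef f j"
      by (simp add: coef_def mult.left_commute[of _ "complex_of_real t"])
    moreover have "coef (sinc_op c f) j = coef (\<lambda>x. complex_of_real t * f x) j"
    proof -
      have "integrable M (\<lambda>x. complex_of_real t * f x)" using fi by simp
      moreover have "sinc_op c f \<in> borel_measurable M"
      proof (rule borel_measurable_LIMSEQ_metric)
        show "(\<lambda>x. \<Sum>j<n. complex_of_real (\<mu> j * \<phi> j x) * coef f j) \<in> borel_measurable M" for n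
          by (intro borel_measurable_interval_measure continuous_intros \<phi>_cont)
        show "(\<lambda>n. \<Sum>j<n. complex_of_real (\<mu> j * \<phi> j x) * coef f j) \<longlonglongrightarrow> sinc_op c f x" if "x \<in> space M" for x
          using sinc_op_sums[OF fi, of x] that by (simp add: sums_def space_interval_measure)
      qed
      ultimately have "integrable M (sinc_op c f)"
        using eig by (subst integrable_cong_AE[where g = "\<lambda>x. complex_of_real t * f x"]) auto
      then show ?thesis using eig fi by (intro coef_cong_AE) auto
    qed
    ultimately have "complex_of_real (\<mu> j) * coef f j = complex_of_real t * coef f j"
      using coef_sinc_op[OF fi] by simp
    then show ?thesis using that by simp
  qed
  have val: "sinc_op c f x = complex_of_real t * (\<Sum>j | \<mu> j = t. coef f j * complex_of_real (\<phi> j x))"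
    if x: "x \<in> {0..c}" for x
  proof -
    have "(\<lambda>j. complex_of_real (\<mu> j * \<phi> j x) * coef f j) sums
        (\<Sum>j | \<mu> j = t. complex_of_real (\<mu> j * \<phi> j x) * coef f j)"
      by (rule sums_finite[OF finite_level[OF t]]) (simp add: zero)
    from sums_unique2[OF sinc_op_sums[OF fi x] this] show ?thesis
      by (simp add: sum_distrib_left mult_ac)
  qed
  have "AE x in M. sinc_op c f x = complex_of_real t * (\<Sum>j | \<mu> j = t. coef f j * complex_of_real (\<phi> j x))"
    by (rule AE_I2) (auto simp: space_interval_measure intro!: val)
  with eig show ?thesis
    by eventually_elim (use t in simp)
qed

lemma eigenspace_dim_\<mu>:
  assumes t: "0 < t"
  shows "eigenspace_dim c t (card {n. \<mu> n = t})"
proof -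
  let ?J = "{n. \<mu> n = t}"
  obtain e where e: "bij_betw e {..<card ?J} ?J"
    using ex_bij_betw_nat_finite[OF finite_level[OF t]] by (auto simp: atLeast0LessThan)
  then have e_in: "i < card ?J \<Longrightarrow> \<mu> (e i) = t" for i by (auto simp: bij_betw_def)
  have e_inj: "i < card ?J \<Longrightarrow> k < card ?J \<Longrightarrow> e i = e k \<longleftrightarrow> i = k" for i k
    using e by (auto simp: bij_betw_def inj_on_def)
  show ?thesis
    unfolding eigenspace_dim_def
  proof (intro exI[of _ "\<lambda>i x. complex_of_real (\<phi> (e i) x)"] conjI allI impI)
    fix i assume "i < card ?J"
    then show "in_eigenspace c t (\<lambda>x. complex_of_real (\<phi> (e i) x))"
      using \<phi>_in_eigenspace[of "e i"] e_in by simp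
  next
    fix a :: "nat \<Rightarrow> complex" and k
    assume 0: "AE x in M. (\<Sum>i<card ?J. a i * complex_of_real (\<phi> (e i) x)) = 0" and k: "k < card ?J"
    have "0 = coef (\<lambda>_. 0) (e k)" by (simp add: coef_def)
    also have "\<dots> = coef (\<lambda>x. \<Sum>i<card ?J. a i * complex_of_real (\<phi> (e i) x)) (e k)"
      by (rule coef_cong_AE) (use 0 in \<open>auto intro!: Bochner_Integration.integrable_sum \<phi>_integrable integrable_mult_right\<close>)
    also have "\<dots> = (\<Sum>i<card ?J. a i * (if i = k then 1 else 0))"
      using k by (subst coef_sum) (auto intro: \<phi>_integrable simp: coef_\<phi> e_inj)
    also have "\<dots> = a k" using k by (simp add: if_distrib sum.delta cong: if_cong)
    finally show "a k = 0" by simp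
  next
    fix f assume f: "in_eigenspace c t f"
    have "(\<Sum>j\<in>?J. coef f j * complex_of_real (\<phi> j x)) =
        (\<Sum>i<card ?J. coef f (e i) * complex_of_real (\<phi> (e i) x))" for x
      by (rule sum.reindex_bij_betw[OF e, symmetric])
    then show "\<exists>a. AE x in M. f x = (\<Sum>i<card ?J. a i * complex_of_real (\<phi> (e i) x))"
      using eigenspace_span[OF f t] by (intro exI[of _ "\<lambda>i. coef f (e i)"]) simp
  qed
qed

lemma eigenvalue_list_\<mu>: "eigenvalue_list c \<mu>"
  unfolding eigenvalue_list_def using \<mu>_decseq \<mu>_pos finite_level eigenspace_dim_\<mu> by blast

lemma eigval_eq_\<mu>: "eigval c = \<mu>"
proof -
  have "eigenvalue_list c (eigval c)" unfolding eigval_def by (rule someI[of "eigenvalue_list c", OF eigenvalue_list_\<mu>])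
  then show ?thesis using eigenvalue_list_unique eigenvalue_list_\<mu> \<mu>_tendsto_0 by blast
qed

end

theorem sinc_spectrum_eigval:
  assumes "0 < c"
  shows "\<exists>\<phi>. sinc_spectrum c (eigval c) \<phi>"
proof -
  obtain \<mu> \<phi> where "spectral_expansion c sinc_kernel \<mu> \<phi>"
    using sinc_spectral_expansion[OF assms] by blast
  then have "sinc_spectrum c \<mu> \<phi>" using assms by unfold_locales
  with sinc_spectrum.eigval_eq_\<mu>[OF this] show ?thesis by auto
qed

section \<open>The Fredholm determinant\<close>

definition injective_tuples :: "nat \<Rightarrow> nat \<Rightarrow> (nat \<Rightarrow> nat) set" where
  "injective_tuples n N = {k \<in> {..<n} \<rightarrow>\<^sub>E {..<N}. inj_on k {..<n}}"

lemma finite_injective_tuples: "finite (injective_tuples n N)"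
  unfolding injective_tuples_def by (rule finite_subset[OF _ finite_PiE[of "{..<n}" "\<lambda>_. {..<N}"]]) auto

text \<open>Every n-subset is the range of exactly \<open>fact n\<close> injective tuples, and the
  product depends only on the range. The inner sum on the right is an elementary symmetric
  polynomial.\<close>

lemma sum_injective_tuples:
  fixes \<mu> :: "nat \<Rightarrow> real"
  shows "(\<Sum>k\<in>injective_tuples n N. \<Prod>i<n. \<mu> (k i)) =
    fact n * (\<Sum>S | S \<subseteq> {..<N} \<and> card S = n. \<Prod>j\<in>S. \<mu> j)"
proof -
  let ?T = "{S. S \<subseteq> {..<N} \<and> card S = n}"
  have img: "(\<lambda>k. k ` {..<n}) ` injective_tuples n N \<subseteq> ?T"
  proof (rule image_subsetI)
    fix k assume "k \<in> injective_tuples n N"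
    then have k: "k \<in> {..<n} \<rightarrow>\<^sub>E {..<N}" "inj_on k {..<n}" by (simp_all add: injective_tuples_def)
    have "k ` {..<n} \<subseteq> {..<N}" by (rule image_subsetI) (rule PiE_mem[OF k(1)])
    then show "k ` {..<n} \<in> ?T" using card_image[OF k(2)] by simp
  qed
  have fT: "finite ?T" by (rule finite_subset[of _ "Pow {..<N}"]) auto
  have "(\<Sum>k\<in>injective_tuples n N. \<Prod>i<n. \<mu> (k i)) =
      (\<Sum>S\<in>?T. \<Sum>k | k \<in> injective_tuples n N \<and> k ` {..<n} = S. \<Prod>i<n. \<mu> (k i))"
    by (rule sum.group[OF finite_injective_tuples fT img, symmetric])
  also have "\<dots> = (\<Sum>S\<in>?T. fact n * (\<Prod>j\<in>S. \<mu> j))"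
  proof (rule sum.cong[OF refl])
    fix S assume S: "S \<in> ?T"
    then have fS: "finite S" using finite_subset by blast
    have "{k. k \<in> injective_tuples n N \<and> k ` {..<n} = S} = {k \<in> {..<n} \<rightarrow>\<^sub>E S. inj_on k {..<n}}"
    proof safe
      fix k assume "k \<in> {..<n} \<rightarrow>\<^sub>E S" "inj_on k {..<n}"
      moreover from this have "k ` {..<n} = S"
        using S fS by (intro card_subset_eq) (auto simp: card_image)
      ultimately show "k \<in> injective_tuples n N" "\<And>x. x \<in> S \<Longrightarrow> x \<in> k ` {..<n}"
        using S by (auto simp: injective_tuples_def PiE_iff)
    qed (auto simp: injective_tuples_def PiE_iff extensional_def)
    then have "card {k. k \<in> injective_tuples n N \<and> k ` {..<n} = S} = fact n"
      using card_inj_on_subset_funcset[OF finite_lessThan fS subset_refl, of n] S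
      by (simp add: fact_prod_rev)
    moreover have "(\<Prod>i<n. \<mu> (k i)) = (\<Prod>j\<in>S. \<mu> j)"
      if "k \<in> injective_tuples n N" "k ` {..<n} = S" for k
      using prod.reindex[of k "{..<n}" \<mu>] that by (simp add: injective_tuples_def)
    ultimately show "(\<Sum>k | k \<in> injective_tuples n N \<and> k ` {..<n} = S. \<Prod>i<n. \<mu> (k i)) =
        fact n * (\<Prod>j\<in>S. \<mu> j)" by simp
  qed
  finally show ?thesis by (simp add: sum_distrib_left)
qed

text \<open>Expand over subsets and group them by cardinality. The terms with n > N vanish; writing
  the result as an infinite series gives it the shape of \<open>fredholm_det\<close>, so that the
  limit in N can be taken termwise.\<close>

lemma prod_one_plus_eq_sum_injective_tuples:
  fixes \<mu> :: "nat \<Rightarrow> real"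
  shows "(\<Prod>j<N. 1 + z * \<mu> j) =
    (\<Sum>n. z ^ n / fact n * (\<Sum>k\<in>injective_tuples n N. \<Prod>i<n. \<mu> (k i)))"
proof -
  have "(\<Prod>j<N. 1 + z * \<mu> j) = (\<Prod>j<N. z * \<mu> j + 1)" by (simp add: add.commute)
  also have "\<dots> = (\<Sum>X\<in>Pow {..<N}. (\<Prod>j\<in>X. z * \<mu> j))"
    by (subst prod_add) auto
  also have "\<dots> = (\<Sum>X\<in>Pow {..<N}. z ^ card X * (\<Prod>j\<in>X. \<mu> j))"
    by (simp add: prod.distrib)
  also have "\<dots> = (\<Sum>n\<le>N. \<Sum>X | X \<in> Pow {..<N} \<and> card X = n. z ^ card X * (\<Prod>j\<in>X. \<mu> j))"
    by (rule sum.group[symmetric]) (auto intro: subset_card_intvl_is_intvl dest: card_mono[rotated])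
  also have "\<dots> = (\<Sum>n\<le>N. z ^ n / fact n * (\<Sum>k\<in>injective_tuples n N. \<Prod>i<n. \<mu> (k i)))"
    by (intro sum.cong) (simp_all add: sum_injective_tuples sum_distrib_left)
  also have "\<dots> = (\<Sum>n. z ^ n / fact n * (\<Sum>k\<in>injective_tuples n N. \<Prod>i<n. \<mu> (k i)))"
  proof (rule suminf_finite[symmetric])
    fix n assume n: "n \<notin> {..N}"
    have "\<not> inj_on k {..<n}" if "k \<in> {..<n} \<rightarrow>\<^sub>E {..<N}" for k
    proof
      assume "inj_on k {..<n}"
      from card_inj[OF _ this, of "{..<N}"] that n show False by (auto simp: PiE_def)
    qed
    then have "injective_tuples n N = {}" by (auto simp: injective_tuples_def)
    then show "z ^ n / fact n * (\<Sum>k\<in>injective_tuples n N. \<Prod>i<n. \<mu> (k i)) = 0" by simp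
  qed simp
  finally show ?thesis .
qed

text \<open>This is the Leibniz expansion of a matrix that is the identity for injective
  \<open>k\<close> and has two equal rows otherwise.\<close>

lemma det_kronecker_tuple:
  fixes k :: "nat \<Rightarrow> nat"
  shows "(\<Sum>p | p permutes {0..<n}. signof p * (\<Prod>i<n. if k i = k (p i) then 1 else 0)) =
    (if inj_on k {..<n} then 1 else (0::real))"
proof -
  define A where "A = Matrix.mat n n (\<lambda>(i, j). if k i = k j then 1 else (0::real))"
  have A: "A \<in> carrier_mat n n" by (simp add: A_def)
  have "(\<Prod>i<n. if k i = k (p i) then 1 else (0::real)) = (\<Prod>i = 0..<n. A $$ (i, p i))"
    if p: "p permutes {0..<n}" for p
    unfolding atLeast0LessThan
  proof (rule prod.cong[OF refl])
    fix i assume "i \<in> {..<n}"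
    moreover from this have "p i < n" using permutes_in_image[OF p, of i] by simp
    ultimately show "(if k i = k (p i) then 1 else 0) = A $$ (i, p i)" by (simp add: A_def)
  qed
  then have "(\<Sum>p | p permutes {0..<n}. signof p * (\<Prod>i<n. if k i = k (p i) then 1 else (0::real))) =
      Determinant.det A" by (simp add: det_def'[OF A])
  also have "\<dots> = (if inj_on k {..<n} then 1 else 0)"
  proof (cases "inj_on k {..<n}")
    case True
    then have "A = 1\<^sub>m n" by (intro eq_matI) (auto simp: A_def inj_on_def)
    then show ?thesis using True by simp
  next
    case False
    then obtain i j where ij: "i < n" "j < n" "i \<noteq> j" "k i = k j" by (auto simp: inj_on_def)
    then have "row A i = row A j" by (intro eq_vecI) (simp_all add: A_def)
    then show ?thesis using det_identical_rows[OF A ij(3,1,2)] False by simp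
  qed
  finally show ?thesis .
qed

section \<open>Determinants of the truncated kernels and their limit\<close>

context sinc_spectrum
begin

interpretation M: finite_measure M by (rule finite_measure_interval_measure)

interpretation P: product_sigma_finite "\<lambda>_::nat. M"
  by (simp add: product_sigma_finite_def M.sigma_finite_measure_axioms)

abbreviation P where "P n \<equiv> Pi\<^sub>M {..<n} (\<lambda>_::nat. M)"

lemma space_P: "x \<in> space (P n) \<Longrightarrow> i < n \<Longrightarrow> x i \<in> {0..c}"
  using PiE_mem[of x "{..<n}" "\<lambda>_. {0<..<c}" i] by (auto simp: space_PiM space_interval_measure)

lemma finite_measure_P: "finite_measure (P n)"
proof -
  have "integrable (P n) (\<lambda>x. \<Prod>i<n. (1::real))"
    by (rule P.product_integrable_prod[of "{..<n}" "\<lambda>_ _. 1"]) auto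
  then have "integrable (P n) (\<lambda>x. 1::real)" by simp
  then show ?thesis
    by (intro finite_measureI) (simp add: integrable_iff_bounded top.not_eq_extremum)
qed

text \<open>Written out by Leibniz's formula, so that limits and integrals pass through finite sums
  and products.\<close>

definition trunc_det :: "nat \<Rightarrow> nat \<Rightarrow> (nat \<Rightarrow> real) \<Rightarrow> real" where
  "trunc_det n N x = (\<Sum>p | p permutes {0..<n}. signof p * (\<Prod>i<n. trunc N (x i) (x (p i))))"



lemma perm_lt: "p permutes {0..<n} \<Longrightarrow> i < n \<Longrightarrow> p i < n" for p :: "nat \<Rightarrow> nat"
  using permutes_in_image[of p "{0..<n}" i] by simp

lemma trunc_det_tendsto:
  assumes "x \<in> space (P n)"
  shows "(\<lambda>N. trunc_det n N x) \<longlonglongrightarrow>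
    Determinant.det (Matrix.mat n n (\<lambda>(i, j). sinc_kernel (x i) (x j)))"
proof -
  have "(\<lambda>N. trunc_det n N x) \<longlonglongrightarrow>
      (\<Sum>p | p permutes {0..<n}. signof p * (\<Prod>i<n. sinc_kernel (x i) (x (p i))))"
    unfolding trunc_det_def
    by (intro tendsto_intros trunc_tendsto space_P[OF assms]) (auto intro: perm_lt)
  moreover have "(\<Prod>i<n. sinc_kernel (x i) (x (p i))) =
      (\<Prod>i = 0..<n. Matrix.mat n n (\<lambda>(i, j). sinc_kernel (x i) (x j)) $$ (i, p i))"
    if "p permutes {0..<n}" for p
    unfolding atLeast0LessThan by (rule prod.cong) (auto simp: perm_lt[OF that])
  ultimately show ?thesis
    by (simp add: det_def'[of "Matrix.mat n n (\<lambda>(i, j). sinc_kernel (x i) (x j))" n])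
qed

text \<open>Each of the \<open>fact n\<close> permutations contributes at most 1. This serves as the
  dominating constant for fixed n; summability over n comes from
  \<open>fredholm_coeff_bound\<close>.\<close>

lemma trunc_det_bound:
  assumes "x \<in> space (P n)"
  shows "\<bar>trunc_det n N x\<bar> \<le> fact n"
proof -
  have "\<bar>trunc_det n N x\<bar> \<le> (\<Sum>p | p permutes {0..<n}. \<bar>signof p * (\<Prod>i<n. trunc N (x i) (x (p i)))\<bar>)"
    unfolding trunc_det_def by (rule sum_abs)
  also have "\<dots> \<le> (\<Sum>p | p permutes {0..<n}. 1)"
  proof (rule sum_mono)
    fix p assume "p \<in> {p. p permutes {0..<n}}"
    then have "\<bar>\<Prod>i<n. trunc N (x i) (x (p i))\<bar> \<le> (\<Prod>i<n. 1)"
      unfolding abs_prod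
      by (intro prod_mono conjI abs_ge_zero trunc_abs_le_1 space_P[OF assms]) (auto intro: perm_lt)
    then show "\<bar>signof p * (\<Prod>i<n. trunc N (x i) (x (p i)))\<bar> \<le> 1"
      by (simp add: abs_mult sign_def)
  qed
  also have "\<dots> = fact n" using card_permutations[of "{0..<n}" n] by simp
  finally show ?thesis .
qed

text \<open>Expanding the products of sums gives one term for each permutation and index tuple,
  whose integral factorizes over the coordinates. Orthonormality leaves Kronecker symbols, and
  summing over permutations retains exactly the injective tuples.\<close>

lemma trunc_det_integral:
  "integrable (P n) (trunc_det n N)"
  "(LINT x|P n. trunc_det n N x) = (\<Sum>k\<in>injective_tuples n N. \<Prod>i<n. \<mu> (k i))"
proof -
  let ?K = "{..<n} \<rightarrow>\<^sub>E {..<N}" and ?S = "{p. p permutes {0..<n}}"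
  \<comment> \<open>The factors at x (p i) are reindexed by the inverse permutation, so that the
    i-th factor depends on x i alone, as the product integral requires.\<close>
  define F where "F p k x = (\<Prod>i<n. \<mu> (k i) * (\<phi> (k i) (x i) * \<phi> (k (inv_into UNIV p i)) (x i)))"
    for p k :: "nat \<Rightarrow> nat" and x
  have expand: "trunc_det n N x = (\<Sum>p\<in>?S. signof p * (\<Sum>k\<in>?K. F p k x))" for x
    unfolding trunc_det_def
  proof (rule sum.cong[OF refl], rule arg_cong2[of _ _ _ _ times, OF refl])
    fix p assume "p \<in> ?S"
    then have p: "p permutes {..<n}" by (simp add: atLeast0LessThan)
    have "(\<Prod>i<n. trunc N (x i) (x (p i))) = (\<Sum>k\<in>?K. \<Prod>i<n. \<mu> (k i) * \<phi> (k i) (x i) * \<phi> (k i) (x (p i)))"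
      unfolding trunc_def by (rule prod_sum_PiE) auto
    also have "\<dots> = (\<Sum>k\<in>?K. F p k x)"
    proof (rule sum.cong[OF refl])
      fix k
      have "(\<Prod>i<n. \<phi> (k i) (x (p i))) = (\<Prod>i<n. \<phi> (k (inv_into UNIV p i)) (x i))"
        using prod.permute[OF p, of "\<lambda>i. \<phi> (k (inv_into UNIV p i)) (x i)"] permutes_inverses(2)[OF p]
        by (simp add: comp_def)
      then show "(\<Prod>i<n. \<mu> (k i) * \<phi> (k i) (x i) * \<phi> (k i) (x (p i))) = F p k x"
        by (simp add: F_def prod.distrib)
    qed
    finally show "(\<Prod>i<n. trunc N (x i) (x (p i))) = (\<Sum>k\<in>?K. F p k x)" .
  qed
  have int: "integrable M (\<lambda>y. \<mu> a * (\<phi> a y * \<phi> b y))" for a b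
    by (intro integrable_interval_measure continuous_intros \<phi>_cont)
  have F_int: "integrable (P n) (F p k)" for p k
    unfolding F_def
    by (rule P.product_integrable_prod[of _ "\<lambda>i y. \<mu> (k i) * (\<phi> (k i) y * \<phi> (k (inv_into UNIV p i)) y)"])
       (rule finite_lessThan int)+
  show "integrable (P n) (trunc_det n N)"
    unfolding expand[abs_def]
    by (intro Bochner_Integration.integrable_sum integrable_mult_right F_int)
  have F_val: "(LINT x|P n. F p k x) = (\<Prod>i<n. \<mu> (k i)) * (\<Prod>i<n. if k i = k (p i) then 1 else 0)"
    if "p \<in> ?S" for p k
  proof -
    have p: "p permutes {..<n}" using that by (simp add: atLeast0LessThan)
    have "(LINT x|P n. F p k x) = (\<Prod>i<n. LINT y|M. \<mu> (k i) * (\<phi> (k i) y * \<phi> (k (inv_into UNIV p i)) y))"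
      unfolding F_def by (rule P.product_integral_prod) (rule finite_lessThan int)+
    also have "\<dots> = (\<Prod>i<n. \<mu> (k i)) * (\<Prod>i<n. if k i = k (inv_into UNIV p i) then 1 else 0)"
      by (simp add: \<phi>_orthonormal_LINT prod.distrib)
    also have "(\<Prod>i<n. if k i = k (inv_into UNIV p i) then 1 else (0::real)) = (\<Prod>i<n. if k i = k (p i) then 1 else 0)"
      using prod.permute[OF p, of "\<lambda>i. if k i = k (inv_into UNIV p i) then 1 else (0::real)"] permutes_inverses(2)[OF p]
      by (simp add: comp_def eq_commute)
    finally show ?thesis .
  qed
  have "(LINT x|P n. trunc_det n N x) = (\<Sum>p\<in>?S. signof p * (\<Sum>k\<in>?K. (LINT x|P n. F p k x)))"
    unfolding expand
    by (simp add: Bochner_Integration.integral_sum Bochner_Integration.integrable_sum integrable_mult_right F_int)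
  also have "\<dots> = (\<Sum>p\<in>?S. \<Sum>k\<in>?K. (\<Prod>i<n. \<mu> (k i)) * (signof p * (\<Prod>i<n. if k i = k (p i) then 1 else 0)))"
    by (intro sum.cong[OF refl]) (simp add: F_val sum_distrib_left mult_ac)
  also have "\<dots> = (\<Sum>k\<in>?K. \<Sum>p\<in>?S. (\<Prod>i<n. \<mu> (k i)) * (signof p * (\<Prod>i<n. if k i = k (p i) then 1 else 0)))"
    by (rule sum.swap)
  also have "\<dots> = (\<Sum>k\<in>?K. (\<Prod>i<n. \<mu> (k i)) * (if inj_on k {..<n} then 1 else 0))"
    unfolding sum_distrib_left[symmetric] det_kronecker_tuple ..
  also have "\<dots> = (\<Sum>k\<in>injective_tuples n N. \<Prod>i<n. \<mu> (k i))"
    unfolding injective_tuples_def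
    by (rule sum.mono_neutral_cong_right) (auto intro: finite_PiE)
  finally show "(LINT x|P n. trunc_det n N x) = (\<Sum>k\<in>injective_tuples n N. \<Prod>i<n. \<mu> (k i))" .
qed

lemma fredholm_coeff_tendsto:
  "(\<lambda>N. \<Sum>k\<in>injective_tuples n N. \<Prod>i<n. \<mu> (k i)) \<longlonglongrightarrow>
     (LINT x|P n. Determinant.det (Matrix.mat n n (\<lambda>(i, j). sinc_kernel (x i) (x j))))"
proof -
  interpret Pn: finite_measure "P n" by (rule finite_measure_P)
  have "(\<lambda>N. LINT x|P n. trunc_det n N x) \<longlonglongrightarrow>
      (LINT x|P n. Determinant.det (Matrix.mat n n (\<lambda>(i, j). sinc_kernel (x i) (x j))))"
  proof (rule integral_dominated_convergence[where w = "\<lambda>_. fact n"])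
    show meas: "trunc_det n N \<in> borel_measurable (P n)" for N
      using trunc_det_integral(1) by (rule borel_measurable_integrable)
    show "(\<lambda>x. Determinant.det (Matrix.mat n n (\<lambda>(i, j). sinc_kernel (x i) (x j)))) \<in> borel_measurable (P n)"
      by (rule borel_measurable_LIMSEQ_metric[OF meas]) (rule trunc_det_tendsto)
  qed (auto intro!: AE_I2 trunc_det_tendsto trunc_det_bound)
  then show ?thesis by (simp add: trunc_det_integral(2))
qed

text \<open>Dropping injectivity turns the sum into the n-th power of a partial trace.\<close>

lemma fredholm_coeff_bound:
  "0 \<le> (\<Sum>k\<in>injective_tuples n N. \<Prod>i<n. \<mu> (k i))"
  "(\<Sum>k\<in>injective_tuples n N. \<Prod>i<n. \<mu> (k i)) \<le> c ^ n"
proof -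
  have nn: "0 \<le> (\<Prod>i<n. \<mu> (k i))" for k by (intro prod_nonneg) (simp add: less_imp_le \<mu>_pos)
  then show "0 \<le> (\<Sum>k\<in>injective_tuples n N. \<Prod>i<n. \<mu> (k i))" by (intro sum_nonneg)
  have "(\<Sum>k\<in>injective_tuples n N. \<Prod>i<n. \<mu> (k i)) \<le> (\<Sum>k\<in>{..<n} \<rightarrow>\<^sub>E {..<N}. \<Prod>i<n. \<mu> (k i))"
    by (rule sum_mono2) (auto simp: injective_tuples_def nn intro: finite_PiE)
  also have "\<dots> = (\<Prod>i<n. \<Sum>j<N. \<mu> j)" by (rule prod_sum_PiE[symmetric]) auto
  also have "\<dots> \<le> c ^ n"
  proof -
    have "(\<Sum>j<N. \<mu> j) \<le> c"
      using sum_le_suminf[of \<mu> "{..<N}"] trace \<mu>_pos by (simp add: sums_iff less_imp_le)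
    then show ?thesis using \<mu>_pos by (simp add: power_mono sum_nonneg less_imp_le)
  qed
  finally show "(\<Sum>k\<in>injective_tuples n N. \<Prod>i<n. \<mu> (k i)) \<le> c ^ n" .
qed

text \<open>Tannery's theorem, with the terms of the series of exp (z * c) as majorant.\<close>

theorem fredholm_det_tendsto:
  assumes z: "0 \<le> z"
  shows "(\<lambda>N. \<Prod>j<N. 1 + z * \<mu> j) \<longlonglongrightarrow> fredholm_det c sinc_kernel z"
proof -
  have "(\<lambda>N. \<Sum>n. z ^ n / fact n * (\<Sum>k\<in>injective_tuples n N. \<Prod>i<n. \<mu> (k i))) \<longlonglongrightarrow>
      (\<Sum>n. z ^ n / fact n * (LINT x|P n. Determinant.det (Matrix.mat n n (\<lambda>(i, j). sinc_kernel (x i) (x j)))))"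
  proof (rule tannerys_theorem[THEN conjunct2, THEN conjunct2])
    show "summable (\<lambda>n. (z * c) ^ n / fact n)"
      using summable_exp[of "z * c"] by (simp add: divide_inverse mult.commute)
    show "\<forall>\<^sub>F (n, N) in sequentially \<times>\<^sub>F sequentially.
        norm (z ^ n / fact n * (\<Sum>k\<in>injective_tuples n N. \<Prod>i<n. \<mu> (k i))) \<le> (z * c) ^ n / fact n"
    proof (intro always_eventually allI, clarify)
      fix n N
      have "z ^ n / fact n * (\<Sum>k\<in>injective_tuples n N. \<Prod>i<n. \<mu> (k i)) \<le> z ^ n / fact n * c ^ n"
        using z by (intro mult_left_mono fredholm_coeff_bound) simp
      then show "norm (z ^ n / fact n * (\<Sum>k\<in>injective_tuples n N. \<Prod>i<n. \<mu> (k i))) \<le> (z * c) ^ n / fact n"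
        using z fredholm_coeff_bound(1)[of n N] by (simp add: abs_mult power_mult_distrib)
    qed
  qed (auto intro!: tendsto_intros fredholm_coeff_tendsto)
  then show ?thesis by (simp add: prod_one_plus_eq_sum_injective_tuples fredholm_det_def)
qed

corollary ln_fredholm_det_sums:
  assumes z: "0 \<le> z"
  shows "(\<lambda>j. ln (1 + z * \<mu> j)) sums ln (fredholm_det c sinc_kernel z)"
proof -
  have ge1: "1 \<le> 1 + z * \<mu> j" for j using z \<mu>_pos[of j] by simp
  \<comment> \<open>The partial products are at least 1, so their limit stays away from the
    singularity of ln.\<close>
  have "1 \<le> fredholm_det c sinc_kernel z"
    by (rule LIMSEQ_le_const[OF fredholm_det_tendsto[OF z]]) (intro exI allI impI prod_ge_1 ge1)
  then have "(\<lambda>N. ln (\<Prod>j<N. 1 + z * \<mu> j)) \<longlonglongrightarrow> ln (fredholm_det c sinc_kernel z)"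
    by (intro tendsto_ln fredholm_det_tendsto z) simp
  moreover have "ln (\<Prod>j<N. 1 + z * \<mu> j) = (\<Sum>j<N. ln (1 + z * \<mu> j))" for N
    by (rule ln_prod) (use ge1 in \<open>auto simp: add_nonneg_eq_0_iff\<close>)
  ultimately show ?thesis by (simp add: sums_def)
qed

end

section \<open>Counting eigenvalues\<close>

text \<open>It vanishes at x = 0 and at x = 1; the estimates below quantify how little an eigenvalue
  near either end contributes.\<close>

definition excess :: "real \<Rightarrow> real \<Rightarrow> real" where
  "excess u x = ln (1 + (exp u - 1) * x) - u * x"

text \<open>By convexity exp (u * x) lies below its chord between x = 0 and x = 1.\<close>

lemma excess_nonneg:
  assumes "0 \<le> x" "x \<le> 1"
  shows "0 \<le> excess u x"
proof -
  have "exp ((1 - x) *\<^sub>R 0 + x *\<^sub>R u) \<le> (1 - x) * exp 0 + x * exp u"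
    by (rule convex_onD[OF exp_convex]) (use assms in auto)
  then have "exp (u * x) \<le> 1 + (exp u - 1) * x" by (simp add: algebra_simps)
  then have "ln (exp (u * x)) \<le> ln (1 + (exp u - 1) * x)" by (intro ln_mono) auto
  then show ?thesis by (simp add: excess_def)
qed

text \<open>The logarithm is at least u + ln x, which exceeds 3 * u / 4, while at most u / 2 is
  subtracted.\<close>

lemma excess_ge_quarter:
  assumes "exp (- (u / 4)) < x" "x \<le> 1/2" "0 \<le> u"
  shows "u / 4 \<le> excess u x"
proof -
  have x: "0 < x" using assms(1) exp_gt_zero less_trans by blast
  have "- (u / 4) < ln x" using assms(1) x by (simp add: ln_less_cancel_iff[symmetric] del: ln_less_cancel_iff)
  moreover have "u + ln x = ln (exp u * x)" using x by (simp add: ln_mult)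
  moreover have "ln (exp u * x) \<le> ln (1 + (exp u - 1) * x)"
    using x assms(2) by (intro ln_mono) (auto simp: algebra_simps)
  moreover have "u * x \<le> u * (1/2)" using assms by (intro mult_left_mono) auto
  ultimately show ?thesis unfolding excess_def by linarith
qed

lemma excess_le_complement:
  assumes "0 < x" "x \<le> 1" "0 \<le> u"
  shows "excess u x \<le> u * (1 - x)"
proof -
  have "(exp u - 1) * x \<le> (exp u - 1) * 1" using assms by (intro mult_left_mono) auto
  moreover have "0 \<le> (exp u - 1) * x" using assms by simp
  ultimately have "ln (1 + (exp u - 1) * x) \<le> ln (exp u)" by (intro ln_mono) auto
  then show ?thesis by (simp add: excess_def algebra_simps)
qed

lemma excess_le_exp:
  assumes "0 < x" "0 \<le> u"
  shows "excess u x \<le> exp u * x"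
proof -
  have "ln (1 + (exp u - 1) * x) \<le> (exp u - 1) * x"
    using assms by (intro ln_add_one_self_le_self) simp
  moreover have "0 \<le> u * x" using assms by simp
  ultimately show ?thesis using assms(1) by (simp add: excess_def algebra_simps)
qed

text \<open>If t lies between exp (- k) and exp (1 - k) for some layer p < k \<le> m, the k-th term
  alone covers it; below the last layer the term exp (- m) does.\<close>

lemma exp_layer_bound:
  fixes t :: real
  assumes "t \<le> exp (- real p)" "p \<le> m"
  shows "t \<le> exp (- real m) + (\<Sum>k\<in>{p<..m}. exp (1 - real k) * of_bool (exp (- real k) < t))"
  using assms(2)
proof (induction m rule: dec_induct)
  case (step m)
  have S: "{p<..Suc m} = insert (Suc m) {p<..m}" using step.hyps by auto
  show ?case
  proof (cases "exp (- real (Suc m)) < t")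
    case True
    have e: "exp (1 - real (Suc m)) = exp (- real m)" by simp
    show ?thesis
      using step.IH True unfolding S by (subst sum.insert) (auto simp del: of_nat_Suc simp: e add_increasing)
  next
    case False
    have "0 \<le> (\<Sum>k\<in>{p<..Suc m}. exp (1 - real k) * of_bool (exp (- real k) < t))"
      by (intro sum_nonneg) auto
    then show ?thesis using False by linarith
  qed
qed (use assms in simp)

text \<open>Converts bounds on counts into a bound on a sum. The layers stop at a level m of free
  choice, beyond which counts may be unknown; whatever lies deeper costs at most exp (- m) per
  element.\<close>

lemma sum_exp_layer_bound:
  fixes t :: "'a \<Rightarrow> real"
  assumes F: "finite F" and t: "\<And>n. n \<in> F \<Longrightarrow> t n \<le> exp (- real p)" and pm: "p \<le> m"
    and N: "\<And>k. p < k \<Longrightarrow> k \<le> m \<Longrightarrow> real (card {n \<in> F. exp (- real k) < t n}) \<le> N k"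
  shows "(\<Sum>n\<in>F. t n) \<le> real (card F) * exp (- real m) + (\<Sum>k\<in>{p<..m}. exp (1 - real k) * N k)"
proof -
  have "(\<Sum>n\<in>F. t n) \<le>
      (\<Sum>n\<in>F. exp (- real m) + (\<Sum>k\<in>{p<..m}. exp (1 - real k) * of_bool (exp (- real k) < t n)))"
    by (intro sum_mono exp_layer_bound t pm)
  also have "\<dots> = real (card F) * exp (- real m) +
      (\<Sum>k\<in>{p<..m}. \<Sum>n\<in>F. exp (1 - real k) * of_bool (exp (- real k) < t n))"
    by (subst sum.swap) (simp add: sum.distrib)
  also have "(\<Sum>k\<in>{p<..m}. \<Sum>n\<in>F. exp (1 - real k) * of_bool (exp (- real k) < t n)) =
      (\<Sum>k\<in>{p<..m}. exp (1 - real k) * real (card {n \<in> F. exp (- real k) < t n}))"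
    unfolding sum_distrib_left[symmetric] by (simp add: of_bool_def sum.If_cases[OF F] Int_def)
  also have "\<dots> \<le> (\<Sum>k\<in>{p<..m}. exp (1 - real k) * N k)"
    by (intro sum_mono mult_left_mono N) auto
  finally show ?thesis by simp
qed

text \<open>Since k / 4 \<le> exp (k / 4), a geometric series with ratio exp (- 1 / 4) dominates.
  Only half of the decay exp (- k) is spent here; the other half supplies the factor exp (- u) in
  \<open>exp_less_layer_index\<close>.\<close>

lemma sum_mult_exp_half_bounded:
  obtains S where "0 < S" "\<And>K. finite K \<Longrightarrow> (\<Sum>k\<in>K. real k * exp (1 - real k / 2)) \<le> S"
proof -
  let ?g = "\<lambda>k. (4 * exp 1) * exp (- 1 / 4) ^ k :: real"
  have s: "summable ?g" by (intro summable_mult summable_geometric) simp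
  have le: "real k * exp (1 - real k / 2) \<le> ?g k" for k
  proof -
    have "real k / 4 \<le> exp (real k / 4)" using exp_ge_add_one_self[of "real k / 4"] by linarith
    then have "real k * exp (1 - real k / 2) \<le> (4 * exp (real k / 4)) * exp (1 - real k / 2)"
      by (intro mult_right_mono) auto
    also have "\<dots> = 4 * exp (1 - real k / 4)" by (simp add: exp_add[symmetric] field_simps)
    also have "\<dots> = ?g k" by (simp add: exp_of_nat_mult[symmetric] exp_add[symmetric] field_simps)
    finally show ?thesis .
  qed
  show thesis
  proof
    show "0 < suminf ?g + 1" using suminf_nonneg[OF s] by (simp add: add_nonneg_pos)
    fix K :: "nat set" assume K: "finite K"
    have "(\<Sum>k\<in>K. real k * exp (1 - real k / 2)) \<le> sum ?g K" by (intro sum_mono le)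
    also have "\<dots> \<le> suminf ?g" by (rule sum_le_suminf[OF s K]) simp
    finally show "(\<Sum>k\<in>K. real k * exp (1 - real k / 2)) \<le> suminf ?g + 1" by simp
  qed
qed

section \<open>Sums over eigenvalues in terms of their counts\<close>

lemma eigval_facts:
  assumes "0 < c"
  shows "0 < eigval c n" "eigval c sums c"
    and "0 \<le> u \<Longrightarrow> (\<lambda>n. excess u (eigval c n)) sums (ln (fredholm_det c sinc_kernel (exp u - 1)) - u * c)"
proof -
  obtain \<phi> where "sinc_spectrum c (eigval c) \<phi>" using sinc_spectrum_eigval[OF assms] by blast
  then interpret sinc_spectrum c "eigval c" \<phi> .
  show "0 < eigval c n" by (rule \<mu>_pos)
  show "eigval c sums c" by (rule trace)
  show "(\<lambda>n. excess u (eigval c n)) sums (ln (fredholm_det c sinc_kernel (exp u - 1)) - u * c)" if "0 \<le> u"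
    unfolding excess_def by (intro sums_diff ln_fredholm_det_sums sums_mult trace) (use that in simp)
qed

lemma finite_eigval_gt:
  assumes "0 < c" "0 < t"
  shows "finite {n. t < eigval c n}"
proof -
  have "eigval c \<longlonglongrightarrow> 0" by (rule summable_LIMSEQ_zero[OF sums_summable[OF eigval_facts(2)[OF assms(1)]]])
  then have "\<forall>\<^sub>F n in sequentially. eigval c n < t" using assms(2) by (rule order_tendstoD)
  then obtain N where N: "\<And>n. n \<ge> N \<Longrightarrow> eigval c n < t" unfolding eventually_sequentially by blast
  have "{n. t < eigval c n} \<subseteq> {..<N}"
  proof
    fix n assume "n \<in> {n. t < eigval c n}"
    then show "n \<in> {..<N}" using N[of n] by (cases "n < N") auto
  qed
  then show ?thesis by (rule finite_subset) simp
qed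

lemma card_eigval_gt_half:
  assumes "0 < c" "finite F" "\<And>n. n \<in> F \<Longrightarrow> 1/2 < eigval c n"
  shows "real (card F) \<le> 2 * c"
proof -
  have "real (card F) * (1/2) = (\<Sum>n\<in>F. 1/2)" by simp
  also have "\<dots> \<le> (\<Sum>n\<in>F. eigval c n)" by (intro sum_mono less_imp_le assms(3))
  also have "\<dots> \<le> suminf (eigval c)"
    by (rule sum_le_suminf)
       (use assms(2) eigval_facts[OF assms(1)] in \<open>auto intro: less_imp_le sums_summable\<close>)
  also have "\<dots> = c" using eigval_facts(2)[OF assms(1)] by (simp add: sums_iff)
  finally show ?thesis by simp
qed

text \<open>The last clause of \<open>KDL_constant\<close>, at its largest admissible \<epsilon>,
  even gives a gap below 1.\<close>

lemma KDL_eigval_le_1: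
  assumes "KDL_constant \<alpha>" "2 \<le> c"
  shows "eigval c n \<le> 1"
proof -
  have \<alpha>: "4 \<le> \<alpha>" using assms(1) by (simp add: KDL_constant_def)
  obtain a A where "\<forall>c\<ge>2. \<forall>\<epsilon>. 0 < \<epsilon> \<and> \<epsilon> \<le> \<alpha> powr (- c) \<longrightarrow> (\<forall>n. eigval c n \<le> 1 - \<epsilon>) \<and>
        a * (ln (1/\<epsilon>) / ln (ln (1/\<epsilon>) / c)) \<le> real (Lambda_minus \<epsilon> c) \<and>
        real (Lambda_minus \<epsilon> c) \<le> A * (ln (1/\<epsilon>) / ln (ln (1/\<epsilon>) / c))"
    using assms(1) unfolding KDL_constant_def by blast
  then have "eigval c n \<le> 1 - \<alpha> powr (- c)" using assms(2) \<alpha> by force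
  then show ?thesis using powr_ge_zero[of \<alpha> "- c"] by linarith
qed

lemma exp_minus_1_less_half: "exp (- 1) < (1/2 :: real)"
  using exp_ge_add_one_self[of 1] exp_gt_one[of "1::real"] e_less_272 exp_lower_Taylor_quadratic[of "1::real"]
  by (simp add: exp_minus field_simps)

lemma ln_4_gt_1: "1 < ln (4::real)"
proof -
  have "exp 1 < (4::real)" using e_less_272 by simp
  then have "ln (exp 1) < ln (4::real)" by (subst ln_less_cancel_iff) auto
  then show ?thesis by simp
qed

lemma ln_KDL_gt_1: "4 \<le> \<alpha> \<Longrightarrow> 1 < ln (\<alpha>::real)"
  using ln_4_gt_1 ln_mono[of 4 \<alpha>] by linarith

lemma powr_neg_less_exp_neg_iff:
  assumes "0 < \<alpha>"
  shows "\<alpha> powr (- c) < exp (- L) \<longleftrightarrow> L < c * ln (\<alpha>::real)"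
  using assms by (simp add: powr_def)

text \<open>Merges the two regimes of the known upper bounds into one that is linear in k. Above the
  threshold, dividing by k \<ge> 1 inside the logarithm is dropped; below it, k / c \<ge> ln
  \<alpha> \<ge> ln 4 bounds the denominator. For counts near 1 the range k \<le> c lies above the
  threshold because ln \<alpha> > 1.\<close>

lemma KDL_Lambda_linear:
  assumes KDL: "KDL_constant \<alpha>"
  obtains A where "0 < A"
    "\<And>c k. 2 \<le> c \<Longrightarrow> 1 \<le> k \<Longrightarrow> real k \<le> c \<Longrightarrow>
      real (Lambda_plus (exp (- real k)) c) \<le> A * real k * ln (\<alpha> * c)"
    "\<And>c k. 2 \<le> c \<Longrightarrow> 1 \<le> k \<Longrightarrow>
      real (Lambda_minus (exp (- real k)) c) \<le> A * real k * ln (\<alpha> * c)"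
proof -
  have \<alpha>: "4 \<le> \<alpha>" using KDL by (simp add: KDL_constant_def)
  note ln\<alpha> = ln_KDL_gt_1[OF \<alpha>]
  obtain A1 where A1: "0 < A1" and "\<forall>c\<ge>2. \<forall>\<epsilon>. \<alpha> powr (- c) < \<epsilon> \<and> \<epsilon> < 1/2 \<longrightarrow>
      real (Lambda_plus \<epsilon> c) \<le> A1 * (ln (1/\<epsilon>) * ln (\<alpha> * c / ln (1/\<epsilon>))) \<and>
      real (Lambda_minus \<epsilon> c) \<le> A1 * (ln (1/\<epsilon>) * ln (\<alpha> * c / ln (1/\<epsilon>)))"
    using KDL unfolding KDL_constant_def by blast
  then have a: "real (Lambda_plus \<epsilon> c) \<le> A1 * (ln (1/\<epsilon>) * ln (\<alpha> * c / ln (1/\<epsilon>))) \<and>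
      real (Lambda_minus \<epsilon> c) \<le> A1 * (ln (1/\<epsilon>) * ln (\<alpha> * c / ln (1/\<epsilon>)))"
    if "2 \<le> c" "\<alpha> powr (- c) < \<epsilon>" "\<epsilon> < 1/2" for c \<epsilon>
    using that by blast
  obtain A2 a2 where A2: "0 < A2" and "\<forall>c\<ge>2. \<forall>\<epsilon>. 0 < \<epsilon> \<and> \<epsilon> \<le> \<alpha> powr (- c) \<longrightarrow>
      (\<forall>n. eigval c n \<le> 1 - \<epsilon>) \<and>
      a2 * (ln (1/\<epsilon>) / ln (ln (1/\<epsilon>) / c)) \<le> real (Lambda_minus \<epsilon> c) \<and>
      real (Lambda_minus \<epsilon> c) \<le> A2 * (ln (1/\<epsilon>) / ln (ln (1/\<epsilon>) / c))"
    using KDL unfolding KDL_constant_def by blast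
  then have b: "real (Lambda_minus \<epsilon> c) \<le> A2 * (ln (1/\<epsilon>) / ln (ln (1/\<epsilon>) / c))"
    if "2 \<le> c" "0 < \<epsilon>" "\<epsilon> \<le> \<alpha> powr (- c)" for c \<epsilon>
    using that by simp
  have ln1: "ln (1 / exp (- real k)) = real k" for k by (simp add: exp_minus inverse_eq_divide[symmetric])
  have half: "exp (- real k) < 1/2" if "1 \<le> k" for k
  proof -
    have "exp (- real k) \<le> exp (- 1)" using that by simp
    then show ?thesis using exp_minus_1_less_half by linarith
  qed
  have bound: "A1 * (real k * ln (\<alpha> * c / real k)) \<le> A1 * real k * ln (\<alpha> * c)" if "2 \<le> c" "1 \<le> k" for c and k :: nat
  proof -
    have "\<alpha> * c / real k \<le> \<alpha> * c" using that \<alpha> by (simp add: field_simps mult_left_mono)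
    then have "ln (\<alpha> * c / real k) \<le> ln (\<alpha> * c)" using that \<alpha> by (intro ln_mono) auto
    then show ?thesis using A1 by (simp add: mult.assoc mult_left_mono)
  qed
  have lnR: "1 \<le> ln (\<alpha> * c)" if "2 \<le> c" for c
  proof -
    have "\<alpha> \<le> \<alpha> * c" using that \<alpha> by simp
    then have "ln \<alpha> \<le> ln (\<alpha> * c)" using \<alpha> by (intro ln_mono) auto
    then show ?thesis using ln\<alpha> by linarith
  qed
  \<comment> \<open>The divisor ln (ln 4) is positive because 4 exceeds e.\<close>
  define A where "A = max A1 (A2 / ln (ln 4))"
  have lnln: "0 < ln (ln (4::real))" using ln_4_gt_1 by simp
  have minus: "real (Lambda_minus (exp (- real k)) c) \<le> A * real k * ln (\<alpha> * c)" if c: "2 \<le> c" and k: "1 \<le> k" for c k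
  proof (cases "real k < c * ln \<alpha>")
    case True
    then have "\<alpha> powr (- c) < exp (- real k)" using \<alpha> by (simp add: powr_neg_less_exp_neg_iff)
    then have "real (Lambda_minus (exp (- real k)) c) \<le> A1 * real k * ln (\<alpha> * c)"
      using a[OF c _ half[OF k]] bound[OF c k] unfolding ln1 by force
    also have "\<dots> \<le> A * real k * ln (\<alpha> * c)"
      using lnR[OF c] by (intro mult_right_mono) (auto simp: A_def)
    finally show ?thesis .
  next
    case False
    then have "exp (- real k) \<le> \<alpha> powr (- c)" using \<alpha> by (simp add: powr_neg_less_exp_neg_iff not_less[symmetric])
    from b[OF c exp_gt_zero this]
    have "real (Lambda_minus (exp (- real k)) c) \<le> A2 * (real k / ln (real k / c))"
      unfolding ln1 .
    also have "\<dots> \<le> A2 * (real k / ln (ln 4))"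
    proof -
      have "ln 4 \<le> ln \<alpha>" using \<alpha> by (intro ln_mono) auto
      also have "\<dots> \<le> real k / c" using False c by (simp add: field_simps)
      finally have le: "ln (ln 4) \<le> ln (real k / c)" using ln_4_gt_1 by (intro ln_mono) auto
      then have "0 < ln (real k / c)" using lnln by linarith
      with le show ?thesis using A2 lnln
        by (intro mult_left_mono divide_left_mono mult_pos_pos) (assumption | simp)+
    qed
    also have "\<dots> = (A2 / ln (ln 4)) * real k * 1" by simp
    also have "\<dots> \<le> A * real k * ln (\<alpha> * c)"
      using lnR[OF c] A1 by (intro mult_mono) (auto simp: A_def)
    finally show ?thesis .
  qed
  have plus: "real (Lambda_plus (exp (- real k)) c) \<le> A * real k * ln (\<alpha> * c)"
    if c: "2 \<le> c" and k: "1 \<le> k" and kc: "real k \<le> c" for c k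
  proof -
    have "c * 1 < c * ln \<alpha>" using c ln\<alpha> by (intro mult_strict_left_mono) auto
    then have "\<alpha> powr (- c) < exp (- real k)" using \<alpha> kc by (simp add: powr_neg_less_exp_neg_iff)
    then have "real (Lambda_plus (exp (- real k)) c) \<le> A1 * real k * ln (\<alpha> * c)"
      using a[OF c _ half[OF k]] bound[OF c k] unfolding ln1 by force
    also have "\<dots> \<le> A * real k * ln (\<alpha> * c)"
      using lnR[OF c] by (intro mult_right_mono) (auto simp: A_def)
    finally show ?thesis .
  qed
  show thesis by (rule that[of A]) (use A1 plus minus in \<open>auto simp: A_def\<close>)
qed

lemma exp_less_layer_index:
  fixes u :: real
  assumes "2 * u < real k"
  shows "exp (1 - real k) \<le> exp (- u) * exp (1 - real k / 2)"
  using assms by (simp add: exp_add[symmetric])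

text \<open>Eigenvalues near 1 contribute only \<open>O(u ln c)\<close>, so the excess of order \<open>u\<^sup>2 ln c\<close> has to come
  from the eigenvalues between \<open>exp (- 2 * u)\<close> and \<open>1/2\<close>, each of which contributes at most \<open>u\<close>.\<close>

lemma excess_upper_bound:
  assumes KDL: "KDL_constant \<alpha>"
  obtains B where "0 < B" "\<And>c u. \<alpha> \<le> c \<Longrightarrow> 1 \<le> u \<Longrightarrow>
    ln (fredholm_det c sinc_kernel (exp u - 1)) - u * c \<le>
      u * real (Lambda_minus (exp (- 2 * u)) c) + B * u * ln c"
proof -
  have \<alpha>: "4 \<le> \<alpha>" using KDL by (simp add: KDL_constant_def)
  obtain A where A: "0 < A"
    and plus: "\<And>c k. 2 \<le> c \<Longrightarrow> 1 \<le> k \<Longrightarrow> real k \<le> c \<Longrightarrow>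
      real (Lambda_plus (exp (- real k)) c) \<le> A * real k * ln (\<alpha> * c)"
    and minus: "\<And>c k. 2 \<le> c \<Longrightarrow> 1 \<le> k \<Longrightarrow>
      real (Lambda_minus (exp (- real k)) c) \<le> A * real k * ln (\<alpha> * c)"
    using KDL_Lambda_linear[OF KDL] by blast
  obtain S where S: "0 < S" "\<And>K. finite K \<Longrightarrow> (\<Sum>k\<in>K. real k * exp (1 - real k / 2)) \<le> S"
    using sum_mult_exp_half_bounded by blast
  \<comment> \<open>Collects 2 * A * S * R + 3, using R \<le> 2 * ln c and ln c \<ge> 1.\<close>
  define B where "B = 4 * A * S + 3"
  have main: "ln (fredholm_det c sinc_kernel (exp u - 1)) - u * c \<le>
      u * real (Lambda_minus (exp (- 2 * u)) c) + B * u * ln c"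
    if c: "\<alpha> \<le> c" and u: "1 \<le> u" for c u
  proof -
    have c2: "2 \<le> c" and c0: "0 < c" using c \<alpha> by auto
    define R where "R = ln (\<alpha> * c)"
    have lnc: "1 \<le> ln c" using ln_KDL_gt_1[of c] c \<alpha> by simp
    have R: "0 \<le> R" "R \<le> 2 * ln c"
    proof -
      have "\<alpha> * c \<le> c * c" using c c0 by (intro mult_right_mono) auto
      then have "R \<le> ln (c * c)" unfolding R_def using \<alpha> c0 by (intro ln_mono) auto
      then show "R \<le> 2 * ln c" using c0 by (simp add: ln_mult)
      have "1 * 1 \<le> \<alpha> * c" using \<alpha> c2 by (intro mult_mono) auto
      then show "0 \<le> R" unfolding R_def by simp
    qed
    let ?l = "eigval c"
    have l0: "0 < ?l n" for n by (rule eigval_facts(1)[OF c0])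
    have l1: "?l n \<le> 1" for n by (rule KDL_eigval_le_1[OF KDL c2])
    define D where "D = real (Lambda_minus (exp (- 2 * u)) c)"
    have small: "exp (- 2 * u) < 1/2"
    proof -
      have "exp (- 2 * u) \<le> exp (- 1)" using u by simp
      then show ?thesis using exp_minus_1_less_half by linarith
    qed
    have upper: "(\<Sum>n\<in>F. excess u (?l n)) \<le> u * (A * R * S + 2)"
      if F: "finite F" and lF: "\<And>n. n \<in> F \<Longrightarrow> 1/2 < ?l n" for F
    proof -
      \<comment> \<open>Counts near 1 are available only for k \<le> c, so the layers stop there.
        The remainder is bounded, since at most 2 * c eigenvalues exceed 1/2 and c * exp (1 - c)
        \<le> 1.\<close>
      define m where "m = nat \<lfloor>c\<rfloor>"
      have m: "real m \<le> c" "c < real m + 1" using c0 by (auto simp: m_def)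
      have "(\<Sum>n\<in>F. 1 - ?l n) \<le> real (card F) * exp (- real m) +
          (\<Sum>k\<in>{0<..m}. exp (1 - real k) * (A * real k * R))"
      proof (rule sum_exp_layer_bound[OF F])
        show "1 - ?l n \<le> exp (- real 0)" for n using l0[of n] by simp
        fix k assume k: "0 < k" "k \<le> m"
        have "{n \<in> F. exp (- real k) < 1 - ?l n} \<subseteq> {n. 1/2 < ?l n \<and> ?l n \<le> 1 - exp (- real k)}"
          using lF by auto
        moreover have "finite {n. 1/2 < ?l n \<and> ?l n \<le> 1 - exp (- real k)}"
          by (rule finite_subset[OF _ finite_eigval_gt[OF c0, of "1/2"]]) auto
        ultimately have "card {n \<in> F. exp (- real k) < 1 - ?l n} \<le> Lambda_plus (exp (- real k)) c"
          unfolding Lambda_plus_def by (intro card_mono)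
        also have "real (Lambda_plus (exp (- real k)) c) \<le> A * real k * R"
          unfolding R_def using k m(1) by (intro plus c2) auto
        finally show "real (card {n \<in> F. exp (- real k) < 1 - ?l n}) \<le> A * real k * R" by simp
      qed simp
      also have "real (card F) * exp (- real m) \<le> 2"
      proof -
        have "real (card F) * exp (- real m) \<le> (2 * c) * exp (1 - c)"
          using card_eigval_gt_half[OF c0 F lF] m c0 by (intro mult_mono) auto
        also have "\<dots> \<le> (2 * exp (c - 1)) * exp (1 - c)"
          using exp_ge_add_one_self[of "c - 1"] by (intro mult_right_mono) auto
        also have "\<dots> = 2" by (simp add: exp_add[symmetric])
        finally show ?thesis .
      qed
      also have "(\<Sum>k\<in>{0<..m}. exp (1 - real k) * (A * real k * R)) \<le>
          (\<Sum>k\<in>{0<..m}. (A * R) * (real k * exp (1 - real k / 2)))"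
      proof (rule sum_mono)
        fix k assume "k \<in> {0<..m}"
        have "exp (1 - real k) * (A * real k * R) \<le> exp (1 - real k / 2) * (A * real k * R)"
          using A R by (intro mult_right_mono) auto
        then show "exp (1 - real k) * (A * real k * R) \<le> (A * R) * (real k * exp (1 - real k / 2))"
          by (simp add: mult_ac)
      qed
      also have "\<dots> \<le> A * R * S"
        unfolding sum_distrib_left[symmetric] using A R S(2) by (intro mult_left_mono) auto
      finally have *: "(\<Sum>n\<in>F. 1 - ?l n) \<le> A * R * S + 2" by simp
      have "(\<Sum>n\<in>F. excess u (?l n)) \<le> (\<Sum>n\<in>F. u * (1 - ?l n))"
        using u by (intro sum_mono excess_le_complement l0 l1) auto
      also have "\<dots> = u * (\<Sum>n\<in>F. 1 - ?l n)" by (rule sum_distrib_left[symmetric])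
      also have "\<dots> \<le> u * (A * R * S + 2)" using * u by (intro mult_left_mono) auto
      finally show ?thesis .
    qed
    have middle: "(\<Sum>n\<in>F. excess u (?l n)) \<le> u * D"
      if F: "finite F" and lF: "\<And>n. n \<in> F \<Longrightarrow> exp (- 2 * u) < ?l n \<and> ?l n \<le> 1/2" for F
    proof -
      have "excess u (?l n) \<le> u" for n
      proof -
        have "u * (1 - ?l n) \<le> u * 1" using l0[of n] u by (intro mult_left_mono) auto
        then show ?thesis using excess_le_complement[OF l0 l1, of u n] u by linarith
      qed
      then have "(\<Sum>n\<in>F. excess u (?l n)) \<le> (\<Sum>n\<in>F. u)" by (intro sum_mono)
      also have "\<dots> = u * real (card F)" by simp
      also have "\<dots> \<le> u * D"
      proof -
        have "finite {n. exp (- 2 * u) < ?l n \<and> ?l n \<le> 1/2}"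
          by (rule finite_subset[OF _ finite_eigval_gt[OF c0, of "exp (- 2 * u)"]]) auto
        then have "card F \<le> Lambda_minus (exp (- 2 * u)) c"
          unfolding Lambda_minus_def by (intro card_mono) (use lF in auto)
        then show ?thesis using u unfolding D_def by (intro mult_left_mono) auto
      qed
      finally show ?thesis .
    qed
    have lower: "(\<Sum>n\<in>F. excess u (?l n)) \<le> A * R * S + 1"
      if F: "finite F" and lF: "\<And>n. n \<in> F \<Longrightarrow> ?l n \<le> exp (- 2 * u)" for F
    proof -
      \<comment> \<open>Rounding down ensures that every layer k > p satisfies k > 2 * u, while
        still p \<ge> u because u \<ge> 1.\<close>
      define p where "p = nat \<lfloor>2 * u\<rfloor>"
      have p: "real p \<le> 2 * u" "2 * u < real p + 1" using u by (auto simp: p_def)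
      \<comment> \<open>The extra \<open>card F\<close> layers make the remainder card F * exp (- m)
        at most exp (- p), however large \<open>F\<close> is.\<close>
      define m where "m = p + card F"
      have "(\<Sum>n\<in>F. ?l n) \<le> real (card F) * exp (- real m) +
          (\<Sum>k\<in>{p<..m}. exp (1 - real k) * (A * real k * R))"
      proof (rule sum_exp_layer_bound[OF F])
        have "exp (- 2 * u) \<le> exp (- real p)" using p by simp
        then show "?l n \<le> exp (- real p)" if "n \<in> F" for n using lF[OF that] by linarith
        fix k assume k: "p < k" "k \<le> m"
        have "{n \<in> F. exp (- real k) < ?l n} \<subseteq> {n. exp (- real k) < ?l n \<and> ?l n \<le> 1/2}"
          using lF small by fastforce
        moreover have "finite {n. exp (- real k) < ?l n \<and> ?l n \<le> 1/2}"
          by (rule finite_subset[OF _ finite_eigval_gt[OF c0, of "exp (- real k)"]]) auto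
        ultimately have "card {n \<in> F. exp (- real k) < ?l n} \<le> Lambda_minus (exp (- real k)) c"
          unfolding Lambda_minus_def by (intro card_mono)
        also have "real (Lambda_minus (exp (- real k)) c) \<le> A * real k * R"
          unfolding R_def using k by (intro minus c2) auto
        finally show "real (card {n \<in> F. exp (- real k) < ?l n}) \<le> A * real k * R" by simp
      qed (simp add: m_def)
      also have "real (card F) * exp (- real m) \<le> exp (- u)"
      proof -
        have "real (card F) * exp (- real m) \<le> exp (real (card F)) * exp (- real m)"
          using exp_ge_add_one_self[of "real (card F)"] by (intro mult_right_mono) (linarith, simp)
        also have "\<dots> = exp (- real p)" by (simp add: m_def exp_add[symmetric])
        also have "\<dots> \<le> exp (- u)" using p u by simp
        finally show ?thesis .
      qed
      also have "(\<Sum>k\<in>{p<..m}. exp (1 - real k) * (A * real k * R)) \<le>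
          (\<Sum>k\<in>{p<..m}. (exp (- u) * (A * R)) * (real k * exp (1 - real k / 2)))"
      proof (rule sum_mono)
        fix k assume "k \<in> {p<..m}"
        then have "2 * u < real k" using p by simp
        then have "exp (1 - real k) * (A * real k * R) \<le> (exp (- u) * exp (1 - real k / 2)) * (A * real k * R)"
          using A R by (intro mult_right_mono exp_less_layer_index) auto
        then show "exp (1 - real k) * (A * real k * R) \<le> (exp (- u) * (A * R)) * (real k * exp (1 - real k / 2))"
          by (simp add: mult_ac)
      qed
      also have "\<dots> \<le> (exp (- u) * (A * R)) * S"
        unfolding sum_distrib_left[symmetric] using A R S(2) by (intro mult_left_mono) auto
      finally have *: "(\<Sum>n\<in>F. ?l n) \<le> exp (- u) * (A * R * S + 1)" by (simp add: algebra_simps)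
      have "(\<Sum>n\<in>F. excess u (?l n)) \<le> (\<Sum>n\<in>F. exp u * ?l n)"
        using u by (intro sum_mono excess_le_exp l0) auto
      also have "\<dots> = exp u * (\<Sum>n\<in>F. ?l n)" by (rule sum_distrib_left[symmetric])
      \<comment> \<open>The threshold exp (- 2 * u) left a factor exp (- u) in the sum, which now
        cancels the weight exp u.\<close>
      also have "\<dots> \<le> exp u * (exp (- u) * (A * R * S + 1))" using * by (intro mult_left_mono) auto
      also have "\<dots> = A * R * S + 1" by (simp add: exp_minus)
      finally show ?thesis .
    qed
    have partial: "(\<Sum>n<N. excess u (?l n)) \<le> u * D + B * u * ln c" for N
    proof -
      let ?F1 = "{n \<in> {..<N}. 1/2 < ?l n}" and ?F2 = "{n \<in> {..<N}. exp (- 2 * u) < ?l n \<and> ?l n \<le> 1/2}"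
        and ?F3 = "{n \<in> {..<N}. ?l n \<le> exp (- 2 * u)}"
      have "(\<Sum>n<N. excess u (?l n)) = (\<Sum>n\<in>(?F1 \<union> ?F2) \<union> ?F3. excess u (?l n))"
        by (rule sum.cong) auto
      also have "\<dots> = (\<Sum>n\<in>?F1. excess u (?l n)) + (\<Sum>n\<in>?F2. excess u (?l n)) + (\<Sum>n\<in>?F3. excess u (?l n))"
        using small by (subst sum.union_disjoint; (subst sum.union_disjoint)?) auto
      also have "\<dots> \<le> u * (A * R * S + 2) + u * D + (A * R * S + 1)"
        by (intro add_mono upper middle lower) auto
      also have "\<dots> \<le> u * (A * R * S + 2) + u * D + u * (A * R * S + 1)"
        using mult_right_mono[OF u, of "A * R * S + 1"] A R S(1) by simp
      also have "\<dots> = u * D + u * (2 * (A * S) * R + 3)" by (simp add: algebra_simps)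
      also have "\<dots> \<le> u * D + u * (B * ln c)"
      proof -
        have "2 * (A * S) * R \<le> 2 * (A * S) * (2 * ln c)" using R A S(1) by (intro mult_left_mono) auto
        then have "2 * (A * S) * R + 3 \<le> B * ln c" using lnc by (simp add: B_def algebra_simps)
        then show ?thesis using u by (intro add_left_mono mult_left_mono) auto
      qed
      finally show ?thesis by (simp add: mult_ac)
    qed
    have "(\<lambda>N. \<Sum>n<N. excess u (?l n)) \<longlonglongrightarrow> ln (fredholm_det c sinc_kernel (exp u - 1)) - u * c"
      using eigval_facts(3)[OF c0, of u] u by (simp add: sums_def)
    from LIMSEQ_le_const2[OF this] show ?thesis using partial unfolding D_def by blast
  qed
  have "0 < B" using A S(1) by (simp add: B_def add_pos_pos)
  then show thesis using that main by blast
qed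

text \<open>Only eigenvalues between exp (- u / 4) and 1/2 are kept, each worth u / 4; the discarded
  terms are nonnegative because eigenvalues are at most 1.\<close>

lemma excess_lower_bound:
  assumes KDL: "KDL_constant \<alpha>" and c: "2 \<le> c" and u: "0 \<le> u"
  shows "u / 4 * real (Lambda_minus (exp (- (u / 4))) c) \<le>
    ln (fredholm_det c sinc_kernel (exp u - 1)) - u * c"
proof -
  have c0: "0 < c" using c by simp
  let ?F = "{n. exp (- (u / 4)) < eigval c n \<and> eigval c n \<le> 1/2}"
  have fin: "finite ?F"
    by (rule finite_subset[OF _ finite_eigval_gt[OF c0, of "exp (- (u / 4))"]]) auto
  have s: "(\<lambda>n. excess u (eigval c n)) sums (ln (fredholm_det c sinc_kernel (exp u - 1)) - u * c)"
    by (rule eigval_facts(3)[OF c0 u])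
  have "u / 4 * real (Lambda_minus (exp (- (u / 4))) c) = (\<Sum>n\<in>?F. u / 4)"
    by (simp add: Lambda_minus_def)
  also have "\<dots> \<le> (\<Sum>n\<in>?F. excess u (eigval c n))"
    using u by (intro sum_mono excess_ge_quarter) auto
  also have "\<dots> \<le> suminf (\<lambda>n. excess u (eigval c n))"
    by (rule sum_le_suminf[OF sums_summable[OF s] fin])
       (rule excess_nonneg[OF less_imp_le[OF eigval_facts(1)[OF c0]] KDL_eigval_le_1[OF KDL c]])
  finally show ?thesis using s by (simp add: sums_iff)
qed

section \<open>Passing between the counting bound and the determinant bound\<close>

lemma eventually_linear_ln_le_sqrt:
  obtains c\<^sub>1 where "\<And>c. c\<^sub>1 \<le> c \<Longrightarrow> a * ln c \<le> sqrt (c::real)"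
proof -
  have "((\<lambda>x::real. (2 * a) * (ln (sqrt x) / sqrt x)) \<longlongrightarrow> 0) at_top"
    by (intro tendsto_mult_right_zero filterlim_compose[OF ln_x_over_x_tendsto_0 sqrt_at_top])
  then have "\<forall>\<^sub>F x in at_top. (2 * a) * (ln (sqrt x) / sqrt x) < 1" by (rule order_tendstoD) simp
  moreover have "\<forall>\<^sub>F x::real in at_top. 0 < x" by (rule eventually_gt_at_top)
  ultimately have "\<forall>\<^sub>F x in at_top. a * ln x \<le> sqrt x"
    by eventually_elim (simp add: field_simps ln_sqrt)
  then show thesis using that unfolding eventually_at_top_linorder by blast
qed

theorem corollary1p19:
  fixes \<alpha>\<^sub>1 :: real
  assumes "KDL_constant \<alpha>\<^sub>1"
  shows
    "(\<exists>(\<alpha>::real) (\<delta>\<^sub>0::real) (\<kappa>::real) (C::real) (c\<^sub>0::real).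
        \<alpha> \<ge> 4 \<and> 0 < \<delta>\<^sub>0 \<and> \<delta>\<^sub>0 < 1/2 \<and> \<kappa> > 0 \<and>
        (\<forall>c\<ge>c\<^sub>0. \<forall>\<delta>. \<alpha> powr (- c) < \<delta> \<and> \<delta> \<le> \<delta>\<^sub>0 \<longrightarrow>
           real (Lambda_minus \<delta> c) \<ge> \<kappa> * ln (1/\<delta>) * ln (\<alpha> * c / ln (1/\<delta>)) - C))
     \<longleftrightarrow>
     (\<exists>(\<kappa>\<^sub>T::real) (L\<^sub>T::real) (c\<^sub>T::real).
        \<kappa>\<^sub>T > 0 \<and>
        (\<forall>c\<ge>c\<^sub>T. \<forall>u. L\<^sub>T \<le> u \<and> u \<le> \<alpha>\<^sub>1 * ln c \<longrightarrow>
           ln (fredholm_det c sinc_kernel (exp u - 1)) \<ge> u * c + \<kappa>\<^sub>T * u\<^sup>2 * ln c))"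
  (is "?i \<longleftrightarrow> ?ii")
proof
  assume ?i
  then obtain \<alpha> \<delta>\<^sub>0 \<kappa> C c\<^sub>0 where \<alpha>: "4 \<le> \<alpha>" and \<delta>\<^sub>0: "0 < \<delta>\<^sub>0" "\<delta>\<^sub>0 < 1/2" and \<kappa>: "0 < \<kappa>"
    and D: "\<And>c \<delta>. c\<^sub>0 \<le> c \<Longrightarrow> \<alpha> powr (- c) < \<delta> \<Longrightarrow> \<delta> \<le> \<delta>\<^sub>0 \<Longrightarrow>
      \<kappa> * ln (1/\<delta>) * ln (\<alpha> * c / ln (1/\<delta>)) - C \<le> real (Lambda_minus \<delta> c)"
    by blast
  \<comment> \<open>Thus u \<le> sqrt c for large c, which makes ln (\<alpha> * c / (u / 4)) at
    least half of ln c.\<close>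
  obtain c\<^sub>1 where c\<^sub>1: "\<And>c. c\<^sub>1 \<le> c \<Longrightarrow> \<alpha>\<^sub>1 * ln c \<le> sqrt c"
    using eventually_linear_ln_le_sqrt by blast
  \<comment> \<open>For u \<ge> L the second entry lets half of the main term absorb
    \<open>C\<close>, and the third gives exp (- u / 4) \<le>
    \<open>\<delta>\<^sub>0\<close>.\<close>
  define L where "L = Max {1, 16 * C / \<kappa>, 4 * ln (1/\<delta>\<^sub>0)}"
  have L: "1 \<le> L" "16 * C / \<kappa> \<le> L" "4 * ln (1/\<delta>\<^sub>0) \<le> L" by (simp_all add: L_def)
  \<comment> \<open>The count is at least \<kappa> * (u / 4) * (ln c / 2) - C; half of the main term
    is spent on \<open>C\<close>, and each counted eigenvalue is worth u / 4, whence 1 / 64.\<close>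
  have main: "u * c + \<kappa> / 64 * u\<^sup>2 * ln c \<le> ln (fredholm_det c sinc_kernel (exp u - 1))"
    if c: "Max {4, c\<^sub>0, c\<^sub>1} \<le> c" and u: "L \<le> u" "u \<le> \<alpha>\<^sub>1 * ln c" for c u
  proof -
    have c4: "4 \<le> c" and c0: "c\<^sub>0 \<le> c" and us: "u \<le> sqrt c" and u1: "1 \<le> u"
      using c u c\<^sub>1[of c] L by auto
    have lnc: "1 \<le> ln c" using ln_KDL_gt_1[OF c4] by simp
    have "sqrt c \<le> sqrt (c * c)" using c4 by (intro real_sqrt_le_mono) auto
    then have uc: "u \<le> c" using us c4 by simp
    have "\<kappa> * (u / 4) * (ln c / 2) - C \<le> real (Lambda_minus (exp (- (u / 4))) c)"
    proof -
      have "c * 1 \<le> c * ln \<alpha>" using ln_KDL_gt_1[OF \<alpha>] c4 by (intro mult_left_mono) auto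
      then have "u / 4 < c * ln \<alpha>" using uc u1 by linarith
      then have e1: "\<alpha> powr (- c) < exp (- (u / 4))"
        using \<alpha> by (subst powr_neg_less_exp_neg_iff) auto
      have e2: "exp (- (u / 4)) \<le> \<delta>\<^sub>0"
      proof -
        have "- (u / 4) \<le> ln \<delta>\<^sub>0" using L(3) u \<delta>\<^sub>0 by (simp add: ln_div)
        then have "exp (- (u / 4)) \<le> exp (ln \<delta>\<^sub>0)" by simp
        then show ?thesis using \<delta>\<^sub>0 by simp
      qed
      have e3: "ln (1 / exp (- (u / 4))) = u / 4" by (simp add: exp_minus inverse_eq_divide[symmetric])
      have "\<kappa> * (u / 4) * ln (\<alpha> * c / (u / 4)) - C \<le> real (Lambda_minus (exp (- (u / 4))) c)"
        using D[OF c0 e1 e2] unfolding e3 .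
      moreover have "ln c / 2 \<le> ln (\<alpha> * c / (u / 4))"
      proof -
        have "u * sqrt c \<le> sqrt c * sqrt c" using us c4 by (intro mult_right_mono) auto
        also have "\<dots> \<le> \<alpha> * c * 4" using c4 \<alpha> by simp
        finally have "sqrt c \<le> \<alpha> * c / (u / 4)" using u1 by (simp add: field_simps)
        then have "ln (sqrt c) \<le> ln (\<alpha> * c / (u / 4))" using c4 by (intro ln_mono) auto
        then show ?thesis using c4 by (simp add: ln_sqrt)
      qed
      then have "\<kappa> * (u / 4) * (ln c / 2) \<le> \<kappa> * (u / 4) * ln (\<alpha> * c / (u / 4))"
        using \<kappa> u1 by (intro mult_left_mono) auto
      ultimately show ?thesis by linarith
    qed
    moreover have "C \<le> \<kappa> * u / 16 * ln c"
    proof -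
      have "16 * C / \<kappa> \<le> u" using L(2) u(1) by linarith
      then have "C \<le> \<kappa> * u / 16" using \<kappa> by (simp add: field_simps)
      also have "\<dots> \<le> \<kappa> * u / 16 * ln c" using mult_left_mono[OF lnc, of "\<kappa> * u / 16"] \<kappa> u1 by simp
      finally show ?thesis .
    qed
    ultimately have "\<kappa> * u / 16 * ln c \<le> real (Lambda_minus (exp (- (u / 4))) c)"
      by (simp add: field_simps)
    then have "u / 4 * (\<kappa> * u / 16 * ln c) \<le> u / 4 * real (Lambda_minus (exp (- (u / 4))) c)"
      using u1 by (intro mult_left_mono) auto
    also have "\<dots> \<le> ln (fredholm_det c sinc_kernel (exp u - 1)) - u * c"
      using excess_lower_bound[OF assms, of c u] c4 u1 by simp
    finally show ?thesis by (simp add: power2_eq_square field_simps)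
  qed
  show ?ii
    by (intro exI[of _ "\<kappa> / 64"] exI[of _ L] exI[of _ "Max {4, c\<^sub>0, c\<^sub>1}"])
       (use \<kappa> main in simp)
next
  assume ?ii
  then obtain \<kappa> L c\<^sub>T where \<kappa>: "0 < \<kappa>"
    and det: "\<And>c u. c\<^sub>T \<le> c \<Longrightarrow> L \<le> u \<Longrightarrow> u \<le> \<alpha>\<^sub>1 * ln c \<Longrightarrow>
      u * c + \<kappa> * u\<^sup>2 * ln c \<le> ln (fredholm_det c sinc_kernel (exp u - 1))" by blast
  have \<alpha>: "4 \<le> \<alpha>\<^sub>1" using assms by (simp add: KDL_constant_def)
  obtain B where B: "0 < B" and ub: "\<And>c u. \<alpha>\<^sub>1 \<le> c \<Longrightarrow> 1 \<le> u \<Longrightarrow>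
      ln (fredholm_det c sinc_kernel (exp u - 1)) - u * c \<le>
        u * real (Lambda_minus (exp (- 2 * u)) c) + B * u * ln c"
    using excess_upper_bound[OF assms] by blast
  obtain a where a: "0 < a" and
    "\<forall>c\<ge>2. \<forall>\<epsilon>. \<alpha>\<^sub>1 powr (- c) < \<epsilon> \<and> \<epsilon> < 1/2 \<and> \<epsilon> < c powr (- \<alpha>\<^sub>1) \<longrightarrow>
      a * (ln (1/\<epsilon>) * ln (\<alpha>\<^sub>1 * c / ln (1/\<epsilon>))) \<le> real (Lambda_plus \<epsilon> c) \<and>
      a * (ln (1/\<epsilon>) * ln (\<alpha>\<^sub>1 * c / ln (1/\<epsilon>))) \<le> real (Lambda_minus \<epsilon> c)"
    using assms unfolding KDL_constant_def by blast
  then have lb: "a * (ln (1/\<epsilon>) * ln (\<alpha>\<^sub>1 * c / ln (1/\<epsilon>))) \<le> real (Lambda_minus \<epsilon> c)"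
    if "2 \<le> c" "\<alpha>\<^sub>1 powr (- c) < \<epsilon>" "\<epsilon> < 1/2" "\<epsilon> < c powr (- \<alpha>\<^sub>1)" for c \<epsilon>
    using that by simp
  \<comment> \<open>For u \<ge> L' the entry 2 * B / \<kappa> makes the error B * u * ln c at most
    half of \<kappa> * u^2 * ln c.\<close>
  define L' where "L' = Max {1, L, 2 * B / \<kappa>}"
  have L': "1 \<le> L'" "L \<le> L'" "2 * B / \<kappa> \<le> L'" by (simp_all add: L'_def)
  define \<delta>\<^sub>0 where "\<delta>\<^sub>0 = exp (- 2 * L')"
  have \<delta>\<^sub>0: "0 < \<delta>\<^sub>0" "\<delta>\<^sub>0 < 1/2"
  proof -
    have "\<delta>\<^sub>0 \<le> exp (- 1)" using L'(1) by (simp add: \<delta>\<^sub>0_def)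
    then show "\<delta>\<^sub>0 < 1/2" using exp_minus_1_less_half by linarith
  qed (simp add: \<delta>\<^sub>0_def)
  \<comment> \<open>With u = l / 2 one has Q \<le> 2 * l * ln c = 4 * u * ln c, and the surviving
    half of the determinant bound is \<kappa> * u * ln c / 2; this explains \<kappa> / 8. No
    additive constant is lost, so (i) is obtained with C = 0.\<close>
  have main: "min (\<kappa> / 8) a * ln (1/\<delta>) * ln (\<alpha>\<^sub>1 * c / ln (1/\<delta>)) - 0 \<le> real (Lambda_minus \<delta> c)"
    if c: "max \<alpha>\<^sub>1 c\<^sub>T \<le> c" and \<delta>: "\<alpha>\<^sub>1 powr (- c) < \<delta>" "\<delta> \<le> \<delta>\<^sub>0" for c \<delta>
  proof -
    have c\<alpha>: "\<alpha>\<^sub>1 \<le> c" and cT: "c\<^sub>T \<le> c" and c4: "4 \<le> c" using c \<alpha> by auto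
    have lnc: "1 \<le> ln c" using ln_KDL_gt_1[OF c4] by simp
    have \<delta>pos: "0 < \<delta>" using \<delta>(1) powr_ge_zero[of \<alpha>\<^sub>1 "- c"] by linarith
    define l where "l = ln (1/\<delta>)"
    have \<delta>l: "\<delta> = exp (- l)" using \<delta>pos by (simp add: l_def ln_div)
    have l2: "2 * L' \<le> l" using \<delta>(2) unfolding \<delta>l \<delta>\<^sub>0_def by simp
    have lc: "l < c * ln \<alpha>\<^sub>1" using \<delta>(1) \<alpha> unfolding \<delta>l by (simp add: powr_neg_less_exp_neg_iff)
    have l1: "1 \<le> l" using l2 L'(1) by linarith
    define Q where "Q = l * ln (\<alpha>\<^sub>1 * c / l)"
    \<comment> \<open>Nonnegativity of \<open>Q\<close> is what allows both cases to be weakened to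
      the smaller constant.\<close>
    have Q0: "0 \<le> Q"
    proof -
      have "l < c * \<alpha>\<^sub>1"
        using lc mult_left_mono[of "ln \<alpha>\<^sub>1" \<alpha>\<^sub>1 c] ln_le_minus_one[of \<alpha>\<^sub>1] \<alpha> c4 by linarith
      then have "1 \<le> \<alpha>\<^sub>1 * c / l" using l1 by (simp add: field_simps)
      then show ?thesis unfolding Q_def using l1 by simp
    qed
    have "min (\<kappa> / 8) a * Q \<le> real (Lambda_minus \<delta> c)"
    \<comment> \<open>In the first case u = l / 2 lies in the range of the determinant bound.
      Otherwise l also exceeds \<open>\<alpha>\<^sub>1 * ln c\<close>, so \<delta> is below
      \<open>c powr (- \<alpha>\<^sub>1)\<close> and the known lower bound applies.\<close>
    proof (cases "l / 2 \<le> \<alpha>\<^sub>1 * ln c")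
      case True
      define u where "u = l / 2"
      have u: "1 \<le> u" "L \<le> u" "2 * B / \<kappa> \<le> u" using l2 L' by (auto simp: u_def)
      have e: "exp (- 2 * u) = \<delta>" by (simp add: u_def \<delta>l)
      have "\<kappa> * u\<^sup>2 * ln c \<le> u * real (Lambda_minus \<delta> c) + B * u * ln c"
        using det[OF cT u(2)] ub[OF c\<alpha> u(1)] True unfolding e by (simp add: u_def[symmetric])
      then have "u * (\<kappa> * u * ln c - B * ln c) \<le> u * real (Lambda_minus \<delta> c)"
        by (simp add: power2_eq_square algebra_simps)
      then have "\<kappa> * u * ln c - B * ln c \<le> real (Lambda_minus \<delta> c)" using u(1) by simp
      moreover have "B * ln c \<le> \<kappa> * u / 2 * ln c"
        using u(3) \<kappa> lnc by (intro mult_right_mono) (auto simp: field_simps)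
      ultimately have D: "\<kappa> * u / 2 * ln c \<le> real (Lambda_minus \<delta> c)" by simp
      have "ln (\<alpha>\<^sub>1 * c / l) \<le> ln (c * c)"
      proof (rule ln_mono)
        have "\<alpha>\<^sub>1 * c / l \<le> \<alpha>\<^sub>1 * c / 1" using l1 \<alpha> c4 by (intro divide_left_mono) auto
        also have "\<dots> \<le> c * c" using c\<alpha> c4 by (simp add: mult_right_mono)
        finally show "\<alpha>\<^sub>1 * c / l \<le> c * c" .
      qed (use \<alpha> c4 l1 in auto)
      then have "Q \<le> l * (2 * ln c)" unfolding Q_def using l1 c4 by (intro mult_left_mono) (auto simp: ln_mult)
      then have "\<kappa> / 8 * Q \<le> \<kappa> / 8 * (l * (2 * ln c))" using \<kappa> by (intro mult_left_mono) auto
      also have "\<dots> = \<kappa> * u / 2 * ln c" by (simp add: u_def)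
      also have "\<dots> \<le> real (Lambda_minus \<delta> c)" by (rule D)
      finally have "\<kappa> / 8 * Q \<le> real (Lambda_minus \<delta> c)" .
      moreover have "min (\<kappa> / 8) a * Q \<le> \<kappa> / 8 * Q" using Q0 by (intro mult_right_mono) auto
      ultimately show ?thesis by linarith
    next
      case False
      have "0 \<le> \<alpha>\<^sub>1 * ln c" using \<alpha> lnc by simp
      then have "\<alpha>\<^sub>1 * ln c < l" using False by linarith
      then have "\<delta> < c powr (- \<alpha>\<^sub>1)" using c4 unfolding \<delta>l by (simp add: powr_def)
      moreover have "\<delta> < 1/2" using \<delta>(2) \<delta>\<^sub>0 by linarith
      ultimately have "a * Q \<le> real (Lambda_minus \<delta> c)"
        unfolding Q_def l_def using \<delta>(1) c4 by (intro lb) auto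
      moreover have "min (\<kappa> / 8) a * Q \<le> a * Q" using Q0 by (intro mult_right_mono) auto
      ultimately show ?thesis by linarith
    qed
    then show ?thesis by (simp add: Q_def l_def mult.assoc)
  qed
  show ?i
  proof (intro exI conjI allI impI)
    show "4 \<le> \<alpha>\<^sub>1" "0 < \<delta>\<^sub>0" "\<delta>\<^sub>0 < 1/2" by (rule \<alpha> \<delta>\<^sub>0)+
    show "0 < min (\<kappa> / 8) a" using \<kappa> a by simp
    show "min (\<kappa> / 8) a * ln (1/\<delta>) * ln (\<alpha>\<^sub>1 * c / ln (1/\<delta>)) - 0 \<le> real (Lambda_minus \<delta> c)"
      if "max \<alpha>\<^sub>1 c\<^sub>T \<le> c" "\<alpha>\<^sub>1 powr (- c) < \<delta> \<and> \<delta> \<le> \<delta>\<^sub>0" for c \<delta>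
      using that by (intro main) auto
  qed
qed

end
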